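(* Let $k=k_n$ and $q=q_n$ depend on $n$ and suppose that $k\to+\infty$, $k/n\to0$ and $q\to+\infty$ as $n\to+\infty$, that $\mu>0$ on $[0,1]$, and that $s$ is $C$-Lipschitz on $[0,1]$. Then the variance of a purely uniformly random forest (PURF) satisfies $$\mathbb{E}\big[(\hat{s}(X)-\tilde{s}(X))^2\big]\leq\frac{3}{4}\,\frac{\sigma^2(k+1)}{n}+o\Big(\frac{k}{n}\Big)\quad (n\to+\infty).$$
   Context: Model: $(X_1,Y_1),\dots,(X_n,Y_n)$ are i.i.d. copies of $(X,Y)$ (the learning sample $\mathcal{L}_n$), with $Y_i=s(X_i)+\varepsilon_i$, where $s:[0,1]\to\mathbb{R}$ is the (fixed, unknown) regression function, $X\in[0,1]$ has a continuous density $\mu$ on $[0,1]$, and $\varepsilon_1,\dots,\varepsilon_n$ are i.i.d. copies of a real random variable $\varepsilon$, independent of $(X_1,\dots,X_n)$, with $\mathbb{E}[\varepsilon]=0$ and $\mathrm{Var}(\varepsilon)=\sigma^2$. In risks, $X$ denotes a new point with density $\mu$, independent of $\mathcal{L}_n$ and of the random partitions. Trees: for a natural integer $k$ and a vector $\mathbb{U}=(U_1,\dots,U_k)$ of i.i.d. uniform variables on $[0,1]$, independent of $\mathcal{L}_n$ and $X$, with order statistics $U_{(1)}\leq\dots\leq U_{(k)}$ and $U_{(0)}=0$, $U_{(k+1)}=1$, set for $x\in[0,1]$ $$\hat{s}_{\mathbb{U}}(x)=\sum_{j=0}^k\hat\beta_j\mathbf{1}_{U_{(j)}<x\leq U_{(j+1)}},\qquad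 \tilde{s}_{\mathbb{U}}(x)=\sum_{j=0}^k\beta_j\mathbf{1}_{U_{(j)}<x\leq U_{(j+1)}},$$ where $\hat\beta_j$ is the average of the $Y_i$ over the indices $i$ with $U_{(j)}<X_i\leq U_{(j+1)}$ (and $\hat\beta_j=0$ if there are none), and $\beta_j=\mathbb{E}[Y\mid U_{(j)}<X\leq U_{(j+1)}]$, the expectation being over $(X,Y)$ for the given partition. Forest: $\mathbb{U}^1,\dots,\mathbb{U}^q$ are i.i.d. copies of $\mathbb{U}$, independent of $\mathcal{L}_n$ and $X$, and $\hat{s}(x)=\frac1q\sum_{l=1}^q\hat{s}_{\mathbb{U}^l}(x)$, $\tilde{s}(x)=\frac1q\sum_{l=1}^q\tilde{s}_{\mathbb{U}^l}(x)$. The purely uniformly random forest (PURF) is $\hat{s}$; its variance is $\mathbb{E}[(\hat{s}(X)-\tilde{s}(X))^2]$. The notation $o(k/n)$ denotes a function $f(n)$ with $f(n)/(k/n)\to0$ as $n\to+\infty$. *)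

theory Defs
  imports "HOL-Probability.Probability" "HOL-Library.Landau_Symbols"
begin

datatype source = Point nat | Noise nat | Split nat nat

text \<open>
  One sample size \<open>n\<close>, with \<open>q\<close> trees of \<open>k\<close> split points each. Index \<open>0\<close> of \<open>X\<close> and \<open>\<epsilon>\<close> is the
  generic pair, so that \<open>X 0\<close> is also the new point at which the risk is evaluated; indices
  \<open>1..n\<close> are the learning sample. \<open>U l 1, \<dots>, U l k\<close> are the splits of tree \<open>l \<in> {1..q}\<close>.
  The law \<open>N\<close> of the noise is a parameter in order to be shared by the models for different \<open>n\<close>.
  The values of the density \<open>\<mu>\<close> outside \<open>{0..1}\<close> are irrelevant.
\<close>

locale purf_model = prob_space M
  for M :: "'a measure" +
  fixes \<mu> :: "real \<Rightarrow> real" and N :: "real measure" and \<sigma> :: real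
    and n k q :: nat
    and X \<epsilon> :: "nat \<Rightarrow> 'a \<Rightarrow> real" and U :: "nat \<Rightarrow> nat \<Rightarrow> 'a \<Rightarrow> real"
  assumes density_continuous: "continuous_on {0..1} \<mu>"
    and density_nonneg: "\<And>x. x \<in> {0..1} \<Longrightarrow> 0 \<le> \<mu> x"
    and point_range: "\<And>i \<omega>. i \<le> n \<Longrightarrow> \<omega> \<in> space M \<Longrightarrow> X i \<omega> \<in> {0..1}"
    and point_distributed:
      "\<And>i. i \<le> n \<Longrightarrow> distributed M lborel (X i) (\<lambda>x. ennreal (\<mu> x * indicator {0..1} x))"
    and noise_law: "\<And>i. i \<le> n \<Longrightarrow> distr M borel (\<epsilon> i) = N"
    and noise_square_integrable: "integrable M (\<lambda>\<omega>. (\<epsilon> 0 \<omega>)\<^sup>2)"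
    and noise_mean: "expectation (\<epsilon> 0) = 0"
    and noise_variance: "variance (\<epsilon> 0) = \<sigma>\<^sup>2"
    and split_law: "\<And>l j. l \<in> {1..q} \<Longrightarrow> j \<in> {1..k} \<Longrightarrow>
      distr M borel (U l j) = uniform_measure lborel {0..1}"
    and independent: "indep_vars (\<lambda>_. borel) (case_source X \<epsilon> U)
      (Point ` {0..n} \<union> Noise ` {0..n} \<union> case_prod Split ` ({1..q} \<times> {1..k}))"

definition response ::
    "(real \<Rightarrow> real) \<Rightarrow> (nat \<Rightarrow> 'a \<Rightarrow> real) \<Rightarrow> (nat \<Rightarrow> 'a \<Rightarrow> real) \<Rightarrow> nat \<Rightarrow> 'a \<Rightarrow> real" where
  "response s X \<epsilon> i \<omega> = s (X i \<omega>) + \<epsilon> i \<omega>"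

text \<open>Order statistics of \<open>u 1, \<dots>, u k\<close>, with the conventions \<open>u\<^sub>(\<^sub>0\<^sub>) = 0\<close> and \<open>u\<^sub>(\<^sub>k\<^sub>+\<^sub>1\<^sub>) = 1\<close>.\<close>

definition order_stat :: "nat \<Rightarrow> (nat \<Rightarrow> real) \<Rightarrow> nat \<Rightarrow> real" where
  "order_stat k u j = (0 # sort (map u [1..<Suc k]) @ [1]) ! j"

definition cell :: "nat \<Rightarrow> (nat \<Rightarrow> real) \<Rightarrow> nat \<Rightarrow> real set" where
  "cell k u j = {order_stat k u j <.. order_stat k u (Suc j)}"

text \<open>The empirical mean is \<open>0\<close> on a set without sample points, because \<open>0 / 0 = 0\<close>.\<close>

definition empirical_mean ::
    "(real \<Rightarrow> real) \<Rightarrow> nat \<Rightarrow> (nat \<Rightarrow> 'a \<Rightarrow> real) \<Rightarrow> (nat \<Rightarrow> 'a \<Rightarrow> real) \<Rightarrow> 'a \<Rightarrow> real set \<Rightarrow> real" where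
  "empirical_mean s n X \<epsilon> \<omega> A =
     (\<Sum>i | i \<in> {1..n} \<and> X i \<omega> \<in> A. response s X \<epsilon> i \<omega>) / real (card {i \<in> {1..n}. X i \<omega> \<in> A})"

text \<open>The mean of \<open>Y\<close> under the conditional probability given the event \<open>X \<in> A\<close>, for a fixed set \<open>A\<close>.\<close>

definition population_mean ::
    "'a measure \<Rightarrow> (real \<Rightarrow> real) \<Rightarrow> (nat \<Rightarrow> 'a \<Rightarrow> real) \<Rightarrow> (nat \<Rightarrow> 'a \<Rightarrow> real) \<Rightarrow> real set \<Rightarrow> real" where
  "population_mean M s X \<epsilon> A =
     (\<integral>\<omega>. response s X \<epsilon> 0 \<omega> \<partial>uniform_measure M {\<omega> \<in> space M. X 0 \<omega> \<in> A})"

definition tree :: "(real set \<Rightarrow> real) \<Rightarrow> nat \<Rightarrow> (nat \<Rightarrow> real) \<Rightarrow> real \<Rightarrow> real" where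
  "tree b k u x = (\<Sum>j=0..k. b (cell k u j) * indicator (cell k u j) x)"

definition forest ::
    "(real set \<Rightarrow> real) \<Rightarrow> nat \<Rightarrow> nat \<Rightarrow> (nat \<Rightarrow> nat \<Rightarrow> 'a \<Rightarrow> real) \<Rightarrow> 'a \<Rightarrow> real \<Rightarrow> real" where
  "forest b k q U \<omega> x = (\<Sum>l=1..q. tree b k (\<lambda>j. U l j \<omega>) x) / real q"

definition purf_sq_deviation ::
    "'a measure \<Rightarrow> (real \<Rightarrow> real) \<Rightarrow> nat \<Rightarrow> nat \<Rightarrow> nat \<Rightarrow> (nat \<Rightarrow> 'a \<Rightarrow> real) \<Rightarrow> (nat \<Rightarrow> 'a \<Rightarrow> real) \<Rightarrow>
      (nat \<Rightarrow> nat \<Rightarrow> 'a \<Rightarrow> real) \<Rightarrow> 'a \<Rightarrow> real" where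
  "purf_sq_deviation M s n k q X \<epsilon> U \<omega> =
     (forest (empirical_mean s n X \<epsilon> \<omega>) k q U \<omega> (X 0 \<omega>)
      - forest (population_mean M s X \<epsilon>) k q U \<omega> (X 0 \<omega>))\<^sup>2"

definition purf_variance ::
    "'a measure \<Rightarrow> (real \<Rightarrow> real) \<Rightarrow> nat \<Rightarrow> nat \<Rightarrow> nat \<Rightarrow> (nat \<Rightarrow> 'a \<Rightarrow> real) \<Rightarrow> (nat \<Rightarrow> 'a \<Rightarrow> real) \<Rightarrow>
      (nat \<Rightarrow> nat \<Rightarrow> 'a \<Rightarrow> real) \<Rightarrow> real" where
  "purf_variance M s n k q X \<epsilon> U = (\<integral>\<omega>. purf_sq_deviation M s n k q X \<epsilon> U \<omega> \<partial>M)"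

end

theory Submission
  imports Defs
begin

text \<open>
  The error of the forest at the new point is an average over the trees of the error at the cell of
  each tree that contains the point. Given the points and the splits, the responses differ from the
  regression function by centred noise, so the variance splits into the part of the noise and a
  remainder that is independent of the noise (\<^verbatim>\<open>purf_variance_le\<close>).

  The part of the noise is \<open>\<sigma>\<^sup>2 / q\<^sup>2\<close> times a sum over pairs of trees of
  \<open>#(A \<inter> A') / (#A \<cdot> #A')\<close>, where \<open>#\<close> counts sample points and \<open>A\<close>, \<open>A'\<close> are the two cells. The \<open>q\<close>
  diagonal pairs contribute \<open>O(k / (n q))\<close>. For different trees the ratio is at most the smaller of
  \<open>1 / #A\<close> and \<open>1 / #A'\<close>, which is the decisive loss and also what makes the proof short: its mean is
  about \<open>1 / (n \<mu>(x) L)\<close>, where \<open>L\<close> is the length of the longer cell. The two cell lengths are independent,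
  hence \<open>E[1 / L]\<close> is the integral of \<open>(F t / t)\<^sup>2\<close>, where \<open>F\<close> is the distribution function of the length
  of one cell. Away from the boundary \<open>F t\<close> is at most \<open>G t - t G' t\<close> with \<open>G t = 1 - (1 - t)\<^sup>k\<close>, and
  \<open>(G / t - G')\<^sup>2 = (G')\<^sup>2 - (G\<^sup>2 / t)'\<close> has an elementary primitive: the integral is about \<open>k / 2\<close>
  (\<^verbatim>\<open>short_cell_bound_integral\<close>). After integration against \<open>\<mu>\<close> the factor \<open>1 / \<mu>(x)\<close> disappears and one
  obtains \<open>\<sigma>\<^sup>2 k / (2 n)\<close>.

  The gap between \<open>1/2\<close> and \<open>3/4\<close> absorbs the remaining losses at a fixed rate: a factor \<open>5/4\<close> for the
  oscillation of \<open>\<mu>\<close> over a short cell, and the points at distance less than \<open>d\<close> from the boundary,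
  where only \<open>E[1 / L] \<le> 2 k\<close> is used, for a small \<open>d\<close> that does not depend on \<open>n\<close>.

  The remainder is handled tree by tree. In a nonempty cell it is the mean of centred independent terms
  bounded by \<open>C\<close> times the length of the cell, which gives \<open>O(1 / n)\<close>. In an empty cell it is bounded,
  and the probability that the cell of a point is empty is \<open>O((k / n)\<^sup>2)\<close> away from the boundary and
  \<open>O(k / n)\<close> near it; since \<open>d\<close> is arbitrary, the total is \<open>o(k / n)\<close>.
\<close>

section \<open>The cell of a partition that contains a point\<close>

text \<open>
  The index \<open>0\<close> and the splits on the other side of \<open>x\<close> contribute the endpoint of the unit interval, so
  that the maximum and the minimum are taken over nonempty sets.
\<close>

definition lower_split :: "nat \<Rightarrow> (nat \<Rightarrow> real) \<Rightarrow> real \<Rightarrow> real" where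
  "lower_split k u x = Max ((\<lambda>j. if j \<in> {1..k} \<and> u j < x then u j else 0) ` {0..k})"

definition upper_split :: "nat \<Rightarrow> (nat \<Rightarrow> real) \<Rightarrow> real \<Rightarrow> real" where
  "upper_split k u x = Min ((\<lambda>j. if j \<in> {1..k} \<and> x \<le> u j then u j else 1) ` {0..k})"

abbreviation cell_at :: "nat \<Rightarrow> (nat \<Rightarrow> real) \<Rightarrow> real \<Rightarrow> real set" where
  "cell_at k u x \<equiv> {lower_split k u x <.. upper_split k u x}"

definition cell_length :: "nat \<Rightarrow> (nat \<Rightarrow> real) \<Rightarrow> real \<Rightarrow> real" where
  "cell_length k u x = upper_split k u x - lower_split k u x"

lemma lower_split_measurable [measurable (raw)]:
  assumes "\<And>j. j \<in> {1..k} \<Longrightarrow> (\<lambda>z. u z j) \<in> borel_measurable N" and "x \<in> borel_measurable N"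
  shows "(\<lambda>z. lower_split k (u z) (x z)) \<in> borel_measurable N"
  unfolding lower_split_def
proof (rule borel_measurable_Max)
  fix j assume "j \<in> {0..k}"
  show "(\<lambda>z. if j \<in> {1..k} \<and> u z j < x z then u z j else 0) \<in> borel_measurable N"
  proof (cases "j \<in> {1..k}")
    case True
    note [measurable] = assms(1)[OF True] assms(2)
    show ?thesis using True by simp
  next
    case False
    then have "(\<lambda>z. if j \<in> {1..k} \<and> u z j < x z then u z j else 0) = (\<lambda>_. 0)" by auto
    then show ?thesis by simp
  qed
qed simp

lemma upper_split_measurable [measurable (raw)]:
  assumes "\<And>j. j \<in> {1..k} \<Longrightarrow> (\<lambda>z. u z j) \<in> borel_measurable N" and "x \<in> borel_measurable N"
  shows "(\<lambda>z. upper_split k (u z) (x z)) \<in> borel_measurable N"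
  unfolding upper_split_def
proof (rule borel_measurable_Min)
  fix j assume "j \<in> {0..k}"
  show "(\<lambda>z. if j \<in> {1..k} \<and> x z \<le> u z j then u z j else 1) \<in> borel_measurable N"
  proof (cases "j \<in> {1..k}")
    case True
    note [measurable] = assms(1)[OF True] assms(2)
    show ?thesis using True by simp
  next
    case False
    then have "(\<lambda>z. if j \<in> {1..k} \<and> x z \<le> u z j then u z j else 1) = (\<lambda>_. 1)" by auto
    then show ?thesis by simp
  qed
qed simp

lemma lower_split_nonneg: "0 \<le> lower_split k u x"
  unfolding lower_split_def by (intro Max_ge) (auto intro!: image_eqI[where x = 0])

lemma upper_split_le_1: "upper_split k u x \<le> 1"
  unfolding upper_split_def by (intro Min_le) (auto intro!: image_eqI[where x = 0])

lemma lower_split_less_iff: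
  assumes "0 \<le> a"
  shows "a < lower_split k u x \<longleftrightarrow> (\<exists>j\<in>{1..k}. a < u j \<and> u j < x)"
  using assms unfolding lower_split_def by (subst Max_gr_iff) (auto split: if_splits)

lemma upper_split_less_iff:
  assumes "a \<le> 1"
  shows "upper_split k u x < a \<longleftrightarrow> (\<exists>j\<in>{1..k}. x \<le> u j \<and> u j < a)"
  using assms unfolding upper_split_def by (subst Min_less_iff) (auto split: if_splits)

lemma lower_split_less: "0 < x \<Longrightarrow> lower_split k u x < x"
  unfolding lower_split_def by (subst Max_less_iff) auto

lemma upper_split_ge: "x \<le> 1 \<Longrightarrow> x \<le> upper_split k u x"
  unfolding upper_split_def by (subst Min_ge_iff) auto

lemma lower_split_le_iff:
  assumes "0 \<le> a"
  shows "lower_split k u x \<le> a \<longleftrightarrow> (\<forall>j\<in>{1..k}. u j < x \<longrightarrow> u j \<le> a)"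
  using lower_split_less_iff[OF assms, of k u x] by (metis not_less)

lemma upper_split_ge_iff:
  assumes "a \<le> 1"
  shows "a \<le> upper_split k u x \<longleftrightarrow> (\<forall>j\<in>{1..k}. x \<le> u j \<longrightarrow> a \<le> u j)"
  using upper_split_less_iff[OF assms, of k u x] by (metis not_less)

text \<open>
  All later arguments concern the cell of a single point, which needs no order statistics: its
  endpoints are the largest split below the point and the smallest split not below it.
\<close>

lemma tree_eq_cell_at:
  assumes u: "\<And>j. j \<in> {1..k} \<Longrightarrow> u j \<in> {0..1}" and x: "0 < x" "x \<le> 1"
  shows "tree b k u x = b (cell_at k u x)"
proof -
  define xs where "xs = 0 # sort (map u [1..<Suc k]) @ [1]"
  have os: "order_stat k u j = xs ! j" for j
    by (simp add: order_stat_def xs_def)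
  have len: "length xs = k + 2" by (simp add: xs_def)
  have set_xs: "set xs = {0,1} \<union> u ` {1..k}" by (auto simp: xs_def)
  have srt: "sorted xs"
    using u by (auto simp: xs_def sorted_append)
  have mono: "xs ! i \<le> xs ! j" if "i \<le> j" "j \<le> Suc k" for i j
    using sorted_nth_mono[OF srt that(1)] that len by simp
  have xs0: "xs ! 0 = 0" by (simp add: xs_def)
  have xsk: "xs ! Suc k = 1" by (simp add: xs_def nth_append)
  define j where "j = Max {i. i \<le> k \<and> xs ! i < x}"
  have fin: "finite {i. i \<le> k \<and> xs ! i < x}" by auto
  have ne: "{i. i \<le> k \<and> xs ! i < x} \<noteq> {}" using xs0 x by auto
  have j: "j \<le> k" "xs ! j < x" using Max_in[OF fin ne] by (auto simp: j_def)
  have j': "x \<le> xs ! Suc j"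
  proof (cases "j = k")
    case False
    then have "Suc j \<le> k" using j by simp
    moreover have "Suc j \<notin> {i. i \<le> k \<and> xs ! i < x}"
      using Max_ge[OF fin, of "Suc j"] unfolding j_def[symmetric] by force
    ultimately show ?thesis by auto
  qed (use xsk x in simp)
  have uniq: "x \<in> cell k u i \<longleftrightarrow> i = j" if "i \<le> k" for i
  proof -
    have "xs ! Suc i \<le> xs ! j" if "i < j" using mono[of "Suc i" j] that j by simp
    moreover have "xs ! Suc j \<le> xs ! i" if "j < i" using mono[of "Suc j" i] that \<open>i \<le> k\<close> by simp
    ultimately show ?thesis
      using j j' by (cases i j rule: linorder_cases) (auto simp: cell_def os)
  qed
  have le: "y \<le> xs ! j" if "y \<in> set xs" "y < x" for y
  proof -
    obtain i where "i < length xs" and y: "xs ! i = y" using \<open>y \<in> set xs\<close> unfolding in_set_conv_nth by blast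
    with len have i: "i \<le> Suc k" "y = xs ! i" by simp_all
    have "i \<le> j"
    proof (rule ccontr)
      assume "\<not> i \<le> j"
      then have "xs ! Suc j \<le> y" using mono[of "Suc j" i] i by simp
      then show False using j' that by simp
    qed
    then show ?thesis using mono[of i j] i j by simp
  qed
  have ge: "xs ! Suc j \<le> y" if "y \<in> set xs" "x \<le> y" for y
  proof -
    obtain i where "i < length xs" and y: "xs ! i = y" using \<open>y \<in> set xs\<close> unfolding in_set_conv_nth by blast
    with len have i: "i \<le> Suc k" "y = xs ! i" by simp_all
    have "Suc j \<le> i"
    proof (rule ccontr)
      assume "\<not> Suc j \<le> i"
      then have "y \<le> xs ! j" using mono[of i j] i j by simp
      then show False using j that by simp
    qed
    then show ?thesis using mono[of "Suc j" i] i j by simp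
  qed
  have nth_in: "xs ! j \<in> set xs" "xs ! Suc j \<in> set xs" using len j by auto
  have "lower_split k u x = xs ! j"
  proof (rule antisym)
    have "0 \<le> xs ! j" using mono[of 0 j] xs0 j by simp
    then show "lower_split k u x \<le> xs ! j"
      using le set_xs by (subst lower_split_le_iff) auto
    show "xs ! j \<le> lower_split k u x"
    proof (rule ccontr)
      assume *: "\<not> xs ! j \<le> lower_split k u x"
      then have "\<forall>i\<in>{1..k}. u i < x \<longrightarrow> u i \<le> lower_split k u x"
        using lower_split_le_iff[OF lower_split_nonneg, of k u x k u x] by simp
      then show False using nth_in(1) * j(2) x lower_split_nonneg[of k u x] unfolding set_xs by auto
    qed
  qed
  moreover have "upper_split k u x = xs ! Suc j"
  proof (rule antisym)
    have "xs ! Suc j \<le> 1" using mono[of "Suc j" "Suc k"] xsk j by simp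
    then show "xs ! Suc j \<le> upper_split k u x"
      using ge set_xs by (subst upper_split_ge_iff) auto
    show "upper_split k u x \<le> xs ! Suc j"
    proof (rule ccontr)
      assume *: "\<not> upper_split k u x \<le> xs ! Suc j"
      then have "\<forall>i\<in>{1..k}. x \<le> u i \<longrightarrow> upper_split k u x \<le> u i"
        using upper_split_ge_iff[OF upper_split_le_1, of k u x k u x] by simp
      then show False using nth_in(2) * j' x upper_split_le_1[of k u x] unfolding set_xs by auto
    qed
  qed
  ultimately have cj: "cell k u j = cell_at k u x" by (simp add: cell_def os)
  have "tree b k u x = (\<Sum>i=0..k. if i = j then b (cell k u j) else 0)"
    unfolding tree_def using uniq by (intro sum.cong) (auto simp: indicator_def)
  then show ?thesis using j cj by simp
qed

section \<open>The distribution function of a cell length and its integral\<close>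

text \<open>
  With \<open>G t = 1 - (1 - t)\<^sup>k\<close> this is \<open>G t - t G' t\<close>; it is the probability that at least two of \<open>k\<close>
  independent uniform points fall into a fixed interval of length \<open>t\<close>.
\<close>

definition short_cell_bound :: "nat \<Rightarrow> real \<Rightarrow> real" where
  "short_cell_bound k t = 1 - (1 - t) ^ k - real k * t * (1 - t) ^ (k - 1)"

lemma short_cell_bound_eq:
  "short_cell_bound k t = t\<^sup>2 * (\<Sum>i<k. real i * (1 - t) ^ (i - 1))"
proof (induction k)
  case (Suc k)
  have "short_cell_bound (Suc k) t - short_cell_bound k t = t\<^sup>2 * (real k * (1 - t) ^ (k - 1))"
    by (cases k) (simp_all add: short_cell_bound_def algebra_simps power2_eq_square)
  with Suc show ?case by (simp add: algebra_simps)
qed (simp add: short_cell_bound_def)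

lemma short_cell_bound_le_square:
  assumes "0 \<le> t" "t \<le> 1"
  shows "short_cell_bound k t \<le> (real k * t)\<^sup>2"
proof -
  have "(\<Sum>i<k. real i * (1 - t) ^ (i - 1)) \<le> (\<Sum>i<k. real k * 1)"
    using assms by (intro sum_mono mult_mono power_le_one) auto
  then have "t\<^sup>2 * (\<Sum>i<k. real i * (1 - t) ^ (i - 1)) \<le> t\<^sup>2 * (real k)\<^sup>2"
    by (intro mult_left_mono) (auto simp: power2_eq_square)
  then show ?thesis
    unfolding short_cell_bound_eq by (simp add: power_mult_distrib mult.commute)
qed

text \<open>
  Write \<open>G t = t S t\<close> with the polynomial \<open>S t = \<Sum>i<k. (1 - t)\<^sup>i\<close>. Then the integrand is
  \<open>(G / t - G')\<^sup>2 = (G')\<^sup>2 - (t S\<^sup>2)'\<close>, and the primitive of \<open>(G')\<^sup>2 = k\<^sup>2 (1 - t)\<^bsup>2 k - 2\<^esup>\<close> gives the bound.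
  The function \<open>S\<close> serves to avoid the division by \<open>t\<close> at the left endpoint.
\<close>

lemma short_cell_bound_integral:
  assumes k: "k > 0" and d: "0 \<le> d" "d \<le> 1"
  shows "(\<integral>\<^sup>+t. ennreal ((short_cell_bound k t)\<^sup>2 / t\<^sup>2) * indicator {0..d} t \<partial>lborel)
    \<le> ennreal ((real k)\<^sup>2 / (2 * real k - 1))"
proof -
  define S where "S t = (\<Sum>i<k. (1 - t) ^ i)" for t :: real
  define T where "T t = (\<Sum>i<k. real i * (1 - t) ^ (i - 1))" for t :: real
  define P where "P t = - (t * (S t)\<^sup>2) - (real k)\<^sup>2 / (2 * real k - 1) * (1 - t) ^ (2 * k - 1)" for t :: real
  have S': "(S has_real_derivative - T t) (at t)" for t
    unfolding S_def T_def
    by (auto intro!: derivative_eq_intros simp: sum_negf)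
  have geo: "t * S t = 1 - (1 - t) ^ k" for t
    using one_diff_power_eq[of "1 - t" k] by (simp add: S_def)
  have deriv_geo: "S t - t * T t = real k * (1 - t) ^ (k - 1)" for t
  proof (rule DERIV_unique)
    show "((\<lambda>t. t * S t) has_real_derivative (S t - t * T t)) (at t)"
      by (auto intro!: derivative_eq_intros S')
    show "((\<lambda>t. t * S t) has_real_derivative (real k * (1 - t) ^ (k - 1))) (at t)"
      unfolding geo by (auto intro!: derivative_eq_intros)
  qed
  have P': "(P has_real_derivative (t * T t)\<^sup>2) (at t)" for t
  proof -
    have "(P has_real_derivative
        (- ((S t)\<^sup>2 + t * (2 * S t * (- T t))) + (real k)\<^sup>2 / (2 * real k - 1) *
          (real (2 * k - 1) * (1 - t) ^ (2 * k - 2)))) (at t)"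
      unfolding P_def
      by (rule derivative_eq_intros refl S' | simp add: algebra_simps numeral_2_eq_2)+
    moreover have "(real k)\<^sup>2 / (2 * real k - 1) * (real (2 * k - 1) * (1 - t) ^ (2 * k - 2))
        = (real k * (1 - t) ^ (k - 1))\<^sup>2"
    proof -
      have "(1 - t) ^ (2 * k - 2) = ((1 - t) ^ (k - 1))\<^sup>2"
        by (simp add: power_mult[symmetric] right_diff_distrib' mult.commute)
      then show ?thesis using k by (simp add: field_simps)
    qed
    moreover have "(S t - t * T t)\<^sup>2 - (S t)\<^sup>2 + 2 * S t * t * T t = (t * T t)\<^sup>2"
      by (simp add: power2_eq_square algebra_simps)
    ultimately show ?thesis unfolding deriv_geo[symmetric]
      by (auto simp: algebra_simps)
  qed
  have eq: "(short_cell_bound k t)\<^sup>2 / t\<^sup>2 = (t * T t)\<^sup>2" for t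
    unfolding short_cell_bound_eq T_def[symmetric] by (simp add: power2_eq_square)
  have "(\<integral>\<^sup>+t. ennreal ((t * T t)\<^sup>2) * indicator {0..d} t \<partial>lborel) = ennreal (P d - P 0)"
    using d by (intro nn_integral_FTC_Icc P') (auto simp: T_def)
  also have "\<dots> \<le> ennreal ((real k)\<^sup>2 / (2 * real k - 1))"
  proof (intro ennreal_leI)
    have "0 \<le> d * (S d)\<^sup>2" "0 \<le> (real k)\<^sup>2 / (2 * real k - 1) * (1 - d) ^ (2 * k - 1)"
      using d k by (auto intro!: mult_nonneg_nonneg divide_nonneg_nonneg)
    then show "P d - P 0 \<le> (real k)\<^sup>2 / (2 * real k - 1)"
      by (simp add: P_def)
  qed
  finally show ?thesis unfolding eq .
qed

section \<open>Freezing one of two independent groups of variables\<close>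

context prob_space
begin

text \<open>
  Fubini's theorem in a form that never mentions the laws of the variables: an independent variable
  may be evaluated at a second, independent outcome.
\<close>

lemma indep_var_nn_integral_freeze:
  assumes ind: "indep_var S V T W" and f: "f \<in> borel_measurable (S \<Otimes>\<^sub>M T)"
  shows "(\<integral>\<^sup>+\<omega>. f (V \<omega>, W \<omega>) \<partial>M) = (\<integral>\<^sup>+\<omega>. \<integral>\<^sup>+\<omega>'. f (V \<omega>, W \<omega>') \<partial>M \<partial>M)"
proof -
  note [measurable] = f
  have V [measurable]: "V \<in> measurable M S" and W [measurable]: "W \<in> measurable M T"
    using indep_var_rv1[OF ind] indep_var_rv2[OF ind] .
  interpret W: prob_space "distr M T W" by (rule prob_space_distr) fact
  have "(\<integral>\<^sup>+\<omega>. f (V \<omega>, W \<omega>) \<partial>M) = (\<integral>\<^sup>+z. f z \<partial>distr M (S \<Otimes>\<^sub>M T) (\<lambda>\<omega>. (V \<omega>, W \<omega>)))"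
    by (simp add: nn_integral_distr)
  also have "\<dots> = (\<integral>\<^sup>+z. f z \<partial>(distr M S V \<Otimes>\<^sub>M distr M T W))"
    using ind by (simp add: indep_var_distribution_eq)
  also have "\<dots> = (\<integral>\<^sup>+v. \<integral>\<^sup>+w. f (v, w) \<partial>distr M T W \<partial>distr M S V)"
    by (rule W.nn_integral_fst[symmetric]) measurable
  also have "\<dots> = (\<integral>\<^sup>+v. \<integral>\<^sup>+\<omega>'. f (v, W \<omega>') \<partial>M \<partial>distr M S V)"
  proof (rule nn_integral_cong)
    fix v assume "v \<in> space (distr M S V)"
    then have "(\<lambda>w. f (v, w)) \<in> borel_measurable T" by simp
    then show "(\<integral>\<^sup>+w. f (v, w) \<partial>distr M T W) = (\<integral>\<^sup>+\<omega>'. f (v, W \<omega>') \<partial>M)"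
      by (simp add: nn_integral_distr)
  qed
  also have "\<dots> = (\<integral>\<^sup>+\<omega>. \<integral>\<^sup>+\<omega>'. f (V \<omega>, W \<omega>') \<partial>M \<partial>M)"
    by (subst nn_integral_distr) auto
  finally show ?thesis .
qed

text \<open>
  The variables of an independent family are used through functions of the whole family that depend
  on few coordinates; the condition \<open>local\<close> expresses this dependence and removes the restrictions.
\<close>

lemma indep_vars_nn_integral_freeze:
  fixes V :: "'i \<Rightarrow> 'a \<Rightarrow> real" and g :: "('i \<Rightarrow> real) \<Rightarrow> ('i \<Rightarrow> real) \<Rightarrow> ennreal"
  assumes ind: "indep_vars (\<lambda>_. borel) V I" and AB: "A \<inter> B = {}" "A \<subseteq> I" "B \<subseteq> I"
    and g: "(\<lambda>z. g (fst z) (snd z)) \<in> borel_measurable (PiM A (\<lambda>_. borel) \<Otimes>\<^sub>M PiM B (\<lambda>_. borel))"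
    and local: "\<And>v w. g (restrict v A) (restrict w B) = g v w"
  shows "(\<integral>\<^sup>+\<omega>. g (\<lambda>i. V i \<omega>) (\<lambda>i. V i \<omega>) \<partial>M) = (\<integral>\<^sup>+\<omega>. \<integral>\<^sup>+\<omega>'. g (\<lambda>i. V i \<omega>) (\<lambda>i. V i \<omega>') \<partial>M \<partial>M)"
  using indep_var_nn_integral_freeze[OF indep_var_restrict[OF ind AB] g] by (simp add: local)

end

lemma (in prob_space) indep_var_functions:
  fixes V :: "'i \<Rightarrow> 'a \<Rightarrow> real" and f g :: "('i \<Rightarrow> real) \<Rightarrow> real"
  assumes ind: "indep_vars (\<lambda>_. borel) V I" and AB: "A \<inter> B = {}" "A \<subseteq> I" "B \<subseteq> I"
    and f: "f \<in> borel_measurable (PiM A (\<lambda>_. borel))" and g: "g \<in> borel_measurable (PiM B (\<lambda>_. borel))"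
    and local: "\<And>v. f (restrict v A) = f v" "\<And>v. g (restrict v B) = g v"
  shows "indep_var borel (\<lambda>\<omega>. f (\<lambda>i. V i \<omega>)) borel (\<lambda>\<omega>. g (\<lambda>i. V i \<omega>))"
  using indep_var_compose[OF indep_var_restrict[OF ind AB] f g] by (simp add: comp_def local)

lemma (in prob_space) indep_vars_reindex_inj:
  assumes ind: "indep_vars M' Z (f ` J)" and inj: "inj_on f J"
  shows "indep_vars (\<lambda>j. M' (f j)) (\<lambda>j. Z (f j)) J"
proof -
  have "indep_vars (\<lambda>j. PiM {f j} M') (\<lambda>j \<omega>. restrict (\<lambda>i. Z i \<omega>) {f j}) J"
    using inj by (intro indep_vars_restrict[OF ind]) (auto simp: disjoint_family_on_def inj_on_def)
  from indep_vars_compose2[OF this, of "\<lambda>j v. v (f j)" "\<lambda>j. M' (f j)"]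
  show ?thesis by (simp add: measurable_component_singleton)
qed

section \<open>Inverse moments from lower tails\<close>

context prob_space
begin

text \<open>
  The layer cake formula for a decreasing function \<open>g\<close> with density \<open>- w\<close>, obtained by exchanging the
  integrals over the outcome and over the level.
\<close>

lemma nn_integral_layers:
  fixes w g :: "real \<Rightarrow> ennreal"
  assumes [measurable]: "Z \<in> borel_measurable M" "w \<in> borel_measurable borel"
    and pos: "\<And>\<omega>. \<omega> \<in> space M \<Longrightarrow> 0 < Z \<omega>"
    and layers: "\<And>z. 0 < z \<Longrightarrow> (\<integral>\<^sup>+t. w t * indicator {z<..} t \<partial>lborel) = g z"
  shows "(\<integral>\<^sup>+\<omega>. g (Z \<omega>) \<partial>M) =
    (\<integral>\<^sup>+t. w t * indicator {0<..} t * emeasure M {\<omega>\<in>space M. Z \<omega> < t} \<partial>lborel)"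
proof -
  interpret pair_sigma_finite M lborel ..
  have "(\<integral>\<^sup>+\<omega>. g (Z \<omega>) \<partial>M) = (\<integral>\<^sup>+\<omega>. \<integral>\<^sup>+t. w t * indicator {Z \<omega><..} t \<partial>lborel \<partial>M)"
    by (intro nn_integral_cong) (simp add: layers pos)
  also have "\<dots> = (\<integral>\<^sup>+\<omega>. \<integral>\<^sup>+t. w t * indicator {0<..} t * indicator {\<omega>\<in>space M. Z \<omega> < t} \<omega> \<partial>lborel \<partial>M)"
    using pos by (intro nn_integral_cong) (auto simp: indicator_def dest: less_trans)
  also have "\<dots> = (\<integral>\<^sup>+t. \<integral>\<^sup>+\<omega>. w t * indicator {0<..} t * indicator {\<omega>\<in>space M. Z \<omega> < t} \<omega> \<partial>M \<partial>lborel)"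
    by (rule Fubini'[symmetric]) (simp add: indicator_def, measurable)
  also have "\<dots> = (\<integral>\<^sup>+t. w t * indicator {0<..} t * emeasure M {\<omega>\<in>space M. Z \<omega> < t} \<partial>lborel)"
    by (intro nn_integral_cong) (simp add: nn_integral_cmult)
  finally show ?thesis .
qed

end

lemma nn_integral_FTC_greaterThan:
  fixes f F :: "real \<Rightarrow> real"
  assumes "f \<in> borel_measurable borel" "\<And>x. a \<le> x \<Longrightarrow> (F has_real_derivative f x) (at x)"
    and "\<And>x. a \<le> x \<Longrightarrow> 0 \<le> f x" "(F \<longlongrightarrow> T) at_top"
  shows "(\<integral>\<^sup>+x. ennreal (f x) * indicator {a<..} x \<partial>lborel) = T - F a"
proof -
  have "(\<integral>\<^sup>+x. ennreal (f x) * indicator {a<..} x \<partial>lborel)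
      = (\<integral>\<^sup>+x. ennreal (f x) * indicator {a..} x \<partial>lborel)"
    using AE_lborel_singleton[of a] by (intro nn_integral_cong_AE) (auto simp: indicator_def)
  then show ?thesis using nn_integral_FTC_atLeast[OF assms] by simp
qed

lemma layers_inverse:
  assumes "0 < (z::real)"
  shows "(\<integral>\<^sup>+t. ennreal (1 / t\<^sup>2) * indicator {z<..} t \<partial>lborel) = ennreal (1 / z)"
proof -
  have "((\<lambda>t::real. - (1 / t)) \<longlongrightarrow> - 0) at_top"
    by (intro tendsto_minus tendsto_divide_0[OF tendsto_const] filterlim_at_top_imp_at_infinity filterlim_ident)
  then show ?thesis
    using assms by (subst nn_integral_FTC_greaterThan[where F = "\<lambda>t. - (1 / t)" and T = 0])
      (auto intro!: derivative_eq_intros simp: power2_eq_square)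
qed

lemma layers_inverse_square:
  assumes "0 < (z::real)"
  shows "(\<integral>\<^sup>+t. ennreal (2 / t ^ 3) * indicator {z<..} t \<partial>lborel) = ennreal (1 / z\<^sup>2)"
proof -
  have "((\<lambda>t::real. - (1 / t\<^sup>2)) \<longlongrightarrow> - 0) at_top"
    by (intro tendsto_minus tendsto_divide_0[OF tendsto_const] filterlim_at_top_imp_at_infinity
        filterlim_pow_at_top filterlim_ident) auto
  then show ?thesis
    using assms by (subst nn_integral_FTC_greaterThan[where F = "\<lambda>t. - (1 / t\<^sup>2)" and T = 0])
      (auto intro!: derivative_eq_intros simp: power2_eq_square power3_eq_cube field_simps)
qed

lemma layers_exp:
  assumes l: "0 < (l::real)"
  shows "(\<integral>\<^sup>+t. ennreal (l * exp (- l * t)) * indicator {z<..} t \<partial>lborel) = ennreal (exp (- l * z))"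
proof -
  have "((\<lambda>t::real. - exp (- l * t)) \<longlongrightarrow> - 0) at_top"
    by (intro tendsto_minus filterlim_compose[OF exp_at_bot]
        filterlim_tendsto_neg_mult_at_bot[OF tendsto_const] filterlim_ident) (use l in auto)
  then show ?thesis
    using l by (subst nn_integral_FTC_greaterThan[where F = "\<lambda>t. - exp (- l * t)" and T = 0])
      (auto intro!: derivative_eq_intros)
qed

context prob_space
begin

text \<open>
  Below \<open>1 / c\<close> the tail bound makes the integrand \<open>P(Z < t) / t\<^sup>2\<close> at most \<open>c\<^sup>2\<close>; above \<open>1 / c\<close> the
  probability is at most \<open>1\<close>. Both ranges contribute \<open>c\<close>.
\<close>

lemma mean_inverse_le:
  assumes Z [measurable]: "Z \<in> borel_measurable M" and pos: "\<And>\<omega>. \<omega> \<in> space M \<Longrightarrow> 0 < Z \<omega>" and c: "0 < c"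
    and tail: "\<And>t. 0 < t \<Longrightarrow> prob {\<omega>\<in>space M. Z \<omega> < t} \<le> (c * t)\<^sup>2"
  shows "(\<integral>\<^sup>+\<omega>. ennreal (1 / Z \<omega>) \<partial>M) \<le> ennreal (2 * c)"
proof -
  have "(\<integral>\<^sup>+\<omega>. ennreal (1 / Z \<omega>) \<partial>M) =
      (\<integral>\<^sup>+t. ennreal (1 / t\<^sup>2) * indicator {0<..} t * emeasure M {\<omega>\<in>space M. Z \<omega> < t} \<partial>lborel)"
    by (intro nn_integral_layers layers_inverse pos) auto
  also have "\<dots> \<le> (\<integral>\<^sup>+t. ennreal (c\<^sup>2) * indicator {0..1 / c} t + ennreal (1 / t\<^sup>2) * indicator {1 / c<..} t \<partial>lborel)"
  proof (intro nn_integral_mono)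
    fix t :: real
    consider "t \<le> 0" | "0 < t" "t \<le> 1 / c" | "1 / c < t" by linarith
    then show "ennreal (1 / t\<^sup>2) * indicator {0<..} t * emeasure M {\<omega>\<in>space M. Z \<omega> < t} \<le>
        ennreal (c\<^sup>2) * indicator {0..1 / c} t + ennreal (1 / t\<^sup>2) * indicator {1 / c<..} t"
    proof cases
      case 2
      have "1 / t\<^sup>2 * prob {\<omega>\<in>space M. Z \<omega> < t} \<le> 1 / t\<^sup>2 * (c * t)\<^sup>2"
        using tail[OF 2(1)] by (intro mult_left_mono) auto
      also have "\<dots> = c\<^sup>2" using 2 by (simp add: power_mult_distrib)
      finally show ?thesis using 2 by (simp add: emeasure_eq_measure ennreal_mult[symmetric] ennreal_leI)
    next
      case 3
      then have "0 < t" using c by (meson divide_pos_pos less_trans zero_less_one)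
      have "1 / t\<^sup>2 * prob {\<omega>\<in>space M. Z \<omega> < t} \<le> 1 / t\<^sup>2 * 1"
        by (intro mult_left_mono) auto
      then show ?thesis using 3 \<open>0 < t\<close> by (simp add: emeasure_eq_measure ennreal_mult[symmetric] ennreal_leI)
    qed simp
  qed
  also have "\<dots> = ennreal (c\<^sup>2) * ennreal (1 / c) + ennreal (1 / (1 / c))"
    using c by (simp add: nn_integral_add nn_integral_cmult layers_inverse)
  also have "\<dots> = ennreal (2 * c)"
    using c by (simp add: ennreal_mult[symmetric] ennreal_plus[symmetric] power2_eq_square del: ennreal_plus)
  finally show ?thesis .
qed

lemma mean_inverse_square_le:
  assumes Z [measurable]: "Z \<in> borel_measurable M" and pos: "\<And>\<omega>. \<omega> \<in> space M \<Longrightarrow> 0 < Z \<omega>" and c: "0 < c"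
    and tail: "\<And>t. 0 < t \<Longrightarrow> prob {\<omega>\<in>space M. Z \<omega> < t} \<le> (c * t) ^ 4"
  shows "(\<integral>\<^sup>+\<omega>. ennreal (1 / (Z \<omega>)\<^sup>2) \<partial>M) \<le> ennreal (2 * c\<^sup>2)"
proof -
  have "(\<integral>\<^sup>+\<omega>. ennreal (1 / (Z \<omega>)\<^sup>2) \<partial>M) =
      (\<integral>\<^sup>+t. ennreal (2 / t ^ 3) * indicator {0<..} t * emeasure M {\<omega>\<in>space M. Z \<omega> < t} \<partial>lborel)"
    by (intro nn_integral_layers[of _ _ "\<lambda>z. ennreal (1 / z\<^sup>2)"] layers_inverse_square pos) auto
  also have "\<dots> \<le> (\<integral>\<^sup>+t. ennreal (2 * c ^ 4 * t) * indicator {0..1 / c} t + ennreal (2 / t ^ 3) * indicator {1 / c<..} t \<partial>lborel)"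
  proof (intro nn_integral_mono)
    fix t :: real
    consider "t \<le> 0" | "0 < t" "t \<le> 1 / c" | "1 / c < t" by linarith
    then show "ennreal (2 / t ^ 3) * indicator {0<..} t * emeasure M {\<omega>\<in>space M. Z \<omega> < t} \<le>
        ennreal (2 * c ^ 4 * t) * indicator {0..1 / c} t + ennreal (2 / t ^ 3) * indicator {1 / c<..} t"
    proof cases
      case 2
      have "2 / t ^ 3 * prob {\<omega>\<in>space M. Z \<omega> < t} \<le> 2 / t ^ 3 * (c * t) ^ 4"
        using tail[OF 2(1)] 2 by (intro mult_left_mono) auto
      also have "\<dots> = 2 * c ^ 4 * t" using 2 by (simp add: power_mult_distrib eval_nat_numeral)
      finally show ?thesis using 2 by (simp add: emeasure_eq_measure ennreal_mult[symmetric] ennreal_leI)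
    next
      case 3
      then have "0 < t" using c by (meson divide_pos_pos less_trans zero_less_one)
      have "2 / t ^ 3 * prob {\<omega>\<in>space M. Z \<omega> < t} \<le> 2 / t ^ 3 * 1"
        using \<open>0 < t\<close> by (intro mult_left_mono) auto
      then show ?thesis using 3 \<open>0 < t\<close> by (simp add: emeasure_eq_measure ennreal_mult[symmetric] ennreal_leI)
    qed simp
  qed
  also have "\<dots> = (\<integral>\<^sup>+t. ennreal (2 * c ^ 4 * t) * indicator {0..1 / c} t \<partial>lborel) + ennreal (1 / (1 / c)\<^sup>2)"
    using c by (simp add: nn_integral_add layers_inverse_square)
  also have "(\<integral>\<^sup>+t. ennreal (2 * c ^ 4 * t) * indicator {0..1 / c} t \<partial>lborel) = ennreal (c ^ 4 * (1 / c)\<^sup>2 - c ^ 4 * 0\<^sup>2)"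
    using c by (intro nn_integral_FTC_Icc[where F = "\<lambda>t. c ^ 4 * t\<^sup>2"]) (auto intro!: derivative_eq_intros)
  also have "ennreal (c ^ 4 * (1 / c)\<^sup>2 - c ^ 4 * 0\<^sup>2) + ennreal (1 / (1 / c)\<^sup>2) = ennreal (2 * c\<^sup>2)"
    using c by (simp add: ennreal_plus[symmetric] field_simps eval_nat_numeral del: ennreal_plus)
  finally show ?thesis .
qed

lemma mean_exp_le:
  assumes Z [measurable]: "Z \<in> borel_measurable M" and pos: "\<And>\<omega>. \<omega> \<in> space M \<Longrightarrow> 0 < Z \<omega>"
    and c: "0 < c" and l: "0 < l"
    and tail: "\<And>t. 0 < t \<Longrightarrow> prob {\<omega>\<in>space M. Z \<omega> < t} \<le> (c * t) ^ a"
  shows "(\<integral>\<^sup>+\<omega>. ennreal (exp (- l * Z \<omega>)) \<partial>M) \<le> ennreal (fact a * (c / l) ^ a)"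
proof -
  have "(\<integral>\<^sup>+\<omega>. ennreal (exp (- l * Z \<omega>)) \<partial>M) =
      (\<integral>\<^sup>+t. ennreal (l * exp (- l * t)) * indicator {0<..} t * emeasure M {\<omega>\<in>space M. Z \<omega> < t} \<partial>lborel)"
    using l by (intro nn_integral_layers[of _ _ "\<lambda>z. ennreal (exp (- l * z))"] layers_exp pos) auto
  also have "\<dots> \<le> (\<integral>\<^sup>+t. ennreal (c ^ a) * ennreal (erlang_density 0 l t * t ^ a) \<partial>lborel)"
  proof (intro nn_integral_mono)
    fix t :: real
    show "ennreal (l * exp (- l * t)) * indicator {0<..} t * emeasure M {\<omega>\<in>space M. Z \<omega> < t} \<le>
        ennreal (c ^ a) * ennreal (erlang_density 0 l t * t ^ a)"
    proof (cases "0 < t")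
      case True
      have "l * exp (- l * t) * prob {\<omega>\<in>space M. Z \<omega> < t} \<le> l * exp (- l * t) * (c * t) ^ a"
        using tail[OF True] l by (intro mult_left_mono) auto
      also have "\<dots> = c ^ a * (erlang_density 0 l t * t ^ a)"
        using True by (simp add: erlang_density_def power_mult_distrib)
      finally show ?thesis using True l c
        by (simp add: emeasure_eq_measure ennreal_mult'[symmetric] ennreal_leI)
    qed simp
  qed
  also have "\<dots> = ennreal (c ^ a) * ennreal (fact a / l ^ a)"
    using l by (simp add: nn_integral_cmult nn_integral_erlang_ith_moment)
  also have "\<dots> = ennreal (fact a * (c / l) ^ a)"
    using c l by (simp add: ennreal_mult[symmetric] power_divide mult.commute)
  finally show ?thesis .
qed

text \<open>
  Meant for the length of the longer one of two independent cells, whose distribution function is the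
  product of two. The tail bound holds up to \<open>d\<close>; the levels above \<open>d\<close> contribute \<open>1 / d\<close>.
\<close>

lemma mean_inverse_longer_cell_le:
  assumes Z [measurable]: "Z \<in> borel_measurable M" and pos: "\<And>\<omega>. \<omega> \<in> space M \<Longrightarrow> 0 < Z \<omega>"
    and k: "0 < k" and d: "0 < d" "d \<le> 1"
    and tail: "\<And>t. 0 < t \<Longrightarrow> t \<le> d \<Longrightarrow> prob {\<omega>\<in>space M. Z \<omega> < t} \<le> (short_cell_bound k t)\<^sup>2"
  shows "(\<integral>\<^sup>+\<omega>. ennreal (1 / Z \<omega>) \<partial>M) \<le> ennreal ((real k)\<^sup>2 / (2 * real k - 1) + 1 / d)"
proof -
  have [measurable]: "short_cell_bound k \<in> borel_measurable borel"
    unfolding short_cell_bound_def by measurable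
  have "(\<integral>\<^sup>+\<omega>. ennreal (1 / Z \<omega>) \<partial>M) =
      (\<integral>\<^sup>+t. ennreal (1 / t\<^sup>2) * indicator {0<..} t * emeasure M {\<omega>\<in>space M. Z \<omega> < t} \<partial>lborel)"
    by (intro nn_integral_layers layers_inverse pos) auto
  also have "\<dots> \<le> (\<integral>\<^sup>+t. ennreal ((short_cell_bound k t)\<^sup>2 / t\<^sup>2) * indicator {0..d} t
      + ennreal (1 / t\<^sup>2) * indicator {d<..} t \<partial>lborel)"
  proof (intro nn_integral_mono)
    fix t :: real
    consider "t \<le> 0" | "0 < t" "t \<le> d" | "d < t" by linarith
    then show "ennreal (1 / t\<^sup>2) * indicator {0<..} t * emeasure M {\<omega>\<in>space M. Z \<omega> < t} \<le>
        ennreal ((short_cell_bound k t)\<^sup>2 / t\<^sup>2) * indicator {0..d} t + ennreal (1 / t\<^sup>2) * indicator {d<..} t"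
    proof cases
      case 2
      have "1 / t\<^sup>2 * prob {\<omega>\<in>space M. Z \<omega> < t} \<le> 1 / t\<^sup>2 * (short_cell_bound k t)\<^sup>2"
        using tail 2 by (intro mult_left_mono) auto
      then show ?thesis using 2 by (simp add: emeasure_eq_measure ennreal_mult[symmetric] ennreal_leI)
    next
      case 3
      have "1 / t\<^sup>2 * prob {\<omega>\<in>space M. Z \<omega> < t} \<le> 1 / t\<^sup>2 * 1"
        by (intro mult_left_mono) auto
      then show ?thesis using 3 d by (simp add: emeasure_eq_measure ennreal_mult[symmetric] ennreal_leI)
    qed simp
  qed
  also have "\<dots> = (\<integral>\<^sup>+t. ennreal ((short_cell_bound k t)\<^sup>2 / t\<^sup>2) * indicator {0..d} t \<partial>lborel) + ennreal (1 / d)"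
    using d by (simp add: nn_integral_add layers_inverse)
  also have "\<dots> \<le> ennreal ((real k)\<^sup>2 / (2 * real k - 1)) + ennreal (1 / d)"
    using k d by (intro add_mono short_cell_bound_integral) auto
  also have "\<dots> = ennreal ((real k)\<^sup>2 / (2 * real k - 1) + 1 / d)"
    using k d by (intro ennreal_plus[symmetric]) auto
  finally show ?thesis .
qed

end

section \<open>Inverse moments of counts\<close>

lemma le_divide_if_mult_le: "0 < c \<Longrightarrow> c * s \<le> 1 \<Longrightarrow> s \<le> 1 / (c::real)"
  by (simp add: pos_le_divide_eq mult.commute)

lemma nn_integral_binomial_pmf:
  assumes p: "p \<in> {0..1::real}" and f: "\<And>j. 0 \<le> f j"
  shows "(\<integral>\<^sup>+j. ennreal (f j) \<partial>binomial_pmf n p) =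
    ennreal (\<Sum>j\<le>n. real (n choose j) * p ^ j * (1 - p) ^ (n - j) * f j)"
proof -
  have "integrable (measure_pmf (binomial_pmf n p)) f"
    using p by (intro integrable_binomial_pmf) auto
  then have "(\<integral>\<^sup>+j. ennreal (f j) \<partial>binomial_pmf n p) = ennreal (measure_pmf.expectation (binomial_pmf n p) f)"
    using f by (intro nn_integral_eq_integral) auto
  then show ?thesis using p by (simp add: expectation_binomial_pmf' mult_ac)
qed

text \<open>
  Since \<open>(n choose j) / (j + 1) = (n + 1 choose j + 1) / (n + 1)\<close>, the mean is, up to the factor
  \<open>1 / ((n + 1) p)\<close>, a partial sum of the binomial expansion of \<open>1\<close>.
\<close>

lemma binomial_mean_inverse_Suc:
  assumes p: "0 < p" "p \<le> (1::real)"
  shows "(\<integral>\<^sup>+j. ennreal (1 / (real j + 1)) \<partial>binomial_pmf n p) \<le> ennreal (1 / ((real n + 1) * p))"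
proof -
  let ?s = "\<Sum>j\<le>n. real (n choose j) * p ^ j * (1 - p) ^ (n - j) * (1 / (real j + 1))"
  have "(real n + 1) * p * ?s = (\<Sum>j\<le>n. real (Suc n choose Suc j) * p ^ Suc j * (1 - p) ^ (Suc n - Suc j))"
    unfolding sum_distrib_left
  proof (intro sum.cong refl)
    fix j
    have "(real j + 1) * real (Suc n choose Suc j) = (real n + 1) * real (n choose j)"
      using Suc_times_binomial[of j n] by (metis of_nat_Suc of_nat_mult add.commute)
    then have "real (Suc n choose Suc j) = (real n + 1) * real (n choose j) / (real j + 1)"
      by (simp add: field_simps)
    then show "(real n + 1) * p * (real (n choose j) * p ^ j * (1 - p) ^ (n - j) * (1 / (real j + 1)))
        = real (Suc n choose Suc j) * p ^ Suc j * (1 - p) ^ (Suc n - Suc j)"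
      by simp
  qed
  also have "\<dots> \<le> (\<Sum>j\<le>Suc n. real (Suc n choose j) * p ^ j * (1 - p) ^ (Suc n - j))"
    unfolding sum.atMost_Suc_shift[of _ n] using p by simp
  also have "\<dots> = 1" using binomial_ring[of p "1 - p" "Suc n"] by simp
  finally have "?s \<le> 1 / ((real n + 1) * p)" using p by (intro le_divide_if_mult_le) auto
  then show ?thesis using p by (subst nn_integral_binomial_pmf) (auto intro!: ennreal_leI)
qed

lemma binomial_mean_inverse_Suc_Suc:
  assumes p: "0 < p" "p \<le> (1::real)"
  shows "(\<integral>\<^sup>+j. ennreal (1 / ((real j + 1) * (real j + 2))) \<partial>binomial_pmf n p)
    \<le> ennreal (1 / ((real n + 1) * (real n + 2) * p\<^sup>2))"
proof -
  let ?s = "\<Sum>j\<le>n. real (n choose j) * p ^ j * (1 - p) ^ (n - j) * (1 / ((real j + 1) * (real j + 2)))"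
  have "(real n + 1) * (real n + 2) * p\<^sup>2 * ?s =
      (\<Sum>j\<le>n. real (Suc (Suc n) choose Suc (Suc j)) * p ^ Suc (Suc j) * (1 - p) ^ (Suc (Suc n) - Suc (Suc j)))"
    unfolding sum_distrib_left
  proof (intro sum.cong refl)
    fix j
    have 1: "(real j + 1) * real (Suc n choose Suc j) = (real n + 1) * real (n choose j)"
      using Suc_times_binomial[of j n] by (metis of_nat_Suc of_nat_mult add.commute)
    have 2: "(real (Suc j) + 1) * real (Suc (Suc n) choose Suc (Suc j)) = (real (Suc n) + 1) * real (Suc n choose Suc j)"
      using Suc_times_binomial[of "Suc j" "Suc n"] by (metis of_nat_Suc of_nat_mult add.commute)
    have "real (Suc (Suc n) choose Suc (Suc j)) = (real n + 2) * real (Suc n choose Suc j) / (real j + 2)"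
      using 2 by (simp add: field_simps del: binomial_Suc_Suc)
    moreover have "real (Suc n choose Suc j) = (real n + 1) * real (n choose j) / (real j + 1)"
      using 1 by (simp add: field_simps del: binomial_Suc_Suc)
    ultimately show "(real n + 1) * (real n + 2) * p\<^sup>2 *
          (real (n choose j) * p ^ j * (1 - p) ^ (n - j) * (1 / ((real j + 1) * (real j + 2))))
        = real (Suc (Suc n) choose Suc (Suc j)) * p ^ Suc (Suc j) * (1 - p) ^ (Suc (Suc n) - Suc (Suc j))"
      by (simp add: power2_eq_square del: binomial_Suc_Suc)
  qed
  also have "\<dots> \<le> (\<Sum>j\<le>Suc (Suc n). real (Suc (Suc n) choose j) * p ^ j * (1 - p) ^ (Suc (Suc n) - j))"
    unfolding sum.atMost_Suc_shift[of _ "Suc n"] sum.atMost_Suc_shift[of _ n] using p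
    by (simp del: binomial_Suc_Suc)
  also have "\<dots> = 1" using binomial_ring[of p "1 - p" "Suc (Suc n)"] by simp
  finally have "?s \<le> 1 / ((real n + 1) * (real n + 2) * p\<^sup>2)" using p by (intro le_divide_if_mult_le) auto
  then show ?thesis using p by (subst nn_integral_binomial_pmf) (auto intro!: ennreal_leI)
qed

context prob_space
begin

text \<open>
  Induction on the index set: freezing all other variables shows that a new variable adds an
  independent Bernoulli trial.
\<close>

lemma count_binomial:
  fixes V :: "'i \<Rightarrow> 'a \<Rightarrow> real" and f :: "nat \<Rightarrow> ennreal"
  assumes "indep_vars (\<lambda>_. borel) V J" "finite J" and [measurable]: "A \<in> sets borel"
    and p: "\<And>i. i \<in> J \<Longrightarrow> prob {\<omega>\<in>space M. V i \<omega> \<in> A} = p" "p \<in> {0..1}"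
  shows "(\<integral>\<^sup>+\<omega>. f (card {i\<in>J. V i \<omega> \<in> A}) \<partial>M) = (\<integral>\<^sup>+j. f j \<partial>binomial_pmf (card J) p)"
  using assms(2,1) p(1)
proof (induction J arbitrary: f)
  case empty
  then show ?case using p(2) by (simp add: binomial_pmf_0 emeasure_space_1)
next
  case (insert i J)
  have ind: "indep_vars (\<lambda>_. borel) V (insert i J)" by (rule insert.prems)
  then have indJ: "indep_vars (\<lambda>_. borel) V J" by (rule indep_vars_subset) auto
  have [measurable]: "V i \<in> borel_measurable M" using ind by (auto simp: indep_vars_def)
  define g where "g v w = f ((if v i \<in> A then 1 else 0) + card {j\<in>J. w j \<in> A})" for v w :: "'i \<Rightarrow> real"
  have card_eq: "card {j\<in>insert i J. v j \<in> A} = (if v i \<in> A then 1 else 0) + card {j\<in>J. v j \<in> A}" for v :: "'i \<Rightarrow> real"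
  proof -
    have "{j\<in>insert i J. v j \<in> A} = (if v i \<in> A then insert i {j\<in>J. v j \<in> A} else {j\<in>J. v j \<in> A})" by auto
    then show ?thesis using insert.hyps by simp
  qed
  have IH: "(\<integral>\<^sup>+\<omega>. h (card {j\<in>J. V j \<omega> \<in> A}) \<partial>M) = (\<integral>\<^sup>+j. h j \<partial>binomial_pmf (card J) p)" for h :: "nat \<Rightarrow> ennreal"
    using insert.IH[OF indJ] insert.prems(2) by auto
  have "(\<integral>\<^sup>+\<omega>. f (card {j\<in>insert i J. V j \<omega> \<in> A}) \<partial>M) = (\<integral>\<^sup>+\<omega>. g (\<lambda>i. V i \<omega>) (\<lambda>i. V i \<omega>) \<partial>M)"
    by (simp only: card_eq g_def)
  also have "\<dots> = (\<integral>\<^sup>+\<omega>. \<integral>\<^sup>+\<omega>'. g (\<lambda>i. V i \<omega>) (\<lambda>i. V i \<omega>') \<partial>M \<partial>M)"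
  proof (rule indep_vars_nn_integral_freeze[OF ind, of "{i}" J])
    show "(\<lambda>z. g (fst z) (snd z)) \<in> borel_measurable (PiM {i} (\<lambda>_. borel) \<Otimes>\<^sub>M PiM J (\<lambda>_. borel))"
    proof -
      have [measurable]: "(\<lambda>z. fst z i) \<in> borel_measurable (PiM {i} (\<lambda>_. borel) \<Otimes>\<^sub>M PiM J (\<lambda>_. borel :: real measure))"
        by (rule measurable_compose[OF measurable_fst measurable_component_singleton]) simp
      have [measurable]: "(\<lambda>z. snd z j) \<in> borel_measurable (PiM {i} (\<lambda>_. borel) \<Otimes>\<^sub>M PiM J (\<lambda>_. borel :: real measure))"
        if "j \<in> J" for j
        by (rule measurable_compose[OF measurable_snd measurable_component_singleton]) (rule that)
      have card_sum: "card {j\<in>J. w j \<in> A} = (\<Sum>j\<in>J. if w j \<in> A then 1 else 0)" for w :: "'i \<Rightarrow> real"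
        using insert.hyps(1) by (simp add: sum.If_cases Int_def)
      show ?thesis unfolding g_def card_sum by measurable
    qed
    show "g (restrict v {i}) (restrict w J) = g v w" for v w
      by (simp add: g_def cong: conj_cong)
  qed (use insert.hyps in auto)
  also have "\<dots> = (\<integral>\<^sup>+\<omega>. (\<integral>\<^sup>+j. f (Suc j) \<partial>binomial_pmf (card J) p) * indicator {\<omega>\<in>space M. V i \<omega> \<in> A} \<omega> +
      (\<integral>\<^sup>+j. f j \<partial>binomial_pmf (card J) p) * indicator {\<omega>\<in>space M. V i \<omega> \<notin> A} \<omega> \<partial>M)"
    by (intro nn_integral_cong) (simp add: g_def IH[of f] IH[of "\<lambda>m. f (Suc m)"])
  also have "\<dots> = (\<integral>\<^sup>+j. f (Suc j) \<partial>binomial_pmf (card J) p) * p + (\<integral>\<^sup>+j. f j \<partial>binomial_pmf (card J) p) * (1 - p)"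
  proof -
    have "emeasure M {\<omega>\<in>space M. V i \<omega> \<notin> A} = ennreal (1 - p)"
      using insert.prems(2)[of i] by (simp add: emeasure_eq_measure prob_neg)
    then show ?thesis
      using insert.prems(2)[of i] by (simp add: nn_integral_add nn_integral_cmult emeasure_eq_measure)
  qed
  also have "\<dots> = (\<integral>\<^sup>+j. f j \<partial>binomial_pmf (card (insert i J)) p)"
    using p(2) insert.hyps by (simp add: binomial_pmf_Suc ennreal_minus)
  finally show ?case .
qed

end

context prob_space
begin

lemma
  fixes V :: "'i \<Rightarrow> 'a \<Rightarrow> real"
  assumes ind: "indep_vars (\<lambda>_. borel) V J" "finite J" and A: "A \<in> sets borel"
    and p: "\<And>i. i \<in> J \<Longrightarrow> prob {\<omega>\<in>space M. V i \<omega> \<in> A} = p" "p \<in> {0..1}" and J: "J \<noteq> {}"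
  shows inverse_count_le: "(\<integral>\<^sup>+\<omega>. ennreal (1 / real (card {i\<in>J. V i \<omega> \<in> A})) \<partial>M) \<le> ennreal (2 / (real (card J) * p))"
    and inverse_count_le_sharp: "0 < p \<Longrightarrow>
      (\<integral>\<^sup>+\<omega>. ennreal (1 / real (card {i\<in>J. V i \<omega> \<in> A})) \<partial>M)
        \<le> ennreal (1 / (real (card J) * p) + 3 / (real (card J) * p)\<^sup>2)"
    and count_0: "(\<integral>\<^sup>+\<omega>. ennreal (if card {i\<in>J. V i \<omega> \<in> A} = 0 then 1 else 0) \<partial>M) = ennreal ((1 - p) ^ card J)"
proof -
  note eq = count_binomial[OF ind A p]
  define n where "n = card J"
  have n: "0 < n" using J ind(2) by (simp add: n_def card_gt_0_iff)
  have frac: "1 / real j \<le> 1 / (real j + 1) + 3 * (1 / ((real j + 1) * (real j + 2)))"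
    "1 / real j \<le> 2 * (1 / (real j + 1))" for j :: nat
  proof -
    have "1 / x \<le> 1 / (x + 1) + 3 * (1 / ((x + 1) * (x + 2)))" "1 / x \<le> 2 * (1 / (x + 1))" if "1 \<le> x" for x :: real
    proof -
      have "1 / (x + 1) + 3 * (1 / ((x + 1) * (x + 2))) - 1 / x = (2 * x - 2) / (x * ((x + 1) * (x + 2)))"
        using that by (simp add: divide_simps) (simp add: algebra_simps)
      moreover have "0 < x * ((x + 1) * (x + 2))" using that by simp
      ultimately have "0 \<le> 1 / (x + 1) + 3 * (1 / ((x + 1) * (x + 2))) - 1 / x" using that by simp
      then show "1 / x \<le> 1 / (x + 1) + 3 * (1 / ((x + 1) * (x + 2)))" by simp
      show "1 / x \<le> 2 * (1 / (x + 1))" using that by (simp add: field_simps)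
    qed
    from this[of "real j"] show "1 / real j \<le> 1 / (real j + 1) + 3 * (1 / ((real j + 1) * (real j + 2)))"
      "1 / real j \<le> 2 * (1 / (real j + 1))"
      by (cases j; simp)+
  qed
  show "(\<integral>\<^sup>+\<omega>. ennreal (1 / real (card {i\<in>J. V i \<omega> \<in> A})) \<partial>M) \<le> ennreal (2 / (real (card J) * p))"
  proof (cases "p = 0")
    case True
    have "(\<Sum>j\<le>card J. real (card J choose j) * p ^ j * (1 - p) ^ (card J - j) * (1 / real j)) = 0"
      by (intro sum.neutral) (auto simp: True)
    then show ?thesis
      using eq[of "\<lambda>j. ennreal (1 / real j)"] nn_integral_binomial_pmf[OF p(2), of "\<lambda>j. 1 / real j" "card J"]
      by simp
  next
    case False
    then have p0: "0 < p" "p \<le> 1" using p by auto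
    have "(\<integral>\<^sup>+j. ennreal (1 / real j) \<partial>binomial_pmf n p) \<le> (\<integral>\<^sup>+j. 2 * ennreal (1 / (real j + 1)) \<partial>binomial_pmf n p)"
    proof (intro nn_integral_mono)
      fix j
      have "ennreal (1 / real j) \<le> ennreal (2 * (1 / (real j + 1)))" by (intro ennreal_leI frac)
      also have "\<dots> = 2 * ennreal (1 / (real j + 1))" by (subst ennreal_mult) auto
      finally show "ennreal (1 / real j) \<le> 2 * ennreal (1 / (real j + 1))" .
    qed
    also have "\<dots> = 2 * (\<integral>\<^sup>+j. ennreal (1 / (real j + 1)) \<partial>binomial_pmf n p)"
      by (rule nn_integral_cmult) simp
    also have "\<dots> \<le> 2 * ennreal (1 / ((real n + 1) * p))"
      by (intro mult_left_mono binomial_mean_inverse_Suc p0) simp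
    also have "\<dots> = ennreal (2 * (1 / ((real n + 1) * p)))"
      by (subst ennreal_mult) (use p0 in auto)
    also have "\<dots> \<le> ennreal (2 / (real n * p))"
    proof (rule ennreal_leI)
      have "2 / ((real n + 1) * p) \<le> 2 / (real n * p)" using p0 n by (intro divide_left_mono) auto
      then show "2 * (1 / ((real n + 1) * p)) \<le> 2 / (real n * p)" by simp
    qed
    finally show ?thesis using eq[of "\<lambda>j. ennreal (1 / real j)"] by (simp add: n_def)
  qed
  show "(\<integral>\<^sup>+\<omega>. ennreal (1 / real (card {i\<in>J. V i \<omega> \<in> A})) \<partial>M)
      \<le> ennreal (1 / (real (card J) * p) + 3 / (real (card J) * p)\<^sup>2)" if p0: "0 < p"
  proof -
    have p1: "p \<le> 1" using p by auto
    have e3: "3 * ennreal x = ennreal (3 * x)" for x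
      by (subst ennreal_mult') auto
    have "(\<integral>\<^sup>+j. ennreal (1 / real j) \<partial>binomial_pmf n p) \<le>
        (\<integral>\<^sup>+j. ennreal (1 / (real j + 1)) + 3 * ennreal (1 / ((real j + 1) * (real j + 2))) \<partial>binomial_pmf n p)"
    proof (intro nn_integral_mono)
      fix j
      have "ennreal (1 / (real j + 1)) + 3 * ennreal (1 / ((real j + 1) * (real j + 2)))
          = ennreal (1 / (real j + 1) + 3 * (1 / ((real j + 1) * (real j + 2))))"
        by (subst ennreal_plus) (unfold e3, auto)
      then show "ennreal (1 / real j) \<le> ennreal (1 / (real j + 1)) + 3 * ennreal (1 / ((real j + 1) * (real j + 2)))"
        using ennreal_leI[OF frac(1)[of j]] by (simp only:)
    qed
    also have "\<dots> = (\<integral>\<^sup>+j. ennreal (1 / (real j + 1)) \<partial>binomial_pmf n p) +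
        3 * (\<integral>\<^sup>+j. ennreal (1 / ((real j + 1) * (real j + 2))) \<partial>binomial_pmf n p)"
      by (subst nn_integral_add, simp, simp, subst nn_integral_cmult) simp_all
    also have "\<dots> \<le> ennreal (1 / ((real n + 1) * p)) + 3 * ennreal (1 / ((real n + 1) * (real n + 2) * p\<^sup>2))"
      by (intro add_mono mult_left_mono binomial_mean_inverse_Suc binomial_mean_inverse_Suc_Suc p0 p1) auto
    also have "\<dots> = ennreal (1 / ((real n + 1) * p) + 3 * (1 / ((real n + 1) * (real n + 2) * p\<^sup>2)))"
      by (subst ennreal_plus) (unfold e3, use p0 in auto)
    also have "\<dots> \<le> ennreal (1 / (real n * p) + 3 * (1 / (real n * p)\<^sup>2))"
    proof (intro ennreal_leI add_mono mult_left_mono divide_left_mono)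
      have "real n * real n \<le> (real n + 1) * (real n + 2)" by (intro mult_mono) auto
      then have "real n * real n * p\<^sup>2 \<le> (real n + 1) * (real n + 2) * p\<^sup>2"
        by (intro mult_right_mono) auto
      then show "(real n * p)\<^sup>2 \<le> (real n + 1) * (real n + 2) * p\<^sup>2"
        by (simp only: power_mult_distrib power2_eq_square[of "real n"])
    qed (use p0 n in auto)
    finally show ?thesis using eq[of "\<lambda>j. ennreal (1 / real j)"] by (simp add: n_def)
  qed
  show "(\<integral>\<^sup>+\<omega>. ennreal (if card {i\<in>J. V i \<omega> \<in> A} = 0 then 1 else 0) \<partial>M) = ennreal ((1 - p) ^ card J)"
  proof -
    have "(\<Sum>j\<le>card J. real (card J choose j) * p ^ j * (1 - p) ^ (card J - j) * (if j = 0 then 1 else 0))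
        = (\<Sum>j\<le>card J. if j = 0 then (1 - p) ^ card J else 0)"
      by (intro sum.cong) auto
    also have "\<dots> = (1 - p) ^ card J" by simp
    finally show ?thesis
      using eq[of "\<lambda>j. ennreal (if j = 0 then 1 else 0)"]
        nn_integral_binomial_pmf[OF p(2), of "\<lambda>j. if j = 0 then 1 else 0" "card J"]
      by (simp only: zero_le_one order_refl if_True if_False if_split simp_thms)
  qed
qed

end

section \<open>Centred sums divided by a count\<close>

context prob_space
begin

text \<open>
  The mean of \<open>g\<close> over the points in \<open>A\<close> has a random number of terms, but they remain
  uncorrelated: on \<open>V i \<in> A\<close> the count is \<open>1\<close> plus the count of the other points, so for \<open>i \<noteq> j\<close>
  the product term is \<open>g (V i)\<close> times a function of the other variables. The diagonal terms add up to at
  most \<open>D\<^sup>2\<close> divided by the count.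
\<close>

lemma centred_mean_square_le:
  fixes V :: "'i \<Rightarrow> 'a \<Rightarrow> real" and g :: "real \<Rightarrow> real"
  assumes ind: "indep_vars (\<lambda>_. borel) V J" and J: "finite J" and A: "A \<in> sets borel"
    and g[measurable]: "g \<in> borel_measurable borel" and D: "\<And>x. \<bar>g x\<bar> \<le> D" and supp: "\<And>x. x \<notin> A \<Longrightarrow> g x = 0"
    and centred: "\<And>i. i \<in> J \<Longrightarrow> expectation (\<lambda>\<omega>. g (V i \<omega>)) = 0"
  shows "(\<integral>\<^sup>+\<omega>. ennreal (((\<Sum>i\<in>J. g (V i \<omega>)) / real (card {i\<in>J. V i \<omega> \<in> A}))\<^sup>2) \<partial>M)
    \<le> ennreal (D\<^sup>2) * (\<integral>\<^sup>+\<omega>. ennreal (1 / real (card {i\<in>J. V i \<omega> \<in> A})) \<partial>M)"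
proof -
  have [measurable]: "V i \<in> borel_measurable M" if "i \<in> J" for i
    using ind that by (simp add: indep_vars_def)
  have D0: "0 \<le> D" using D[of 0] by linarith
  define N where "N K v = (\<Sum>i\<in>K. if v i \<in> A then 1 else 0 :: real)" for K and v :: "'i \<Rightarrow> real"
  have card_N: "real (card {i\<in>J. v i \<in> A}) = N J v" for v
    using J by (simp add: N_def sum.If_cases Int_def)
  have N_0: "0 \<le> N K v" for K v unfolding N_def by (intro sum_nonneg) auto
  have N_meas: "(\<lambda>v. N K v) \<in> borel_measurable (PiM K (\<lambda>_. borel))" for K
    unfolding N_def using A by measurable
  have [measurable]: "(\<lambda>\<omega>. N J (\<lambda>i. V i \<omega>)) \<in> borel_measurable M"
    unfolding N_def using A by measurable
  have N_remove: "N J v = 1 + N (J - {i}) v" if "i \<in> J" "v i \<in> A" for i v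
    unfolding N_def using J that by (simp add: sum.remove[of J i])
  define c where "c i j \<omega> = g (V i \<omega>) * g (V j \<omega>) / (N J (\<lambda>i. V i \<omega>))\<^sup>2" for i j \<omega>
  have c_alt: "c i j \<omega> = g (V i \<omega>) * (g (V j \<omega>) / (1 + N (J - {i}) (\<lambda>i. V i \<omega>))\<^sup>2)" if "i \<in> J" for i j \<omega>
    using N_remove[OF that, of "\<lambda>i. V i \<omega>"] supp[of "V i \<omega>"]
    by (cases "V i \<omega> \<in> A") (auto simp: c_def)
  have bound: "norm (g x / (1 + N K v)\<^sup>2) \<le> D" for x K v
  proof -
    have "\<bar>g x\<bar> / (1 + N K v)\<^sup>2 \<le> D / 1"
      using D[of x] D0 N_0[of K v] by (intro frac_le) auto
    then show ?thesis by (simp add: abs_divide)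
  qed
  have c_meas [measurable]: "c i j \<in> borel_measurable M" if "i \<in> J" "j \<in> J" for i j
    unfolding c_def using that by measurable
  have c_int: "integrable M (c i j)" if "i \<in> J" "j \<in> J" for i j
  proof (rule integrable_const_bound[where B = "D * D"])
    show "AE \<omega> in M. norm (c i j \<omega>) \<le> D * D"
    proof (intro AE_I2)
      fix \<omega>
      have "\<bar>g (V i \<omega>)\<bar> * norm (g (V j \<omega>) / (1 + N (J - {i}) (\<lambda>i. V i \<omega>))\<^sup>2) \<le> D * D"
        by (intro mult_mono bound D D0) auto
      then show "norm (c i j \<omega>) \<le> D * D" unfolding c_alt[OF that(1)] by (simp add: abs_mult)
    qed
  qed (use that in measurable)
  have c_0: "expectation (c i j) = 0" if ij: "i \<in> J" "j \<in> J" "i \<noteq> j" for i j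
  proof -
    let ?Y = "\<lambda>v. g (v j) / (1 + N (J - {i}) v)\<^sup>2"
    have Y: "?Y \<in> borel_measurable (PiM (J - {i}) (\<lambda>_. borel))"
    proof -
      have [measurable]: "(\<lambda>v. v j) \<in> borel_measurable (PiM (J - {i}) (\<lambda>_. borel :: real measure))"
        by (rule measurable_component_singleton) (use ij in auto)
      note [measurable] = N_meas[of "J - {i}"]
      show ?thesis by measurable
    qed
    have "indep_var borel ((\<lambda>v. g (v i)) \<circ> (\<lambda>\<omega>. restrict (\<lambda>i. V i \<omega>) {i}))
        borel (?Y \<circ> (\<lambda>\<omega>. restrict (\<lambda>i. V i \<omega>) (J - {i})))"
    proof (rule indep_var_compose[OF indep_var_restrict[OF ind] _ Y])
      have [measurable]: "(\<lambda>v. v i) \<in> borel_measurable (PiM {i} (\<lambda>_. borel :: real measure))"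
        by (rule measurable_component_singleton) simp
      show "(\<lambda>v. g (v i)) \<in> borel_measurable (PiM {i} (\<lambda>_. borel))" by measurable
    qed (use ij in auto)
    also have "(\<lambda>v. g (v i)) \<circ> (\<lambda>\<omega>. restrict (\<lambda>i. V i \<omega>) {i}) = (\<lambda>\<omega>. g (V i \<omega>))"
      by auto
    also have "?Y \<circ> (\<lambda>\<omega>. restrict (\<lambda>i. V i \<omega>) (J - {i})) = (\<lambda>\<omega>. ?Y (\<lambda>i. V i \<omega>))"
      using ij by (auto simp: N_def fun_eq_iff)
    finally have iv: "indep_var borel (\<lambda>\<omega>. g (V i \<omega>)) borel (\<lambda>\<omega>. ?Y (\<lambda>i. V i \<omega>))" .
    have "integrable M (\<lambda>\<omega>. g (V i \<omega>))"
      using ij D by (intro integrable_const_bound[where B = D]) (auto intro!: AE_I2)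
    moreover have "integrable M (\<lambda>\<omega>. ?Y (\<lambda>i. V i \<omega>))"
      using indep_var_rv2[OF iv] bound by (intro integrable_const_bound[where B = D]) (auto intro!: AE_I2)
    ultimately have "expectation (\<lambda>\<omega>. g (V i \<omega>) * ?Y (\<lambda>i. V i \<omega>)) = 0"
      using indep_var_lebesgue_integral[OF iv] centred[OF ij(1)] by simp
    moreover have "c i j = (\<lambda>\<omega>. g (V i \<omega>) * ?Y (\<lambda>i. V i \<omega>))"
      by (rule ext) (rule c_alt[OF ij(1)])
    ultimately show ?thesis by simp
  qed
  have sq: "((\<Sum>i\<in>J. g (V i \<omega>)) / N J (\<lambda>i. V i \<omega>))\<^sup>2 = (\<Sum>i\<in>J. \<Sum>j\<in>J. c i j \<omega>)" for \<omega>
    by (simp add: c_def power_divide power2_eq_square sum_product sum_divide_distrib)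
  have diag: "(\<Sum>i\<in>J. c i i \<omega>) \<le> D\<^sup>2 * (1 / N J (\<lambda>i. V i \<omega>))" for \<omega>
  proof -
    let ?N = "N J (\<lambda>i. V i \<omega>)"
    have "(\<Sum>i\<in>J. (g (V i \<omega>))\<^sup>2) \<le> (\<Sum>i\<in>J. D\<^sup>2 * (if V i \<omega> \<in> A then 1 else 0))"
      using D supp by (intro sum_mono) (auto simp: abs_le_square_iff[symmetric] D0)
    also have "\<dots> = D\<^sup>2 * ?N" by (simp add: N_def sum_distrib_left)
    finally have "(\<Sum>i\<in>J. (g (V i \<omega>))\<^sup>2) / ?N\<^sup>2 \<le> D\<^sup>2 * ?N / ?N\<^sup>2" by (intro divide_right_mono) auto
    moreover have "D\<^sup>2 * ?N / ?N\<^sup>2 = D\<^sup>2 * (1 / ?N)" by (simp add: power2_eq_square)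
    moreover have "(\<Sum>i\<in>J. (g (V i \<omega>))\<^sup>2) / ?N\<^sup>2 = (\<Sum>i\<in>J. c i i \<omega>)"
      by (simp add: c_def power2_eq_square sum_divide_distrib)
    ultimately show ?thesis by simp
  qed
  have "(\<integral>\<^sup>+\<omega>. ennreal (((\<Sum>i\<in>J. g (V i \<omega>)) / N J (\<lambda>i. V i \<omega>))\<^sup>2) \<partial>M)
      = ennreal (expectation (\<lambda>\<omega>. ((\<Sum>i\<in>J. g (V i \<omega>)) / N J (\<lambda>i. V i \<omega>))\<^sup>2))"
    unfolding sq using c_int sq[symmetric] by (intro nn_integral_eq_integral Bochner_Integration.integrable_sum) auto
  also have "expectation (\<lambda>\<omega>. ((\<Sum>i\<in>J. g (V i \<omega>)) / N J (\<lambda>i. V i \<omega>))\<^sup>2) = expectation (\<lambda>\<omega>. \<Sum>i\<in>J. c i i \<omega>)"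
  proof -
    have "expectation (\<lambda>\<omega>. ((\<Sum>i\<in>J. g (V i \<omega>)) / N J (\<lambda>i. V i \<omega>))\<^sup>2) = (\<Sum>i\<in>J. \<Sum>j\<in>J. expectation (c i j))"
      unfolding sq using c_int by simp
    also have "\<dots> = (\<Sum>i\<in>J. \<Sum>j\<in>J. if j = i then expectation (c i i) else 0)"
      using c_0 by (intro sum.cong) auto
    also have "\<dots> = expectation (\<lambda>\<omega>. \<Sum>i\<in>J. c i i \<omega>)"
      using c_int J by simp
    finally show ?thesis .
  qed
  also have "ennreal \<dots> = (\<integral>\<^sup>+\<omega>. ennreal (\<Sum>i\<in>J. c i i \<omega>) \<partial>M)"
  proof (rule nn_integral_eq_integral[symmetric])
    have "0 \<le> c i i \<omega>" for i \<omega> by (simp add: c_def)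
    then show "AE \<omega> in M. 0 \<le> (\<Sum>i\<in>J. c i i \<omega>)" by (intro AE_I2 sum_nonneg)
    show "integrable M (\<lambda>\<omega>. \<Sum>i\<in>J. c i i \<omega>)" using c_int by (intro Bochner_Integration.integrable_sum) auto
  qed
  also have "\<dots> \<le> (\<integral>\<^sup>+\<omega>. ennreal (D\<^sup>2) * ennreal (1 / N J (\<lambda>i. V i \<omega>)) \<partial>M)"
    using diag N_0 by (intro nn_integral_mono) (simp add: ennreal_mult[symmetric] ennreal_leI)
  also have "\<dots> = ennreal (D\<^sup>2) * (\<integral>\<^sup>+\<omega>. ennreal (1 / N J (\<lambda>i. V i \<omega>)) \<partial>M)"
    by (intro nn_integral_cmult) measurable
  finally show ?thesis by (simp add: card_N)
qed

end

section \<open>The length of the cell around a fixed point\<close>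

context prob_space
begin

lemma emeasure_eq_freeze:
  fixes V :: "'i \<Rightarrow> 'a \<Rightarrow> real"
  assumes ind: "indep_vars (\<lambda>_. borel) V I" and AB: "A \<inter> B = {}" "A \<subseteq> I" "B \<subseteq> I"
    and P: "Measurable.pred (PiM A (\<lambda>_. borel) \<Otimes>\<^sub>M PiM B (\<lambda>_. borel)) (\<lambda>z. P (fst z) (snd z))"
    and local: "\<And>v w. P (restrict v A) (restrict w B) = P v w"
    and meas: "{\<omega>\<in>space M. P (\<lambda>i. V i \<omega>) (\<lambda>i. V i \<omega>)} \<in> events"
    "\<And>\<omega>. \<omega> \<in> space M \<Longrightarrow> {\<omega>'\<in>space M. P (\<lambda>i. V i \<omega>) (\<lambda>i. V i \<omega>')} \<in> events"
  shows "emeasure M {\<omega>\<in>space M. P (\<lambda>i. V i \<omega>) (\<lambda>i. V i \<omega>)} =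
    (\<integral>\<^sup>+\<omega>. emeasure M {\<omega>'\<in>space M. P (\<lambda>i. V i \<omega>) (\<lambda>i. V i \<omega>')} \<partial>M)"
proof -
  define g :: "('i \<Rightarrow> real) \<Rightarrow> ('i \<Rightarrow> real) \<Rightarrow> ennreal" where "g v w = (if P v w then 1 else 0)" for v w
  have ind_eq: "(\<integral>\<^sup>+\<omega>. (if Q \<omega> then 1 else 0) \<partial>M) = emeasure M {\<omega>\<in>space M. Q \<omega>}"
    if "{\<omega>\<in>space M. Q \<omega>} \<in> events" for Q
  proof -
    have "(\<integral>\<^sup>+\<omega>. (if Q \<omega> then 1 else 0) \<partial>M) = (\<integral>\<^sup>+\<omega>. indicator {\<omega>\<in>space M. Q \<omega>} \<omega> \<partial>M)"
      by (intro nn_integral_cong) (simp add: indicator_def)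
    with that show ?thesis by simp
  qed
  have "(\<integral>\<^sup>+\<omega>. g (\<lambda>i. V i \<omega>) (\<lambda>i. V i \<omega>) \<partial>M) = (\<integral>\<^sup>+\<omega>. \<integral>\<^sup>+\<omega>'. g (\<lambda>i. V i \<omega>) (\<lambda>i. V i \<omega>') \<partial>M \<partial>M)"
  proof (rule indep_vars_nn_integral_freeze[OF ind AB])
    show "(\<lambda>z. g (fst z) (snd z)) \<in> borel_measurable (PiM A (\<lambda>_. borel) \<Otimes>\<^sub>M PiM B (\<lambda>_. borel))"
      unfolding g_def using P by measurable
  qed (simp only: g_def local)
  then show ?thesis
    using meas by (simp add: g_def ind_eq cong: nn_integral_cong_simp)
qed

end

locale uniform_splits = prob_space M for M :: "'a measure" +
  fixes V :: "nat \<Rightarrow> 'a \<Rightarrow> real" and k :: nat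
  assumes splits_indep: "indep_vars (\<lambda>_. borel) V {1..k}"
    and splits_uniform: "\<And>j. j \<in> {1..k} \<Longrightarrow> distr M borel (V j) = uniform_measure lborel {0..1}"
begin

lemma split_measurable [measurable]: "j \<in> {1..k} \<Longrightarrow> V j \<in> borel_measurable M"
  using splits_indep by (simp add: indep_vars_def)

lemma prob_split:
  assumes j: "j \<in> {1..k}" and A[measurable]: "A \<in> sets borel"
  shows "emeasure M {\<omega>\<in>space M. V j \<omega> \<in> A} = emeasure lborel ({0..1} \<inter> A)"
proof -
  have "emeasure M {\<omega>\<in>space M. V j \<omega> \<in> A} = emeasure (distr M borel (V j)) A"
    using j A by (subst emeasure_distr) (auto intro!: arg_cong2[where f = emeasure])
  also have "\<dots> = emeasure lborel ({0..1} \<inter> A)"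
  proof -
    have "y / 1 = y" for y :: ennreal
      by (metis divide_ennreal_def ennreal_1 inverse_1 inverse_ennreal mult.right_neutral zero_less_one)
    then show ?thesis using A by (simp add: splits_uniform[OF j])
  qed
  finally show ?thesis .
qed

lemma prob_split_interval:
  assumes "j \<in> {1..k}" "0 \<le> a" "a \<le> b" "b \<le> 1"
  shows "emeasure M {\<omega>\<in>space M. V j \<omega> \<in> {a..<b}} = ennreal (b - a)"
proof -
  have "emeasure M {\<omega>\<in>space M. V j \<omega> \<in> {a..<b}} = emeasure lborel ({0..1} \<inter> {a..<b})"
    by (rule prob_split) (use assms in auto)
  moreover have "{0..1} \<inter> {a..<b} = {a..<b}" using assms by auto
  ultimately show ?thesis using assms by simp
qed

lemma splits_in_unit: "AE \<omega> in M. \<forall>j\<in>{1..k}. V j \<omega> \<in> {0..1}"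
proof (rule AE_finite_allI)
  fix j assume j: "j \<in> {1..k}"
  have "{0..1::real} \<inter> - {0..1} = {}" by auto
  then have "emeasure M {\<omega>\<in>space M. V j \<omega> \<in> - {0..1}} = 0"
    using prob_split[OF j, of "- {0..1}"] by simp
  then show "AE \<omega> in M. V j \<omega> \<in> {0..1}"
    using j by (subst AE_iff_measurable[where N = "{\<omega>\<in>space M. V j \<omega> \<in> - {0..1}}"]) auto
qed simp

lemma prob_splits_avoid:
  assumes J: "J \<subseteq> {1..k}" and t: "0 \<le> a" "0 \<le> t" "a + t \<le> 1"
  shows "prob {\<omega>\<in>space M. \<forall>j\<in>J. V j \<omega> \<notin> {a..<a + t}} = (1 - t) ^ card J"
proof (cases "J = {}")
  case False
  have fin: "finite J" using J finite_subset by blast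
  have "prob {\<omega>\<in>space M. \<forall>j\<in>J. V j \<omega> \<notin> {a..<a + t}} = prob (\<Inter>j\<in>J. V j -` (- {a..<a + t}) \<inter> space M)"
    using False by (intro arg_cong[where f = prob]) auto
  also have "\<dots> = (\<Prod>j\<in>J. prob (V j -` (- {a..<a + t}) \<inter> space M))"
    using False fin J by (intro indep_varsD[OF splits_indep]) auto
  also have "\<dots> = (\<Prod>j\<in>J. 1 - t)"
  proof (intro prod.cong refl)
    fix j assume "j \<in> J"
    then have j: "j \<in> {1..k}" using J by auto
    have "prob {\<omega>\<in>space M. \<not> V j \<omega> \<in> {a..<a + t}} = 1 - prob {\<omega>\<in>space M. V j \<omega> \<in> {a..<a + t}}"
      using j by (intro prob_neg) measurable
    also have "\<dots> = 1 - t"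
      using prob_split_interval[OF j, of a "a + t"] t by (simp add: measure_def)
    finally show "prob (V j -` (- {a..<a + t}) \<inter> space M) = 1 - t"
      by (simp add: vimage_def Int_def conj_commute)
  qed
  finally show ?thesis by simp
qed (simp add: prob_space)

abbreviation cell_len :: "real \<Rightarrow> 'a \<Rightarrow> real" where
  "cell_len x \<omega> \<equiv> cell_length k (\<lambda>j. V j \<omega>) x"

lemma cell_len_measurable [measurable]: "cell_len x \<in> borel_measurable M"
  unfolding cell_length_def by measurable

text \<open>
  For \<open>t \<le> 1/2\<close> there is room for an interval of length \<open>t\<close> inside \<open>{0..1}\<close> on one side of the point,
  and the cell can be shorter than \<open>t\<close> only if some split falls into this interval.
\<close>

lemma prob_short_cell_len_less_le_linear:
  assumes x: "0 < x" "x \<le> 1" and t: "0 < t" "t \<le> 1/2"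
  shows "prob {\<omega>\<in>space M. cell_len x \<omega> < t} \<le> real k * t"
proof -
  obtain a where a: "0 \<le> a" "a + t \<le> 1" "\<And>u. (\<And>j. j \<in> {1..k} \<Longrightarrow> u j \<notin> {a..<a + t}) \<Longrightarrow> t \<le> cell_length k u x"
  proof (cases "t \<le> x")
    case True
    have "t \<le> cell_length k u x" if "\<And>j. j \<in> {1..k} \<Longrightarrow> u j \<notin> {x - t..<x - t + t}" for u
    proof -
      have "lower_split k u x \<le> x - t"
        using that True by (subst lower_split_le_iff) force+
      with upper_split_ge[OF x(2), of k u] show ?thesis by (simp add: cell_length_def)
    qed
    with True x show ?thesis by (intro that[of "x - t"]) auto
  next
    case False
    have "t \<le> cell_length k u x" if "\<And>j. j \<in> {1..k} \<Longrightarrow> u j \<notin> {x..<x + t}" for u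
    proof -
      have "x + t \<le> upper_split k u x"
        using that False t by (subst upper_split_ge_iff) force+
      with lower_split_less[OF x(1), of k u] show ?thesis by (simp add: cell_length_def)
    qed
    with False x t show ?thesis by (intro that[of x]) auto
  qed
  have "{\<omega>\<in>space M. cell_len x \<omega> < t} \<subseteq> (\<Union>j\<in>{1..k}. {\<omega>\<in>space M. V j \<omega> \<in> {a..<a + t}})"
  proof
    fix \<omega> assume \<omega>: "\<omega> \<in> {\<omega>\<in>space M. cell_len x \<omega> < t}"
    show "\<omega> \<in> (\<Union>j\<in>{1..k}. {\<omega>\<in>space M. V j \<omega> \<in> {a..<a + t}})"
    proof (rule ccontr)
      assume "\<not> ?thesis"
      then have "V j \<omega> \<notin> {a..<a + t}" if "j \<in> {1..k}" for j using that \<omega> by blast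
      from a(3)[of "\<lambda>j. V j \<omega>", OF this] show False using \<omega> by simp
    qed
  qed
  then have "prob {\<omega>\<in>space M. cell_len x \<omega> < t} \<le> prob (\<Union>j\<in>{1..k}. {\<omega>\<in>space M. V j \<omega> \<in> {a..<a + t}})"
    by (intro finite_measure_mono) (auto intro!: sets.finite_UN)
  also have "\<dots> \<le> (\<Sum>j\<in>{1..k}. prob {\<omega>\<in>space M. V j \<omega> \<in> {a..<a + t}})"
    by (intro finite_measure_subadditive_finite) auto
  also have "\<dots> = (\<Sum>j\<in>{1..k}. t)"
    using a t by (intro sum.cong) (auto simp: measure_def prob_split_interval simp del: atLeastLessThan_iff)
  finally show ?thesis by simp
qed

text \<open>
  Two kinds of disjoint events force a cell of length at least \<open>t\<close>. Either no split lies in \<open>{x - t..<x}\<close>,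
  with probability \<open>(1 - t)\<^sup>k\<close>; or some split \<open>V j\<close> lies there and no other split lies in
  \<open>{V j..<V j + t}\<close>, which has probability \<open>t (1 - t)\<^bsup>k - 1\<^esup>\<close> for each of the \<open>k\<close> values of \<open>j\<close>.
\<close>

lemma prob_cell_len_less_le:
  assumes t: "0 < t" "t \<le> x" "x + t \<le> 1"
  shows "prob {\<omega>\<in>space M. cell_len x \<omega> < t} \<le> short_cell_bound k t"
proof -
  define E0 where "E0 = {\<omega>\<in>space M. \<forall>j\<in>{1..k}. V j \<omega> \<notin> {x - t..<x - t + t}}"
  define P where "P j v w \<longleftrightarrow> v j \<in> {x - t..<x} \<and> (\<forall>i\<in>{1..k} - {j}. w i \<notin> {v j..<v j + t})"
    for j and v w :: "nat \<Rightarrow> real"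
  define E where "E j = {\<omega>\<in>space M. P j (\<lambda>i. V i \<omega>) (\<lambda>i. V i \<omega>)}" for j
  have E0_meas: "E0 \<in> events" unfolding E0_def by measurable
  have pr0: "prob E0 = (1 - t) ^ k"
    unfolding E0_def using t by (subst prob_splits_avoid) auto
  have E_meas: "E j \<in> events" if "j \<in> {1..k}" for j
    unfolding E_def P_def atLeastLessThan_iff using that by measurable
  have pr: "prob (E j) = t * (1 - t) ^ (k - 1)" if j: "j \<in> {1..k}" for j
  proof -
    have "emeasure M (E j) = (\<integral>\<^sup>+\<omega>. emeasure M {\<omega>'\<in>space M. P j (\<lambda>i. V i \<omega>) (\<lambda>i. V i \<omega>')} \<partial>M)"
      unfolding E_def
    proof (rule emeasure_eq_freeze[OF splits_indep, of "{j}" "{1..k} - {j}"])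
      let ?N = "PiM {j} (\<lambda>_. borel) \<Otimes>\<^sub>M PiM ({1..k} - {j}) (\<lambda>_. borel :: real measure)"
      have [measurable]: "(\<lambda>z. fst z j) \<in> borel_measurable ?N"
        by (rule measurable_compose[OF measurable_fst measurable_component_singleton]) simp
      have [measurable]: "(\<lambda>z. snd z i) \<in> borel_measurable ?N" if "i \<in> {1..k} - {j}" for i
        by (rule measurable_compose[OF measurable_snd measurable_component_singleton]) (rule that)
      show "Measurable.pred ?N (\<lambda>z. P j (fst z) (snd z))"
        unfolding P_def atLeastLessThan_iff by measurable
      show "P j (restrict v {j}) (restrict w ({1..k} - {j})) = P j v w" for v w
        by (simp add: P_def)
      show "{\<omega>'\<in>space M. P j (\<lambda>i. V i \<omega>) (\<lambda>i. V i \<omega>')} \<in> events" for \<omega>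
        unfolding P_def atLeastLessThan_iff by measurable
    qed (use j E_meas[OF j] in \<open>auto simp: E_def\<close>)
    also have "\<dots> = (\<integral>\<^sup>+\<omega>. ennreal ((1 - t) ^ (k - 1)) * indicator {\<omega>\<in>space M. V j \<omega> \<in> {x - t..<x}} \<omega> \<partial>M)"
    proof (intro nn_integral_cong)
      fix \<omega> assume \<omega>: "\<omega> \<in> space M"
      show "emeasure M {\<omega>'\<in>space M. P j (\<lambda>i. V i \<omega>) (\<lambda>i. V i \<omega>')} =
          ennreal ((1 - t) ^ (k - 1)) * indicator {\<omega>\<in>space M. V j \<omega> \<in> {x - t..<x}} \<omega>"
      proof (cases "V j \<omega> \<in> {x - t..<x}")
        case True
        have "prob {\<omega>'\<in>space M. \<forall>i\<in>{1..k} - {j}. V i \<omega>' \<notin> {V j \<omega>..<V j \<omega> + t}} = (1 - t) ^ card ({1..k} - {j})"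
          using True t by (intro prob_splits_avoid) auto
        then show ?thesis using True j \<omega> by (simp add: P_def emeasure_eq_measure del: atLeastLessThan_iff)
      qed (simp add: P_def del: atLeastLessThan_iff)
    qed
    also have "\<dots> = ennreal ((1 - t) ^ (k - 1)) * ennreal t"
      using j t prob_split_interval[OF j, of "x - t" x] by (simp add: nn_integral_cmult del: atLeastLessThan_iff)
    also have "\<dots> = ennreal (t * (1 - t) ^ (k - 1))"
      using t by (simp add: ennreal_mult mult.commute)
    finally show ?thesis using t by (simp add: measure_def)
  qed
  \<comment> \<open>If the events of \<open>i\<close> and \<open>j\<close> occurred together with \<open>V i \<le> V j\<close>, then \<open>V j\<close> would lie in
    \<open>{V i..<V i + t}\<close>.\<close>
  have disj: "disjoint_family_on (\<lambda>j. if j = 0 then E0 else E j) {0..k}"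
    unfolding disjoint_family_on_def
  proof (intro ballI impI)
    have key: "(if i = 0 then E0 else E i) \<inter> (if j = 0 then E0 else E j) = {}"
      if "i < j" "j \<le> k" for i j
    proof (rule equals0I)
      fix \<omega> assume \<omega>: "\<omega> \<in> (if i = 0 then E0 else E i) \<inter> (if j = 0 then E0 else E j)"
      have j: "j \<in> {1..k}" "j \<noteq> 0" using that by auto
      with \<omega> have Pj: "P j (\<lambda>i. V i \<omega>) (\<lambda>i. V i \<omega>)" by (simp add: E_def)
      show False
      proof (cases "i = 0")
        case True
        with \<omega> have "V j \<omega> \<notin> {x - t..<x}" using j by (auto simp: E0_def)
        with Pj show False by (simp add: P_def)
      next
        case False
        then have i: "i \<in> {1..k}" using that by auto
        from False \<omega> have Pi: "P i (\<lambda>i. V i \<omega>) (\<lambda>i. V i \<omega>)" by (simp add: E_def)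
        from Pi have "V i \<omega> \<in> {x - t..<x}" "V j \<omega> \<notin> {V i \<omega>..<V i \<omega> + t}"
          using that j unfolding P_def by auto
        moreover from Pj have "V j \<omega> \<in> {x - t..<x}" "V i \<omega> \<notin> {V j \<omega>..<V j \<omega> + t}"
          using that i unfolding P_def by auto
        ultimately show False by auto
      qed
    qed
    fix i j assume "i \<in> {0..k}" "j \<in> {0..k}" "i \<noteq> j"
    then show "(if i = 0 then E0 else E i) \<inter> (if j = 0 then E0 else E j) = {}"
      using key[of i j] key[of j i] by (cases i j rule: linorder_cases) (auto simp: Int_commute)
  qed
  have long: "(\<Union>j\<in>{0..k}. if j = 0 then E0 else E j) \<subseteq> {\<omega>\<in>space M. \<not> cell_len x \<omega> < t}"
  proof (intro UN_least)
    fix j assume j: "j \<in> {0..k}"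
    show "(if j = 0 then E0 else E j) \<subseteq> {\<omega>\<in>space M. \<not> cell_len x \<omega> < t}"
    proof
      fix \<omega> assume \<omega>: "\<omega> \<in> (if j = 0 then E0 else E j)"
      then have sp: "\<omega> \<in> space M" by (auto simp: E0_def E_def split: if_splits)
      let ?u = "\<lambda>i. V i \<omega>"
      have "t \<le> cell_len x \<omega>"
      proof (cases "j = 0")
        case True
        with \<omega> have "\<forall>i\<in>{1..k}. ?u i \<notin> {x - t..<x}" by (simp add: E0_def)
        then have "lower_split k ?u x \<le> x - t"
          using t by (subst lower_split_le_iff) force+
        moreover have "x \<le> upper_split k ?u x" using t by (intro upper_split_ge) auto
        ultimately show ?thesis by (simp add: cell_length_def)
      next
        case False
        then have Pj: "V j \<omega> \<in> {x - t..<x}" "\<And>i. i \<in> {1..k} - {j} \<Longrightarrow> V i \<omega> \<notin> {V j \<omega>..<V j \<omega> + t}"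
          using \<omega> by (auto simp: E_def P_def)
        have "lower_split k ?u x \<le> V j \<omega>"
        proof (subst lower_split_le_iff, goal_cases)
          case 2
          show ?case
          proof (intro ballI impI)
            fix i assume "i \<in> {1..k}" "V i \<omega> < x"
            then show "V i \<omega> \<le> V j \<omega>" using Pj(1) Pj(2)[of i] by (cases "i = j") auto
          qed
        qed (use Pj t in auto)
        moreover have "V j \<omega> + t \<le> upper_split k ?u x"
        proof (subst upper_split_ge_iff, goal_cases)
          case 2
          show ?case
          proof (intro ballI impI)
            fix i assume "i \<in> {1..k}" "x \<le> V i \<omega>"
            then show "V j \<omega> + t \<le> V i \<omega>" using Pj(1) Pj(2)[of i] by (cases "i = j") auto
          qed
        qed (use Pj t in auto)
        ultimately show ?thesis by (simp add: cell_length_def)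
      qed
      with sp show "\<omega> \<in> {\<omega>\<in>space M. \<not> cell_len x \<omega> < t}" by simp
    qed
  qed
  have "(1 - t) ^ k + real k * (t * (1 - t) ^ (k - 1)) = (\<Sum>j\<in>{0..k}. prob (if j = 0 then E0 else E j))"
    by (simp add: sum.atLeast_Suc_atMost pr0 pr)
  also have "\<dots> = prob (\<Union>j\<in>{0..k}. if j = 0 then E0 else E j)"
    using E0_meas E_meas by (intro finite_measure_finite_Union[symmetric] disj) auto
  also have "\<dots> \<le> prob {\<omega>\<in>space M. \<not> cell_len x \<omega> < t}"
    by (intro finite_measure_mono long) measurable
  also have "\<dots> = 1 - prob {\<omega>\<in>space M. cell_len x \<omega> < t}"
    by (rule prob_neg) measurable
  finally show ?thesis by (simp add: short_cell_bound_def algebra_simps)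
qed

lemma cell_len_pos:
  assumes "0 < x" "x \<le> 1" shows "0 < cell_len x \<omega>"
  using lower_split_less[of x k "\<lambda>j. V j \<omega>"] upper_split_ge[of x k "\<lambda>j. V j \<omega>"] assms
  by (simp add: cell_length_def)

end

context uniform_splits
begin

lemma prob_cell_len_less_le_linear:
  assumes "0 < x" "x \<le> 1" "2 \<le> k" "0 < t"
  shows "prob {\<omega>\<in>space M. cell_len x \<omega> < t} \<le> real k * t"
proof (cases "t \<le> 1/2")
  case False
  then have "1 \<le> real k * t" using mult_mono[of 2 "real k" "1/2" t] assms by simp
  then show ?thesis using prob_le_1 order_trans by blast
qed (use assms prob_short_cell_len_less_le_linear in auto)

lemma prob_cell_len_less_le_square:
  assumes x: "d \<le> x" "x \<le> 1 - d" and d: "0 < d" "1 \<le> real k * d" and t: "0 < t"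
  shows "prob {\<omega>\<in>space M. cell_len x \<omega> < t} \<le> (real k * t)\<^sup>2"
proof (cases "t \<le> d")
  case True
  have "prob {\<omega>\<in>space M. cell_len x \<omega> < t} \<le> short_cell_bound k t"
    using True x t by (intro prob_cell_len_less_le) auto
  also have "\<dots> \<le> (real k * t)\<^sup>2" using True x t by (intro short_cell_bound_le_square) auto
  finally show ?thesis .
next
  case False
  then have "real k * d \<le> real k * t" by (intro mult_left_mono) auto
  then have "1 \<le> (real k * t)\<^sup>2" using d by (intro one_le_power) auto
  then show ?thesis using prob_le_1 order_trans by blast
qed

lemma mean_exp_cell_len_le_linear:
  assumes "0 < x" "x \<le> 1" "2 \<le> k" "0 < l"
  shows "(\<integral>\<^sup>+\<omega>. ennreal (exp (- l * cell_len x \<omega>)) \<partial>M) \<le> ennreal (real k / l)"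
  using mean_exp_le[of "cell_len x" "real k" l 1] prob_cell_len_less_le_linear cell_len_pos assms by simp

lemma mean_exp_cell_len_le_square:
  assumes "d \<le> x" "x \<le> 1 - d" "0 < d" "1 \<le> real k * d" "0 < l"
  shows "(\<integral>\<^sup>+\<omega>. ennreal (exp (- l * cell_len x \<omega>)) \<partial>M) \<le> ennreal (2 * (real k / l)\<^sup>2)"
proof -
  have "0 < k" using assms by (cases k) auto
  then show ?thesis
    using mean_exp_le[of "cell_len x" "real k" l 2] prob_cell_len_less_le_square cell_len_pos assms
    by (simp add: eval_nat_numeral)
qed

end

section \<open>The longer of two independent cells\<close>

locale two_uniform_splits = V: uniform_splits M V k + W: uniform_splits M W k
  for M :: "'a measure" and V W :: "nat \<Rightarrow> 'a \<Rightarrow> real" and k :: nat +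
  assumes cell_len_indep: "\<And>x. V.indep_var borel (V.cell_len x) borel (W.cell_len x)"
begin

definition longer :: "real \<Rightarrow> 'a \<Rightarrow> real" where
  "longer x \<omega> = max (V.cell_len x \<omega>) (W.cell_len x \<omega>)"

lemma longer_measurable [measurable]: "longer x \<in> borel_measurable M"
  unfolding longer_def by measurable

lemma longer_pos: "0 < x \<Longrightarrow> x \<le> 1 \<Longrightarrow> 0 < longer x \<omega>"
  using V.cell_len_pos[of x \<omega>] by (simp add: longer_def less_max_iff_disj)

lemma prob_longer_less:
  "V.prob {\<omega>\<in>space M. longer x \<omega> < t} =
    V.prob {\<omega>\<in>space M. V.cell_len x \<omega> < t} * V.prob {\<omega>\<in>space M. W.cell_len x \<omega> < t}"
proof -
  have "V.prob {\<omega>\<in>space M. longer x \<omega> < t} =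
      V.prob ((\<lambda>\<omega>. (V.cell_len x \<omega>, W.cell_len x \<omega>)) -` ({..<t} \<times> {..<t}) \<inter> space M)"
    by (intro arg_cong[where f = V.prob]) (auto simp: longer_def)
  also have "\<dots> = V.prob (V.cell_len x -` {..<t} \<inter> space M) * V.prob (W.cell_len x -` {..<t} \<inter> space M)"
    by (rule V.indep_varD[OF cell_len_indep]) auto
  finally show ?thesis by (simp add: vimage_def Int_def conj_commute)
qed

lemma prob_longer_less_le:
  assumes "V.prob {\<omega>\<in>space M. V.cell_len x \<omega> < t} \<le> c" "V.prob {\<omega>\<in>space M. W.cell_len x \<omega> < t} \<le> c"
  shows "V.prob {\<omega>\<in>space M. longer x \<omega> < t} \<le> c\<^sup>2"
  unfolding prob_longer_less power2_eq_square
  using assms by (intro mult_mono) (auto intro: order_trans[OF measure_nonneg])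

lemma mean_inverse_longer_le:
  assumes "0 < x" "x \<le> 1" "2 \<le> k"
  shows "(\<integral>\<^sup>+\<omega>. ennreal (1 / longer x \<omega>) \<partial>M) \<le> ennreal (2 * real k)"
  using assms by (intro V.mean_inverse_le prob_longer_less_le longer_pos
      V.prob_cell_len_less_le_linear W.prob_cell_len_less_le_linear) auto

lemma mean_inverse_longer_le_sharp:
  assumes "d \<le> x" "x \<le> 1 - d" "0 < d" "1 \<le> real k * d"
  shows "(\<integral>\<^sup>+\<omega>. ennreal (1 / longer x \<omega>) \<partial>M) \<le> ennreal ((real k)\<^sup>2 / (2 * real k - 1) + 1 / d)"
proof -
  have "0 < k" using assms by (cases k) auto
  then show ?thesis
    using assms by (intro V.mean_inverse_longer_cell_le prob_longer_less_le longer_pos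
        V.prob_cell_len_less_le W.prob_cell_len_less_le) auto
qed

lemma mean_inverse_square_longer_le:
  assumes "d \<le> x" "x \<le> 1 - d" "0 < d" "1 \<le> real k * d"
  shows "(\<integral>\<^sup>+\<omega>. ennreal (1 / (longer x \<omega>)\<^sup>2) \<partial>M) \<le> ennreal (2 * (real k)\<^sup>2)"
proof (rule V.mean_inverse_square_le)
  show "0 < real k" using assms by (cases k) auto
  show "V.prob {\<omega>\<in>space M. longer x \<omega> < t} \<le> (real k * t) ^ 4" if "0 < t" for t
    using prob_longer_less_le[OF V.prob_cell_len_less_le_square W.prob_cell_len_less_le_square] assms that
    by (simp add: power_mult[symmetric])
qed (use assms longer_pos in auto)

end

section \<open>The forest model with quantitative bounds\<close>

lemma split_congs:
  assumes "\<And>j. j \<in> {1..k} \<Longrightarrow> u j = u' j"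
  shows "lower_split k u x = lower_split k u' x" "upper_split k u x = upper_split k u' x"
  unfolding lower_split_def upper_split_def using assms
  by (auto intro!: arg_cong[where f = Max] arg_cong[where f = Min] image_cong)

lemma cell_length_cong:
  assumes "\<And>j. j \<in> {1..k} \<Longrightarrow> u j = u' j"
  shows "cell_length k u x = cell_length k u' x"
  unfolding cell_length_def using split_congs[where u = u and u' = u' and x = x, OF assms] by (simp only:)

lemma divide_mult_left_mono:
  fixes a b c d :: real
  assumes "0 \<le> c" "0 < d" "0 < a" "a \<le> b"
  shows "c / (d * b) \<le> c / (d * a)"
  using assms by (intro divide_left_mono mult_left_mono mult_pos_pos) auto

text \<open>
  One sample size, with the constants that do not depend on it: bounds \<open>m\<close> and \<open>mx\<close> for the density, a
  radius \<open>r\<close> within which the density drops by at most a fifth, and a bound \<open>B\<close> and a Lipschitz constant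
  \<open>C\<close> for the regression function.
\<close>

locale regular_purf = purf_model M \<mu> N \<sigma> n k q X \<epsilon> U
  for M :: "'a measure" and \<mu> :: "real \<Rightarrow> real" and N :: "real measure" and \<sigma> :: real
    and n k q :: nat and X \<epsilon> :: "nat \<Rightarrow> 'a \<Rightarrow> real" and U :: "nat \<Rightarrow> nat \<Rightarrow> 'a \<Rightarrow> real" +
  fixes s :: "real \<Rightarrow> real" and C B m mx r :: real
  assumes n_pos: "0 < n" and q_pos: "0 < q" and k_ge_2: "2 \<le> k"
    and m_pos: "0 < m" and r_pos: "0 < r"
    and density_lower: "\<And>x. x \<in> {0..1} \<Longrightarrow> m \<le> \<mu> x" and density_upper: "\<And>x. x \<in> {0..1} \<Longrightarrow> \<mu> x \<le> mx"
    and density_oscillation: "\<And>x y. x \<in> {0..1} \<Longrightarrow> y \<in> {0..1} \<Longrightarrow> \<bar>x - y\<bar> \<le> r \<Longrightarrow> 4 / 5 * \<mu> x \<le> \<mu> y"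
    and lipschitz: "C-lipschitz_on {0..1} s"
    and bounded: "\<And>x. x \<in> {0..1} \<Longrightarrow> \<bar>s x\<bar> \<le> B"
begin

abbreviation "src \<equiv> case_source X \<epsilon> U"
abbreviation "splits \<equiv> case_prod Split ` ({1..q} \<times> {1..k})"
abbreviation "sources \<equiv> Point ` {0..n} \<union> Noise ` {0..n} \<union> splits"

lemma src_measurable: "i \<in> sources \<Longrightarrow> src i \<in> borel_measurable M"
  using independent by (simp add: indep_vars_def)

lemma X_measurable [measurable]: "i \<le> n \<Longrightarrow> X i \<in> borel_measurable M"
  using src_measurable[of "Point i"] by simp

lemma eps_measurable [measurable]: "i \<le> n \<Longrightarrow> \<epsilon> i \<in> borel_measurable M"
  using src_measurable[of "Noise i"] by simp

lemma U_measurable [measurable]: "l \<in> {1..q} \<Longrightarrow> j \<in> {1..k} \<Longrightarrow> U l j \<in> borel_measurable M"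
  using src_measurable[of "Split l j"] by force

lemma points_indep: "indep_vars (\<lambda>_. borel) X {1..n}"
proof -
  have "indep_vars (\<lambda>_. borel) src (Point ` {1..n})"
    by (rule indep_vars_subset[OF independent]) auto
  from indep_vars_reindex_inj[OF this] show ?thesis by (simp add: inj_on_def)
qed

lemma tree_splits:
  assumes l: "l \<in> {1..q}" shows "uniform_splits M (U l) k"
proof
  have "indep_vars (\<lambda>_. borel) src (Split l ` {1..k})"
    by (rule indep_vars_subset[OF independent]) (use l in auto)
  from indep_vars_reindex_inj[OF this] show "indep_vars (\<lambda>_. borel) (U l) {1..k}"
    by (simp add: inj_on_def)
qed (use split_law[OF l] in auto)

lemma tree_pair:
  assumes l: "l \<in> {1..q}" "l' \<in> {1..q}" "l \<noteq> l'" shows "two_uniform_splits M (U l) (U l') k"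
proof -
  interpret V: uniform_splits M "U l" k by (rule tree_splits) fact
  interpret W: uniform_splits M "U l'" k by (rule tree_splits) fact
  show ?thesis
  proof
    fix x
    let ?f = "\<lambda>l v. cell_length k (\<lambda>j. v (Split l j)) x"
    have f: "?f l \<in> borel_measurable (PiM (Split l ` {1..k}) (\<lambda>_. borel))" for l
    proof -
      have [measurable]: "(\<lambda>v. v (Split l j)) \<in> borel_measurable (PiM (Split l ` {1..k}) (\<lambda>_. borel :: real measure))"
        if "j \<in> {1..k}" for j
        by (rule measurable_component_singleton) (use that in auto)
      show ?thesis unfolding cell_length_def by measurable
    qed
    have "indep_var (PiM (Split l ` {1..k}) (\<lambda>_. borel)) (\<lambda>\<omega>. restrict (\<lambda>i. src i \<omega>) (Split l ` {1..k}))
        (PiM (Split l' ` {1..k}) (\<lambda>_. borel)) (\<lambda>\<omega>. restrict (\<lambda>i. src i \<omega>) (Split l' ` {1..k}))"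
      by (rule indep_var_restrict[OF independent]) (use l in auto)
    from indep_var_compose[OF this f f]
    have "indep_var borel (\<lambda>\<omega>. cell_length k (\<lambda>j. restrict (\<lambda>i. src i \<omega>) (Split l ` {1..k}) (Split l j)) x)
        borel (\<lambda>\<omega>. cell_length k (\<lambda>j. restrict (\<lambda>i. src i \<omega>) (Split l' ` {1..k}) (Split l' j)) x)"
      by (simp add: comp_def)
    moreover have "cell_length k (\<lambda>j. restrict (\<lambda>i. src i \<omega>) (Split l ` {1..k}) (Split l j)) x
        = cell_length k (\<lambda>j. U l j \<omega>) x" for l \<omega>
      by (rule cell_length_cong) auto
    ultimately show "indep_var borel (V.cell_len x) borel (W.cell_len x)" by simp
  qed
qed

abbreviation "lo l x \<omega> \<equiv> lower_split k (\<lambda>j. U l j \<omega>) x"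
abbreviation "hi l x \<omega> \<equiv> upper_split k (\<lambda>j. U l j \<omega>) x"

section \<open>The law of the points\<close>

definition dens :: "real \<Rightarrow> real" where "dens x = \<mu> x * indicator {0..1} x"

lemma dens_measurable [measurable]: "dens \<in> borel_measurable borel"
  unfolding dens_def
  using borel_measurable_continuous_on_indicator[OF _ density_continuous] by (simp add: mult.commute)

lemma dens_nonneg: "0 \<le> dens x"
  using density_nonneg by (auto simp: dens_def indicator_def)

lemma nn_integral_X:
  assumes "i \<le> n" and [measurable]: "g \<in> borel_measurable borel"
  shows "(\<integral>\<^sup>+\<omega>. g (X i \<omega>) \<partial>M) = (\<integral>\<^sup>+x. ennreal (dens x) * g x \<partial>lborel)"
  using distributed_nn_integral[OF point_distributed[OF assms(1)], of g] by (simp add: dens_def)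

definition mass :: "real set \<Rightarrow> real" where "mass A = prob {\<omega>\<in>space M. X 0 \<omega> \<in> A}"

lemma mass_in_unit: "mass A \<in> {0..1}" by (simp add: mass_def)

lemma emeasure_X:
  assumes i: "i \<le> n" and [measurable]: "A \<in> sets borel"
  shows "emeasure M {\<omega>\<in>space M. X i \<omega> \<in> A} = (\<integral>\<^sup>+x. ennreal (dens x) * indicator A x \<partial>lborel)"
proof -
  have "emeasure M {\<omega>\<in>space M. X i \<omega> \<in> A} = (\<integral>\<^sup>+\<omega>. indicator {\<omega>\<in>space M. X i \<omega> \<in> A} \<omega> \<partial>M)"
    using i by simp
  also have "\<dots> = (\<integral>\<^sup>+\<omega>. indicator A (X i \<omega>) \<partial>M)"
    by (intro nn_integral_cong) (simp add: indicator_def)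
  also have "\<dots> = (\<integral>\<^sup>+x. ennreal (dens x) * indicator A x \<partial>lborel)"
    using i by (intro nn_integral_X) auto
  finally show ?thesis .
qed

lemma prob_X:
  assumes "i \<le> n" "A \<in> sets borel"
  shows "prob {\<omega>\<in>space M. X i \<omega> \<in> A} = mass A"
  unfolding mass_def measure_def using emeasure_X[of i A] emeasure_X[of 0 A] assms by simp

lemma emeasure_X_eq_mass:
  assumes "i \<le> n" "A \<in> sets borel"
  shows "emeasure M {\<omega>\<in>space M. X i \<omega> \<in> A} = ennreal (mass A)"
  using prob_X[OF assms] by (simp add: emeasure_eq_measure)

lemma mass_interval_ge:
  assumes ab: "0 \<le> a" "a \<le> b" "b \<le> 1" and c: "0 \<le> c" "\<And>y. y \<in> {a<..b} \<Longrightarrow> c \<le> \<mu> y"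
  shows "c * (b - a) \<le> mass {a<..b}"
proof -
  have "ennreal (c * (b - a)) = (\<integral>\<^sup>+x. ennreal c * indicator {a<..b} x \<partial>lborel)"
    using ab c by (simp add: nn_integral_cmult ennreal_mult)
  also have "\<dots> \<le> (\<integral>\<^sup>+x. ennreal (dens x) * indicator {a<..b} x \<partial>lborel)"
    using ab c(2) by (intro nn_integral_mono) (auto simp: dens_def indicator_def intro!: ennreal_leI)
  also have "\<dots> = ennreal (mass {a<..b})"
    using emeasure_X_eq_mass[of 0 "{a<..b}"] emeasure_X[of 0 "{a<..b}"] by simp
  finally show ?thesis using mass_in_unit[of "{a<..b}"] by (simp add: ennreal_le_iff)
qed

lemma mass_interval_ge_m:
  assumes "0 \<le> a" "a \<le> b" "b \<le> 1" shows "m * (b - a) \<le> mass {a<..b}"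
  using assms m_pos density_lower by (intro mass_interval_ge) auto

lemma X_pos: "AE \<omega> in M. 0 < X 0 \<omega> \<and> X 0 \<omega> \<le> 1"
proof -
  have "emeasure M {\<omega>\<in>space M. X 0 \<omega> \<in> {0}} = (\<integral>\<^sup>+x. ennreal (dens x) * indicator {0} x \<partial>lborel)"
    by (rule emeasure_X) auto
  also have "\<dots> = 0"
    using AE_lborel_singleton[of 0] by (subst nn_integral_0_iff_AE) auto
  finally have "AE \<omega> in M. X 0 \<omega> \<noteq> 0"
    by (subst AE_iff_measurable[where N = "{\<omega>\<in>space M. X 0 \<omega> \<in> {0}}"]) auto
  moreover have "AE \<omega> in M. X 0 \<omega> \<in> {0..1}" using point_range[of 0] by auto
  ultimately show ?thesis by eventually_elim auto
qed

abbreviation near_boundary :: "real \<Rightarrow> 'a set" where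
  "near_boundary d \<equiv> {\<omega>\<in>space M. X 0 \<omega> \<in> - {d..1 - d}}"

lemma prob_near_boundary:
  assumes "0 < d"
  shows "emeasure M (near_boundary d) \<le> ennreal (2 * d * mx)"
proof -
  have mx: "0 \<le> mx" using density_upper[of 0] density_nonneg[of 0] by simp
  have "emeasure M (near_boundary d) = (\<integral>\<^sup>+x. ennreal (dens x) * indicator (- {d..1 - d}) x \<partial>lborel)"
    by (rule emeasure_X) auto
  also have "\<dots> \<le> (\<integral>\<^sup>+x. ennreal mx * indicator {0..d} x + ennreal mx * indicator {1 - d..1} x \<partial>lborel)"
  proof (rule nn_integral_mono)
    fix x :: real
    show "ennreal (dens x) * indicator (- {d..1 - d}) x
        \<le> ennreal mx * indicator {0..d} x + ennreal mx * indicator {1 - d..1} x"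
    proof (cases "x \<in> {0..1} \<and> x \<notin> {d..1 - d}")
      case True
      then have "ennreal (dens x) \<le> ennreal mx" using density_upper by (intro ennreal_leI) (simp add: dens_def)
      moreover have "x \<in> {0..d} \<or> x \<in> {1 - d..1}" using True by auto
      ultimately show ?thesis using True by (elim disjE) (simp_all add: add_increasing add_increasing2)
    next
      case False
      then have "ennreal (dens x) * indicator (- {d..1 - d}) x = 0" by (auto simp: dens_def)
      then show ?thesis by (simp only: zero_le)
    qed
  qed
  also have "\<dots> = ennreal (2 * d * mx)"
    using assms mx by (simp add: nn_integral_add nn_integral_cmult ennreal_mult[symmetric] ennreal_plus[symmetric] mult_ac del: ennreal_plus)
  finally show ?thesis .
qed

text \<open>
  This is where the density of the new point cancels against the density of the sample.
\<close>

lemma mean_inverse_dens: "(\<integral>\<^sup>+\<omega>. ennreal (1 / dens (X 0 \<omega>)) \<partial>M) \<le> 1"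
proof -
  have "(\<integral>\<^sup>+\<omega>. ennreal (1 / dens (X 0 \<omega>)) \<partial>M) = (\<integral>\<^sup>+x. ennreal (dens x) * ennreal (1 / dens x) \<partial>lborel)"
    by (rule nn_integral_X) auto
  also have "\<dots> \<le> (\<integral>\<^sup>+x. indicator {0..1::real} x \<partial>lborel)"
  proof (rule nn_integral_mono)
    fix x :: real
    have "ennreal (dens x) * ennreal (1 / dens x) = ennreal (dens x * (1 / dens x))"
      by (rule ennreal_mult[symmetric]) (use dens_nonneg[of x] in auto)
    also have "\<dots> \<le> ennreal (indicator {0..1} x)"
      by (intro ennreal_leI) (simp add: dens_def indicator_def)
    also have "ennreal (indicator {0..1} x) = indicator {0..1} x" by (auto split: split_indicator)
    finally show "ennreal (dens x) * ennreal (1 / dens x) \<le> indicator {0..1} x" .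
  qed
  finally show ?thesis by simp
qed

section \<open>Counts of sample points\<close>

abbreviation sample_count :: "'a \<Rightarrow> real set \<Rightarrow> real" where
  "sample_count \<omega> A \<equiv> real (card {i\<in>{1..n}. X i \<omega> \<in> A})"

lemma mean_inverse_count_le:
  assumes [measurable]: "A \<in> sets borel"
  shows "(\<integral>\<^sup>+\<omega>. ennreal (1 / sample_count \<omega> A) \<partial>M) \<le> ennreal (2 / (real n * mass A))"
  using inverse_count_le[OF points_indep _ assms, of "mass A"] n_pos mass_in_unit prob_X by simp

lemma mean_inverse_count_le_sharp:
  assumes [measurable]: "A \<in> sets borel" and "0 < mass A"
  shows "(\<integral>\<^sup>+\<omega>. ennreal (1 / sample_count \<omega> A) \<partial>M) \<le> ennreal (1 / (real n * mass A) + 3 / (real n * mass A)\<^sup>2)"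
  using inverse_count_le_sharp[OF points_indep _ assms(1), of "mass A"] assms n_pos mass_in_unit prob_X by simp

lemma mean_inverse_count_cell_le:
  assumes "0 \<le> a" "a < b" "b \<le> 1"
  shows "(\<integral>\<^sup>+\<omega>. ennreal (1 / sample_count \<omega> {a<..b}) \<partial>M) \<le> ennreal (2 / (real n * (m * (b - a))))"
proof -
  have "(\<integral>\<^sup>+\<omega>. ennreal (1 / sample_count \<omega> {a<..b}) \<partial>M) \<le> ennreal (2 / (real n * mass {a<..b}))"
    by (rule mean_inverse_count_le) auto
  also have "\<dots> \<le> ennreal (2 / (real n * (m * (b - a))))"
  proof (intro ennreal_leI divide_mult_left_mono)
    show "m * (b - a) \<le> mass {a<..b}" using assms by (intro mass_interval_ge_m) auto
    show "0 < m * (b - a)" using assms m_pos by simp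
  qed (use n_pos in simp_all)
  finally show ?thesis .
qed

text \<open>
  If \<open>b - a \<le> r\<close>, the mass of the cell is at least \<open>4/5 \<cdot> \<mu> x \<cdot> (b - a)\<close>; otherwise it is at least \<open>m r\<close>.
  The last summand is the second order term of the inverse moment of the count.
\<close>

lemma mean_inverse_count_cell_le_sharp:
  assumes ab: "0 \<le> a" "a < x" "x \<le> b" "b \<le> 1"
  shows "(\<integral>\<^sup>+\<omega>. ennreal (1 / sample_count \<omega> {a<..b}) \<partial>M) \<le>
    ennreal (5 / (4 * real n * dens x) * (1 / (b - a)) + 1 / (real n * (m * r)) + 3 / (real n * m)\<^sup>2 * (1 / (b - a)\<^sup>2))"
proof -
  let ?p = "mass {a<..b}"
  have L: "0 < b - a" using ab by simp
  have pm: "m * (b - a) \<le> ?p" using ab by (intro mass_interval_ge_m) auto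
  then have p: "0 < ?p" using mult_pos_pos[OF m_pos L] by linarith
  have x: "x \<in> {0..1}" "dens x = \<mu> x" using ab by (auto simp: dens_def)
  have \<mu>: "0 < \<mu> x" using density_lower[OF x(1)] m_pos by simp
  have 1: "1 / (real n * ?p) \<le> 5 / (4 * real n * dens x) * (1 / (b - a)) + 1 / (real n * (m * r))"
  proof (cases "b - a \<le> r")
    case True
    have "4 / 5 * \<mu> x * (b - a) \<le> ?p"
      using ab True \<mu> x by (intro mass_interval_ge density_oscillation) auto
    then have "1 / (real n * ?p) \<le> 1 / (real n * (4 / 5 * \<mu> x * (b - a)))"
      using n_pos \<mu> L by (intro divide_mult_left_mono) simp_all
    also have "\<dots> = 5 / (4 * real n * dens x) * (1 / (b - a))" using x by simp
    also have "\<dots> \<le> \<dots> + 1 / (real n * (m * r))" using m_pos r_pos by simp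
    finally show ?thesis .
  next
    case False
    then have "m * r \<le> m * (b - a)" using m_pos by (intro mult_left_mono) simp_all
    with pm have "m * r \<le> ?p" by linarith
    then have "1 / (real n * ?p) \<le> 1 / (real n * (m * r))"
      using n_pos m_pos r_pos by (intro divide_mult_left_mono) simp_all
    also have "\<dots> \<le> 5 / (4 * real n * dens x) * (1 / (b - a)) + \<dots>"
      using x \<mu> L by simp
    finally show ?thesis .
  qed
  have "3 / (real n * ?p)\<^sup>2 \<le> 3 / (real n * (m * (b - a)))\<^sup>2"
  proof (rule divide_left_mono)
    show "(real n * (m * (b - a)))\<^sup>2 \<le> (real n * ?p)\<^sup>2"
      using pm m_pos L by (intro power_mono mult_left_mono) simp_all
    show "0 < (real n * ?p)\<^sup>2 * (real n * (m * (b - a)))\<^sup>2"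
      using n_pos m_pos L p by simp
  qed simp
  also have "\<dots> = 3 / (real n * m)\<^sup>2 * (1 / (b - a)\<^sup>2)" by (simp add: power_mult_distrib)
  finally have 2: "3 / (real n * ?p)\<^sup>2 \<le> 3 / (real n * m)\<^sup>2 * (1 / (b - a)\<^sup>2)" .
  have "(\<integral>\<^sup>+\<omega>. ennreal (1 / sample_count \<omega> {a<..b}) \<partial>M) \<le> ennreal (1 / (real n * ?p) + 3 / (real n * ?p)\<^sup>2)"
    using p by (intro mean_inverse_count_le_sharp) auto
  also have "\<dots> \<le> ennreal (5 / (4 * real n * dens x) * (1 / (b - a)) + 1 / (real n * (m * r)) + 3 / (real n * m)\<^sup>2 * (1 / (b - a)\<^sup>2))"
    using 1 2 by (intro ennreal_leI) simp
  finally show ?thesis .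
qed

end

section \<open>The shared noise of two trees\<close>

context regular_purf
begin

abbreviation "cell_set l x \<omega> \<equiv> cell_at k (\<lambda>j. U l j \<omega>) x"

abbreviation "new_and_splits \<equiv> insert (Point 0) splits"

lemma component_Point:
  assumes "Point i \<in> K"
  shows "(\<lambda>v. v (Point i)) \<in> borel_measurable (PiM K (\<lambda>_. borel :: real measure))"
  by (rule measurable_component_singleton) fact

lemma component_Split:
  assumes "splits \<subseteq> K" "l \<in> {1..q}" "j \<in> {1..k}"
  shows "(\<lambda>v. v (Split l j)) \<in> borel_measurable (PiM K (\<lambda>_. borel :: real measure))"
  by (rule measurable_component_singleton) (use assms in force)

lemma lo_hi_measurable [measurable]:
  assumes "l \<in> {1..q}" "x \<in> borel_measurable M"
  shows "(\<lambda>\<omega>. lo l (x \<omega>) \<omega>) \<in> borel_measurable M" "(\<lambda>\<omega>. hi l (x \<omega>) \<omega>) \<in> borel_measurable M"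
  using assms by (auto intro!: lower_split_measurable upper_split_measurable)

text \<open>
  The cells of the trees at the new point depend on the new point and the splits only, so the sample
  may be replaced by an independent copy. The hypotheses on \<open>G\<close> ask that it is measurable in the
  coordinates of its arguments and ignores all indices outside the model.
\<close>

lemma indep_freeze_sample:
  fixes G :: "(nat \<Rightarrow> real) \<Rightarrow> (nat \<Rightarrow> real \<times> real) \<Rightarrow> ennreal"
  assumes G: "\<And>K f a b. (\<And>i. i \<in> {1..n} \<Longrightarrow> (\<lambda>z. f z i) \<in> borel_measurable K) \<Longrightarrow>
      (\<And>l. l \<in> {1..q} \<Longrightarrow> a l \<in> borel_measurable K) \<Longrightarrow> (\<And>l. l \<in> {1..q} \<Longrightarrow> b l \<in> borel_measurable K) \<Longrightarrow>
      (\<lambda>z. G (f z) (\<lambda>l. (a l z, b l z))) \<in> borel_measurable (K :: ((source \<Rightarrow> real) \<times> (source \<Rightarrow> real)) measure)"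
    and local: "\<And>f f' c c'. (\<And>i. i \<in> {1..n} \<Longrightarrow> f i = f' i) \<Longrightarrow> (\<And>l. l \<in> {1..q} \<Longrightarrow> c l = c' l) \<Longrightarrow> G f c = G f' c'"
  shows "(\<integral>\<^sup>+\<omega>. G (\<lambda>i. X i \<omega>) (\<lambda>l. (lo l (X 0 \<omega>) \<omega>, hi l (X 0 \<omega>) \<omega>)) \<partial>M) =
    (\<integral>\<^sup>+\<omega>. \<integral>\<^sup>+\<omega>'. G (\<lambda>i. X i \<omega>') (\<lambda>l. (lo l (X 0 \<omega>) \<omega>, hi l (X 0 \<omega>) \<omega>)) \<partial>M \<partial>M)"
proof -
  define c where "c v l = (lower_split k (\<lambda>j. v (Split l j)) (v (Point 0)), upper_split k (\<lambda>j. v (Split l j)) (v (Point 0)))"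
    for v :: "source \<Rightarrow> real" and l
  define g where "g v w = G (\<lambda>i. w (Point i)) (c v)" for v w :: "source \<Rightarrow> real"
  have "(\<integral>\<^sup>+\<omega>. g (\<lambda>i. src i \<omega>) (\<lambda>i. src i \<omega>) \<partial>M) = (\<integral>\<^sup>+\<omega>. \<integral>\<^sup>+\<omega>'. g (\<lambda>i. src i \<omega>) (\<lambda>i. src i \<omega>') \<partial>M \<partial>M)"
  proof (rule indep_vars_nn_integral_freeze[OF independent, of new_and_splits "Point ` {1..n}"])
    let ?K = "PiM new_and_splits (\<lambda>_. borel :: real measure) \<Otimes>\<^sub>M PiM (Point ` {1..n}) (\<lambda>_. borel :: real measure)"
    have 1: "(\<lambda>z. snd z (Point i)) \<in> borel_measurable ?K" if "i \<in> {1..n}" for i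
      by (rule measurable_compose[OF measurable_snd component_Point]) (use that in auto)
    have 2: "(\<lambda>z. fst z (Point 0)) \<in> borel_measurable ?K"
      by (rule measurable_compose[OF measurable_fst component_Point]) auto
    have 3: "(\<lambda>z. fst z (Split l j)) \<in> borel_measurable ?K" if "l \<in> {1..q}" "j \<in> {1..k}" for l j
      by (rule measurable_compose[OF measurable_fst component_Split]) (use that in auto)
    show "(\<lambda>z. g (fst z) (snd z)) \<in> borel_measurable ?K"
      unfolding g_def c_def
      by (intro G 1 lower_split_measurable upper_split_measurable 2 3)
    show "g (restrict v new_and_splits) (restrict w (Point ` {1..n})) = g v w" for v w
      unfolding g_def
    proof (rule local)
      fix l assume l: "l \<in> {1..q}"
      have "(\<lambda>j. restrict v new_and_splits (Split l j)) j = v (Split l j)" if "j \<in> {1..k}" for j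
        using l that by force
      note * = split_congs[where u = "\<lambda>j. restrict v new_and_splits (Split l j)" and u' = "\<lambda>j. v (Split l j)", OF this]
      show "c (restrict v new_and_splits) l = c v l"
        unfolding c_def using * by simp
    qed auto
  qed auto
  moreover have "c (\<lambda>i. src i \<omega>) = (\<lambda>l. (lo l (X 0 \<omega>) \<omega>, hi l (X 0 \<omega>) \<omega>))" for \<omega>
    by (simp add: c_def fun_eq_iff)
  ultimately show ?thesis by (simp add: g_def)
qed

text \<open>
  The same for the new point and the splits, with either of them in the outer integral: the first order
  serves estimates at a fixed point, the second one sums over the cells of a fixed partition.
\<close>

lemma indep_freeze_new_point:
  fixes G :: "real \<Rightarrow> (nat \<Rightarrow> real \<times> real) \<Rightarrow> ennreal"
  assumes G: "\<And>K f a b. f \<in> borel_measurable K \<Longrightarrow>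
      (\<And>l. l \<in> {1..q} \<Longrightarrow> a l \<in> borel_measurable K) \<Longrightarrow> (\<And>l. l \<in> {1..q} \<Longrightarrow> b l \<in> borel_measurable K) \<Longrightarrow>
      (\<lambda>z. G (f z) (\<lambda>l. (a l z, b l z))) \<in> borel_measurable (K :: ((source \<Rightarrow> real) \<times> (source \<Rightarrow> real)) measure)"
    and local: "\<And>x c c'. (\<And>l. l \<in> {1..q} \<Longrightarrow> c l = c' l) \<Longrightarrow> G x c = G x c'"
  shows "(\<integral>\<^sup>+\<omega>. G (X 0 \<omega>) (\<lambda>l. (lo l (X 0 \<omega>) \<omega>, hi l (X 0 \<omega>) \<omega>)) \<partial>M) =
      (\<integral>\<^sup>+\<omega>. \<integral>\<^sup>+\<omega>'. G (X 0 \<omega>) (\<lambda>l. (lo l (X 0 \<omega>) \<omega>', hi l (X 0 \<omega>) \<omega>')) \<partial>M \<partial>M)" (is ?points_first)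
    and "(\<integral>\<^sup>+\<omega>. G (X 0 \<omega>) (\<lambda>l. (lo l (X 0 \<omega>) \<omega>, hi l (X 0 \<omega>) \<omega>)) \<partial>M) =
      (\<integral>\<^sup>+\<omega>. \<integral>\<^sup>+\<omega>'. G (X 0 \<omega>') (\<lambda>l. (lo l (X 0 \<omega>') \<omega>, hi l (X 0 \<omega>') \<omega>)) \<partial>M \<partial>M)" (is ?splits_first)
proof -
  define c where "c x v l = (lower_split k (\<lambda>j. v (Split l j)) x, upper_split k (\<lambda>j. v (Split l j)) x)"
    for x and v :: "source \<Rightarrow> real" and l
  define g where "g v w = G (v (Point 0)) (c (v (Point 0)) w)" for v w :: "source \<Rightarrow> real"
  have loc: "g (restrict v {Point 0}) (restrict w splits) = g v w" for v w
  proof -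
    have "c x (restrict w splits) l = c x w l" if l: "l \<in> {1..q}" for x l
    proof -
      have "(\<lambda>j. restrict w splits (Split l j)) j = w (Split l j)" if "j \<in> {1..k}" for j
        using l that by force
      note * = split_congs[where u = "\<lambda>j. restrict w splits (Split l j)" and u' = "\<lambda>j. w (Split l j)", OF this]
      show ?thesis unfolding c_def using * by simp
    qed
    then have "G x (c x (restrict w splits)) = G x (c x w)" for x by (intro local)
    moreover have "restrict v {Point 0} (Point 0) = v (Point 0)" by simp
    ultimately show ?thesis by (simp only: g_def)
  qed
  have c_src: "c x (\<lambda>i. src i \<omega>) = (\<lambda>l. (lo l x \<omega>, hi l x \<omega>))" for x \<omega>
    by (simp add: c_def fun_eq_iff)
  show ?points_first
  proof -
    have "(\<integral>\<^sup>+\<omega>. g (\<lambda>i. src i \<omega>) (\<lambda>i. src i \<omega>) \<partial>M) = (\<integral>\<^sup>+\<omega>. \<integral>\<^sup>+\<omega>'. g (\<lambda>i. src i \<omega>) (\<lambda>i. src i \<omega>') \<partial>M \<partial>M)"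
    proof (rule indep_vars_nn_integral_freeze[OF independent, of "{Point 0}" splits])
      let ?K = "PiM {Point 0} (\<lambda>_. borel :: real measure) \<Otimes>\<^sub>M PiM splits (\<lambda>_. borel :: real measure)"
      have 2: "(\<lambda>z. fst z (Point 0)) \<in> borel_measurable ?K"
        by (rule measurable_compose[OF measurable_fst component_Point]) auto
      have 3: "(\<lambda>z. snd z (Split l j)) \<in> borel_measurable ?K" if "l \<in> {1..q}" "j \<in> {1..k}" for l j
        by (rule measurable_compose[OF measurable_snd component_Split]) (use that in auto)
      show "(\<lambda>z. g (fst z) (snd z)) \<in> borel_measurable ?K"
        unfolding g_def c_def
        by (intro G lower_split_measurable upper_split_measurable 2 3)
      show "g (restrict v {Point 0}) (restrict w splits) = g v w" for v w by (rule loc)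
    qed auto
    then show ?thesis by (simp add: g_def c_src)
  qed
  show ?splits_first
  proof -
    have "(\<integral>\<^sup>+\<omega>. (\<lambda>w v. g v w) (\<lambda>i. src i \<omega>) (\<lambda>i. src i \<omega>) \<partial>M) =
        (\<integral>\<^sup>+\<omega>. \<integral>\<^sup>+\<omega>'. (\<lambda>w v. g v w) (\<lambda>i. src i \<omega>) (\<lambda>i. src i \<omega>') \<partial>M \<partial>M)"
    proof (rule indep_vars_nn_integral_freeze[OF independent, of splits "{Point 0}"])
      let ?K = "PiM splits (\<lambda>_. borel :: real measure) \<Otimes>\<^sub>M PiM {Point 0} (\<lambda>_. borel :: real measure)"
      have 2: "(\<lambda>z. snd z (Point 0)) \<in> borel_measurable ?K"
        by (rule measurable_compose[OF measurable_snd component_Point]) auto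
      have 3: "(\<lambda>z. fst z (Split l j)) \<in> borel_measurable ?K" if "l \<in> {1..q}" "j \<in> {1..k}" for l j
        by (rule measurable_compose[OF measurable_fst component_Split]) (use that in auto)
      show "(\<lambda>z. g (snd z) (fst z)) \<in> borel_measurable ?K"
        unfolding g_def c_def
        by (intro G lower_split_measurable upper_split_measurable 2 3)
      show "g (restrict v {Point 0}) (restrict w splits) = g v w" for v w by (rule loc)
    qed auto
    then show ?thesis by (simp add: g_def c_src)
  qed
qed

definition overlap_ratio :: "'a \<Rightarrow> real set \<Rightarrow> real set \<Rightarrow> real" where
  "overlap_ratio \<omega> A A' = sample_count \<omega> (A \<inter> A') / (sample_count \<omega> A * sample_count \<omega> A')"

definition overlap :: "nat \<Rightarrow> nat \<Rightarrow> 'a \<Rightarrow> real" where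
  "overlap l l' \<omega> = overlap_ratio \<omega> (cell_set l (X 0 \<omega>) \<omega>) (cell_set l' (X 0 \<omega>) \<omega>)"

text \<open>
  The number of common points is at most the number of points in the second set. By symmetry, the
  ratio is therefore at most the smaller one of the two inverse counts.
\<close>

lemma overlap_ratio_le: "overlap_ratio \<omega> A A' \<le> 1 / sample_count \<omega> A"
proof (cases "sample_count \<omega> A' = 0")
  case False
  have "sample_count \<omega> (A \<inter> A') \<le> sample_count \<omega> A'"
    by (intro of_nat_mono card_mono) auto
  then have "overlap_ratio \<omega> A A' \<le> sample_count \<omega> A' / (sample_count \<omega> A * sample_count \<omega> A')"
    unfolding overlap_ratio_def by (intro divide_right_mono) auto
  with False show ?thesis by simp
next
  case True
  then show ?thesis
    unfolding overlap_ratio_def by (simp only: mult_zero_right div_by_0 zero_le_divide_1_iff of_nat_0_le_iff)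
qed

lemma card_eq_sum: "finite J \<Longrightarrow> real (card {i\<in>J. P i}) = (\<Sum>i\<in>J. if P i then 1 else 0)"
  by (simp add: sum.If_cases Int_def)

lemma mean_overlap_freeze:
  assumes l: "l \<in> {1..q}" "l' \<in> {1..q}"
  shows "(\<integral>\<^sup>+\<omega>. ennreal (overlap l l' \<omega>) \<partial>M) =
    (\<integral>\<^sup>+\<omega>. \<integral>\<^sup>+\<omega>'. ennreal (overlap_ratio \<omega>' (cell_set l (X 0 \<omega>) \<omega>) (cell_set l' (X 0 \<omega>) \<omega>)) \<partial>M \<partial>M)"
proof -
  define cn where "cn f A = (\<Sum>i\<in>{1..n}. if f i \<in> A then 1 else 0 :: real)" for f :: "nat \<Rightarrow> real" and A
  define ce where "ce c l = {fst (c l)<..snd (c l)}" for c :: "nat \<Rightarrow> real \<times> real" and l :: nat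
  define G where "G f c = ennreal (cn f (ce c l \<inter> ce c l') / (cn f (ce c l) * cn f (ce c l')))" for f c
  have cn_eq: "sample_count \<omega> A = cn (\<lambda>i. X i \<omega>) A" for \<omega> A
    by (simp only: cn_def card_eq_sum finite_atLeastAtMost)
  have "(\<integral>\<^sup>+\<omega>. G (\<lambda>i. X i \<omega>) (\<lambda>l. (lo l (X 0 \<omega>) \<omega>, hi l (X 0 \<omega>) \<omega>)) \<partial>M) =
    (\<integral>\<^sup>+\<omega>. \<integral>\<^sup>+\<omega>'. G (\<lambda>i. X i \<omega>') (\<lambda>l. (lo l (X 0 \<omega>) \<omega>, hi l (X 0 \<omega>) \<omega>)) \<partial>M \<partial>M)"
  proof (rule indep_freeze_sample)
    fix K :: "((source \<Rightarrow> real) \<times> (source \<Rightarrow> real)) measure"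
      and f :: "_ \<Rightarrow> nat \<Rightarrow> real" and a b :: "nat \<Rightarrow> _ \<Rightarrow> real"
    assume f[measurable]: "\<And>i. i \<in> {1..n} \<Longrightarrow> (\<lambda>z. f z i) \<in> borel_measurable K"
      and "\<And>l. l \<in> {1..q} \<Longrightarrow> a l \<in> borel_measurable K" "\<And>l. l \<in> {1..q} \<Longrightarrow> b l \<in> borel_measurable K"
    then have [measurable]: "a l \<in> borel_measurable K" "b l \<in> borel_measurable K"
      "a l' \<in> borel_measurable K" "b l' \<in> borel_measurable K" using l by auto
    show "(\<lambda>z. G (f z) (\<lambda>l. (a l z, b l z))) \<in> borel_measurable K"
      unfolding G_def cn_def ce_def fst_conv snd_conv Int_iff greaterThanAtMost_iff by measurable
  next
    fix f f' :: "nat \<Rightarrow> real" and c c' :: "nat \<Rightarrow> real \<times> real"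
    assume "\<And>i. i \<in> {1..n} \<Longrightarrow> f i = f' i" "\<And>l. l \<in> {1..q} \<Longrightarrow> c l = c' l"
    then have "cn f = cn f'" "c l = c' l" "c l' = c' l'"
      using l by (auto simp: cn_def fun_eq_iff intro!: sum.cong)
    then show "G f c = G f' c'" by (simp add: G_def ce_def)
  qed
  then show ?thesis by (simp only: G_def ce_def overlap_def overlap_ratio_def cn_eq fst_conv snd_conv)
qed

definition sum_inverse :: "real \<Rightarrow> real" where
  "sum_inverse d = (real k)\<^sup>2 / (2 * real k - 1) + 1 / d"

text \<open>
  The leading term is the first one, about \<open>5 k / (8 n)\<close>; the last one comes from the points near the
  boundary, and the two others are of smaller order than \<open>k / n\<close>.
\<close>

definition overlap_bound :: "real \<Rightarrow> real" where
  "overlap_bound d = 5 / 4 * sum_inverse d / real n + 1 / (real n * (m * r)) + 6 * (real k)\<^sup>2 / (real n * m)\<^sup>2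
    + 8 * d * mx * real k / (real n * m)"

text \<open>
  With the sample integrated out, the inverse count of the longer cell becomes a function \<open>h\<close> of the
  point \<open>x\<close> and the length of that cell: the sharp bound if \<open>x\<close> has distance at least \<open>d\<close> from the
  boundary, and a crude one otherwise. It remains to integrate over the splits at fixed \<open>x\<close> and then
  over \<open>x\<close>.
\<close>

lemma mean_overlap_le:
  assumes l: "l \<in> {1..q}" "l' \<in> {1..q}" "l \<noteq> l'" and d: "0 < d" "1 \<le> real k * d"
  shows "(\<integral>\<^sup>+\<omega>. ennreal (overlap l l' \<omega>) \<partial>M) \<le> ennreal (overlap_bound d)"
proof -
  interpret two_uniform_splits M "U l" "U l'" k by (rule tree_pair) fact+
  let ?len = "\<lambda>c l. snd (c l) - fst (c l) :: real"
  define h where "h x L = (if d \<le> x \<and> x \<le> 1 - d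
      then 5 / (4 * real n * dens x) * (1 / L) + 1 / (real n * (m * r)) + 3 / (real n * m)\<^sup>2 * (1 / L\<^sup>2)
      else 2 / (real n * m) * (1 / L))" for x L
  have L_eq: "longer x \<omega> = max (hi l x \<omega> - lo l x \<omega>) (hi l' x \<omega> - lo l' x \<omega>)" for x \<omega>
    by (simp add: longer_def cell_length_def)
  have mx: "0 \<le> mx" using density_upper[of 0] density_nonneg[of 0] by simp
  have cell_bound: "(\<integral>\<^sup>+\<omega>'. ennreal (1 / sample_count \<omega>' {a<..b}) \<partial>M) \<le> ennreal (h x (b - a))"
    if "0 \<le> a" "a < x" "x \<le> b" "b \<le> 1" for a b x
  proof (cases "d \<le> x \<and> x \<le> 1 - d")
    case True
    then show ?thesis using mean_inverse_count_cell_le_sharp[OF that] by (simp add: h_def)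
  next
    case False
    have "(\<integral>\<^sup>+\<omega>'. ennreal (1 / sample_count \<omega>' {a<..b}) \<partial>M) \<le> ennreal (2 / (real n * (m * (b - a))))"
      using that by (intro mean_inverse_count_cell_le) auto
    also have "2 / (real n * (m * (b - a))) = h x (b - a)"
      unfolding h_def if_not_P[OF False] by simp
    finally show ?thesis .
  qed
  have inner: "(\<integral>\<^sup>+\<omega>'. ennreal (overlap_ratio \<omega>' (cell_set l x \<omega>) (cell_set l' x \<omega>)) \<partial>M) \<le> ennreal (h x (longer x \<omega>))"
    if x: "0 < x" "x \<le> 1" for x \<omega>
  proof (cases "hi l' x \<omega> - lo l' x \<omega> \<le> hi l x \<omega> - lo l x \<omega>")
    case True
    have "(\<integral>\<^sup>+\<omega>'. ennreal (overlap_ratio \<omega>' (cell_set l x \<omega>) (cell_set l' x \<omega>)) \<partial>M)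
        \<le> (\<integral>\<^sup>+\<omega>'. ennreal (1 / sample_count \<omega>' (cell_set l x \<omega>)) \<partial>M)"
      by (intro nn_integral_mono ennreal_leI overlap_ratio_le)
    also have "\<dots> \<le> ennreal (h x (hi l x \<omega> - lo l x \<omega>))"
      using x by (intro cell_bound lower_split_nonneg upper_split_le_1 lower_split_less upper_split_ge)
    finally show ?thesis using True by (simp add: L_eq max_absorb1)
  next
    case False
    have "(\<integral>\<^sup>+\<omega>'. ennreal (overlap_ratio \<omega>' (cell_set l x \<omega>) (cell_set l' x \<omega>)) \<partial>M)
        \<le> (\<integral>\<^sup>+\<omega>'. ennreal (1 / sample_count \<omega>' (cell_set l' x \<omega>)) \<partial>M)"
    proof (intro nn_integral_mono ennreal_leI)
      fix \<omega>'
      show "overlap_ratio \<omega>' (cell_set l x \<omega>) (cell_set l' x \<omega>) \<le> 1 / sample_count \<omega>' (cell_set l' x \<omega>)"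
        using overlap_ratio_le[of \<omega>' "cell_set l' x \<omega>" "cell_set l x \<omega>"]
        unfolding overlap_ratio_def by (simp only: Int_commute mult.commute)
    qed
    also have "\<dots> \<le> ennreal (h x (hi l' x \<omega> - lo l' x \<omega>))"
      using x by (intro cell_bound lower_split_nonneg upper_split_le_1 lower_split_less upper_split_ge)
    finally show ?thesis using False by (simp add: L_eq max_absorb2)
  qed
  have "(\<integral>\<^sup>+\<omega>. ennreal (overlap l l' \<omega>) \<partial>M) \<le> (\<integral>\<^sup>+\<omega>. ennreal (h (X 0 \<omega>) (longer (X 0 \<omega>) \<omega>)) \<partial>M)"
    unfolding mean_overlap_freeze[OF l(1,2)]
  proof (rule nn_integral_mono_AE, use X_pos in eventually_elim)
    fix \<omega> assume "0 < X 0 \<omega> \<and> X 0 \<omega> \<le> 1"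
    then show "(\<integral>\<^sup>+\<omega>'. ennreal (overlap_ratio \<omega>' (cell_set l (X 0 \<omega>) \<omega>) (cell_set l' (X 0 \<omega>) \<omega>)) \<partial>M)
      \<le> ennreal (h (X 0 \<omega>) (longer (X 0 \<omega>) \<omega>))"
      by (intro inner) blast+
  qed
  also have "\<dots> = (\<integral>\<^sup>+\<omega>. \<integral>\<^sup>+\<omega>'. ennreal (h (X 0 \<omega>) (longer (X 0 \<omega>) \<omega>')) \<partial>M \<partial>M)"
  proof -
    define G where "G x c = ennreal (h x (max (?len c l) (?len c l')))" for x and c :: "nat \<Rightarrow> real \<times> real"
    have "(\<integral>\<^sup>+\<omega>. G (X 0 \<omega>) (\<lambda>l. (lo l (X 0 \<omega>) \<omega>, hi l (X 0 \<omega>) \<omega>)) \<partial>M) =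
      (\<integral>\<^sup>+\<omega>. \<integral>\<^sup>+\<omega>'. G (X 0 \<omega>) (\<lambda>l. (lo l (X 0 \<omega>) \<omega>', hi l (X 0 \<omega>) \<omega>')) \<partial>M \<partial>M)"
    proof (rule indep_freeze_new_point(1))
      fix K :: "((source \<Rightarrow> real) \<times> (source \<Rightarrow> real)) measure"
        and f :: "_ \<Rightarrow> real" and a b :: "nat \<Rightarrow> _ \<Rightarrow> real"
      assume f[measurable]: "f \<in> borel_measurable K"
        and "\<And>l. l \<in> {1..q} \<Longrightarrow> a l \<in> borel_measurable K" "\<And>l. l \<in> {1..q} \<Longrightarrow> b l \<in> borel_measurable K"
      then have [measurable]: "a l \<in> borel_measurable K" "b l \<in> borel_measurable K"
        "a l' \<in> borel_measurable K" "b l' \<in> borel_measurable K" using l by auto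
      show "(\<lambda>z. G (f z) (\<lambda>l. (a l z, b l z))) \<in> borel_measurable K"
        unfolding G_def h_def fst_conv snd_conv by measurable
    next
      fix x and c c' :: "nat \<Rightarrow> real \<times> real" assume "\<And>l. l \<in> {1..q} \<Longrightarrow> c l = c' l"
      then show "G x c = G x c'" using l by (simp add: G_def)
    qed
    then show ?thesis by (simp add: G_def L_eq)
  qed
  also have "\<dots> \<le> (\<integral>\<^sup>+\<omega>. (ennreal (5 / 4 * sum_inverse d / real n) * ennreal (1 / dens (X 0 \<omega>)) +
      ennreal (1 / (real n * (m * r)) + 6 * (real k)\<^sup>2 / (real n * m)\<^sup>2)) +
      ennreal (4 * real k / (real n * m)) * indicator (near_boundary d) \<omega> \<partial>M)"
  proof (rule nn_integral_mono_AE, use X_pos AE_space in eventually_elim)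
    fix \<omega> assume x: "0 < X 0 \<omega> \<and> X 0 \<omega> \<le> 1" and \<omega>: "\<omega> \<in> space M"
    let ?x = "X 0 \<omega>"
    have si: "0 \<le> sum_inverse d" using d k_ge_2 by (simp add: sum_inverse_def)
    show "(\<integral>\<^sup>+\<omega>'. ennreal (h ?x (longer ?x \<omega>')) \<partial>M) \<le>
      (ennreal (5 / 4 * sum_inverse d / real n) * ennreal (1 / dens ?x) +
      ennreal (1 / (real n * (m * r)) + 6 * (real k)\<^sup>2 / (real n * m)\<^sup>2)) +
      ennreal (4 * real k / (real n * m)) * indicator (near_boundary d) \<omega>"
    proof (cases "d \<le> ?x \<and> ?x \<le> 1 - d")
      case True
      define c1 c2 c3 where "c1 = 5 / (4 * real n * dens ?x)" and "c2 = 1 / (real n * (m * r))"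
        and "c3 = 3 / (real n * m)\<^sup>2"
      have c: "0 \<le> c1" "0 \<le> c2" "0 \<le> c3"
        using dens_nonneg m_pos r_pos by (auto simp: c1_def c2_def c3_def)
      have L: "0 \<le> 1 / longer ?x \<omega>'" for \<omega>' using longer_pos[of ?x \<omega>'] x by simp
      have "(\<integral>\<^sup>+\<omega>'. ennreal (h ?x (longer ?x \<omega>')) \<partial>M) =
          (\<integral>\<^sup>+\<omega>'. ennreal c1 * ennreal (1 / longer ?x \<omega>') + (ennreal c2 + ennreal c3 * ennreal (1 / (longer ?x \<omega>')\<^sup>2)) \<partial>M)"
      proof (rule nn_integral_cong)
        fix \<omega>'
        have "h ?x (longer ?x \<omega>') = c1 * (1 / longer ?x \<omega>') + (c2 + c3 * (1 / (longer ?x \<omega>')\<^sup>2))"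
          using True by (simp add: h_def c1_def c2_def c3_def)
        then show "ennreal (h ?x (longer ?x \<omega>')) = ennreal c1 * ennreal (1 / longer ?x \<omega>') + (ennreal c2 + ennreal c3 * ennreal (1 / (longer ?x \<omega>')\<^sup>2))"
          using c L[of \<omega>'] by (simp only: ennreal_plus ennreal_mult mult_nonneg_nonneg add_nonneg_nonneg zero_le_power2 zero_le_divide_1_iff)
      qed
      also have "\<dots> = ennreal c1 * (\<integral>\<^sup>+\<omega>'. ennreal (1 / longer ?x \<omega>') \<partial>M) +
          (ennreal c2 + ennreal c3 * (\<integral>\<^sup>+\<omega>'. ennreal (1 / (longer ?x \<omega>')\<^sup>2) \<partial>M))"
        by (simp add: nn_integral_add nn_integral_cmult emeasure_space_1)
      also have "\<dots> \<le> ennreal c1 * ennreal (sum_inverse d) + (ennreal c2 + ennreal c3 * ennreal (2 * (real k)\<^sup>2))"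
        unfolding sum_inverse_def using True d
        by (intro add_mono mult_left_mono mean_inverse_longer_le_sharp mean_inverse_square_longer_le) auto
      also have "ennreal c1 * ennreal (sum_inverse d) = ennreal (5 / 4 * sum_inverse d / real n) * ennreal (1 / dens ?x)"
      proof -
        have "c1 * sum_inverse d = 5 / 4 * sum_inverse d / real n * (1 / dens ?x)" by (simp add: c1_def)
        then show ?thesis using c si dens_nonneg by (simp add: ennreal_mult[symmetric])
      qed
      also have "ennreal c2 + ennreal c3 * ennreal (2 * (real k)\<^sup>2) = ennreal (c2 + 6 * (real k)\<^sup>2 / (real n * m)\<^sup>2)"
      proof -
        have "c3 * (2 * (real k)\<^sup>2) = 6 * (real k)\<^sup>2 / (real n * m)\<^sup>2" by (simp add: c3_def)
        then show ?thesis using c by (simp add: ennreal_mult[symmetric] ennreal_plus[symmetric] del: ennreal_plus)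
      qed
      finally show ?thesis unfolding c2_def by (rule order_trans) simp
    next
      case False
      have "(\<integral>\<^sup>+\<omega>'. ennreal (h ?x (longer ?x \<omega>')) \<partial>M) = (\<integral>\<^sup>+\<omega>'. ennreal (2 / (real n * m)) * ennreal (1 / longer ?x \<omega>') \<partial>M)"
      proof (rule nn_integral_cong)
        fix \<omega>'
        have "0 \<le> 1 / longer ?x \<omega>'" using longer_pos[of ?x \<omega>'] x by simp
        then show "ennreal (h ?x (longer ?x \<omega>')) = ennreal (2 / (real n * m)) * ennreal (1 / longer ?x \<omega>')"
          unfolding h_def if_not_P[OF False] using m_pos by (intro ennreal_mult) auto
      qed
      also have "\<dots> = ennreal (2 / (real n * m)) * (\<integral>\<^sup>+\<omega>'. ennreal (1 / longer ?x \<omega>') \<partial>M)"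
        by (rule nn_integral_cmult) measurable
      also have "\<dots> \<le> ennreal (2 / (real n * m)) * ennreal (2 * real k)"
        using x k_ge_2 by (intro mult_left_mono mean_inverse_longer_le) auto
      also have "\<dots> = ennreal (4 * real k / (real n * m))"
        using m_pos by (simp add: ennreal_mult[symmetric])
      finally have "(\<integral>\<^sup>+\<omega>'. ennreal (h ?x (longer ?x \<omega>')) \<partial>M) \<le>
          ennreal (4 * real k / (real n * m)) * indicator (near_boundary d) \<omega>"
        using False \<omega> by (simp add: indicator_def)
      then show ?thesis by (rule order_trans) (simp add: add_increasing)
    qed
  qed
  also have "\<dots> = ennreal (5 / 4 * sum_inverse d / real n) * (\<integral>\<^sup>+\<omega>. ennreal (1 / dens (X 0 \<omega>)) \<partial>M) +
      ennreal (1 / (real n * (m * r)) + 6 * (real k)\<^sup>2 / (real n * m)\<^sup>2) +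
      ennreal (4 * real k / (real n * m)) * emeasure M (near_boundary d)"
    by (simp add: nn_integral_add nn_integral_cmult emeasure_space_1 del: ennreal_plus atLeastAtMost_iff Compl_iff)
  also have "\<dots> \<le> ennreal (5 / 4 * sum_inverse d / real n) * 1 +
      ennreal (1 / (real n * (m * r)) + 6 * (real k)\<^sup>2 / (real n * m)\<^sup>2) +
      ennreal (4 * real k / (real n * m)) * ennreal (2 * d * mx)"
    using d by (intro add_mono mult_left_mono mean_inverse_dens prob_near_boundary) auto
  also have "\<dots> = ennreal (overlap_bound d)"
  proof -
    have "0 \<le> sum_inverse d" using d k_ge_2 by (simp add: sum_inverse_def)
    moreover have "overlap_bound d = 5 / 4 * sum_inverse d / real n + (1 / (real n * (m * r)) + 6 * (real k)\<^sup>2 / (real n * m)\<^sup>2)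
        + 4 * real k / (real n * m) * (2 * d * mx)"
      by (simp add: overlap_bound_def)
    ultimately show ?thesis
      using m_pos r_pos d mx by (simp add: ennreal_mult[symmetric] ennreal_plus[symmetric] del: ennreal_plus)
  qed
  finally show ?thesis .
qed

end

context regular_purf
begin

lemma mass_interval_measurable:
  fixes a b :: "'c \<Rightarrow> real"
  assumes [measurable]: "a \<in> borel_measurable K" "b \<in> borel_measurable K"
  shows "(\<lambda>z. mass {a z<..b z}) \<in> borel_measurable K"
proof -
  have "mass {c<..d} = enn2real (\<integral>\<^sup>+x. ennreal (dens x) * (if c < x \<and> x \<le> d then 1 else 0) \<partial>lborel)" for c d
  proof -
    have "ennreal (mass {c<..d}) = (\<integral>\<^sup>+x. ennreal (dens x) * indicator {c<..d} x \<partial>lborel)"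
      using emeasure_X_eq_mass[of 0 "{c<..d}"] emeasure_X[of 0 "{c<..d}"] by simp
    then have "ennreal (mass {c<..d}) = (\<integral>\<^sup>+x. ennreal (dens x) * (if c < x \<and> x \<le> d then 1 else 0) \<partial>lborel)"
      by (simp add: indicator_def of_bool_def)
    then show ?thesis using mass_in_unit[of "{c<..d}"] by (metis atLeastAtMost_iff enn2real_ennreal)
  qed
  then show ?thesis by simp
qed

text \<open>
  The sum over the cells of the mass times the inverse mass is the number of cells of positive mass.
\<close>

lemma mean_inverse_mass_le:
  assumes u: "\<And>j. j \<in> {1..k} \<Longrightarrow> u j \<in> {0..1}"
  shows "(\<integral>\<^sup>+\<omega>. ennreal (2 / (real n * mass (cell_at k u (X 0 \<omega>)))) \<partial>M) \<le> ennreal (2 * (real k + 1) / real n)"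
proof -
  define b where "b A = 2 / (real n * mass A)" for A
  have b0: "0 \<le> b A" for A using mass_in_unit[of A] by (simp add: b_def)
  have cells [measurable]: "cell k u j \<in> sets borel" for j by (simp add: cell_def)
  have "(\<integral>\<^sup>+\<omega>. ennreal (b (cell_at k u (X 0 \<omega>))) \<partial>M) = (\<integral>\<^sup>+\<omega>. ennreal (tree b k u (X 0 \<omega>)) \<partial>M)"
    by (intro nn_integral_cong_AE, use X_pos in eventually_elim) (subst tree_eq_cell_at, use u in auto)
  also have "\<dots> = (\<integral>\<^sup>+\<omega>. (\<Sum>j=0..k. ennreal (b (cell k u j)) * indicator {\<omega>\<in>space M. X 0 \<omega> \<in> cell k u j} \<omega>) \<partial>M)"
  proof (rule nn_integral_cong)
    fix \<omega> assume \<omega>: "\<omega> \<in> space M"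
    have "ennreal (tree b k u (X 0 \<omega>)) = (\<Sum>j=0..k. ennreal (b (cell k u j) * indicator (cell k u j) (X 0 \<omega>)))"
      unfolding tree_def using b0 by (intro sum_ennreal[symmetric]) auto
    also have "\<dots> = (\<Sum>j=0..k. ennreal (b (cell k u j)) * indicator {\<omega>\<in>space M. X 0 \<omega> \<in> cell k u j} \<omega>)"
      using \<omega> by (intro sum.cong refl) (auto split: split_indicator)
    finally show "ennreal (tree b k u (X 0 \<omega>)) = (\<Sum>j=0..k. ennreal (b (cell k u j)) * indicator {\<omega>\<in>space M. X 0 \<omega> \<in> cell k u j} \<omega>)" .
  qed
  also have "\<dots> = (\<Sum>j=0..k. ennreal (b (cell k u j)) * ennreal (mass (cell k u j)))"
    by (subst nn_integral_sum, measurable) (simp add: nn_integral_cmult emeasure_X_eq_mass)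
  also have "\<dots> \<le> (\<Sum>j=0..k. ennreal (2 / real n))"
  proof (intro sum_mono)
    fix j
    have "b (cell k u j) * mass (cell k u j) \<le> 2 / real n" by (simp add: b_def)
    then show "ennreal (b (cell k u j)) * ennreal (mass (cell k u j)) \<le> ennreal (2 / real n)"
      using b0 mass_in_unit[of "cell k u j"] by (simp add: ennreal_mult[symmetric] ennreal_leI)
  qed
  also have "\<dots> = ennreal (2 * (real k + 1) / real n)"
    by (subst sum_ennreal) (auto simp: field_simps)
  finally show ?thesis by (simp add: b_def)
qed

text \<open>
  For a tree paired with itself only the order of magnitude \<open>k / n\<close> matters, since just \<open>q\<close> of the
  \<open>q\<^sup>2\<close> pairs are of this kind.
\<close>

lemma mean_overlap_diagonal_le:
  assumes l: "l \<in> {1..q}"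
  shows "(\<integral>\<^sup>+\<omega>. ennreal (overlap l l \<omega>) \<partial>M) \<le> ennreal (2 * (real k + 1) / real n)"
proof -
  interpret V: uniform_splits M "U l" k by (rule tree_splits) fact
  have "(\<integral>\<^sup>+\<omega>. ennreal (overlap l l \<omega>) \<partial>M) \<le> (\<integral>\<^sup>+\<omega>. ennreal (2 / (real n * mass (cell_set l (X 0 \<omega>) \<omega>))) \<partial>M)"
    unfolding mean_overlap_freeze[OF l l]
  proof (rule nn_integral_mono)
    fix \<omega>
    let ?A = "cell_set l (X 0 \<omega>) \<omega>"
    have "(\<integral>\<^sup>+\<omega>'. ennreal (overlap_ratio \<omega>' ?A ?A) \<partial>M) \<le> (\<integral>\<^sup>+\<omega>'. ennreal (1 / sample_count \<omega>' ?A) \<partial>M)"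
      by (intro nn_integral_mono ennreal_leI overlap_ratio_le)
    also have "\<dots> \<le> ennreal (2 / (real n * mass ?A))" by (rule mean_inverse_count_le) auto
    finally show "(\<integral>\<^sup>+\<omega>'. ennreal (overlap_ratio \<omega>' ?A ?A) \<partial>M) \<le> ennreal (2 / (real n * mass ?A))" .
  qed
  also have "\<dots> = (\<integral>\<^sup>+\<omega>. \<integral>\<^sup>+\<omega>'. ennreal (2 / (real n * mass (cell_set l (X 0 \<omega>') \<omega>))) \<partial>M \<partial>M)"
  proof -
    define G where "G x c = ennreal (2 / (real n * mass {fst (c l)<..snd (c l)}))" for x :: real and c :: "nat \<Rightarrow> real \<times> real"
    have "(\<integral>\<^sup>+\<omega>. G (X 0 \<omega>) (\<lambda>l. (lo l (X 0 \<omega>) \<omega>, hi l (X 0 \<omega>) \<omega>)) \<partial>M) =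
      (\<integral>\<^sup>+\<omega>. \<integral>\<^sup>+\<omega>'. G (X 0 \<omega>') (\<lambda>l. (lo l (X 0 \<omega>') \<omega>, hi l (X 0 \<omega>') \<omega>)) \<partial>M \<partial>M)"
    proof (rule indep_freeze_new_point(2))
      fix K :: "((source \<Rightarrow> real) \<times> (source \<Rightarrow> real)) measure"
        and f :: "_ \<Rightarrow> real" and a b :: "nat \<Rightarrow> _ \<Rightarrow> real"
      assume "f \<in> borel_measurable K"
        and "\<And>l. l \<in> {1..q} \<Longrightarrow> a l \<in> borel_measurable K" "\<And>l. l \<in> {1..q} \<Longrightarrow> b l \<in> borel_measurable K"
      then have [measurable]: "a l \<in> borel_measurable K" "b l \<in> borel_measurable K" using l by auto
      note [measurable] = mass_interval_measurable[of "a l" K "b l"]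
      show "(\<lambda>z. G (f z) (\<lambda>l. (a l z, b l z))) \<in> borel_measurable K"
        unfolding G_def fst_conv snd_conv by measurable
    next
      fix x :: real and c c' :: "nat \<Rightarrow> real \<times> real" assume "\<And>l. l \<in> {1..q} \<Longrightarrow> c l = c' l"
      then show "G x c = G x c'" using l by (simp add: G_def)
    qed
    then show ?thesis by (simp only: G_def fst_conv snd_conv)
  qed
  also have "\<dots> \<le> (\<integral>\<^sup>+\<omega>. ennreal (2 * (real k + 1) / real n) \<partial>M)"
    by (rule nn_integral_mono_AE, use V.splits_in_unit in eventually_elim) (intro mean_inverse_mass_le, blast)
  also have "\<dots> = ennreal (2 * (real k + 1) / real n)" by (simp add: emeasure_space_1)
  finally show ?thesis .
qed

end

section \<open>The regression function and its means over cells\<close>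

lemma (in prob_space) abs_expectation_le:
  fixes f g :: "'a \<Rightarrow> real"
  assumes "integrable M f" "integrable M g" "\<And>\<omega>. \<omega> \<in> space M \<Longrightarrow> \<bar>f \<omega>\<bar> \<le> g \<omega>"
  shows "\<bar>expectation f\<bar> \<le> expectation g"
proof -
  have "expectation (\<lambda>\<omega>. \<bar>f \<omega>\<bar>) \<le> expectation g"
    by (intro integral_mono integrable_abs assms)
  with integral_abs_bound[of M f] show ?thesis by (rule order_trans)
qed

context regular_purf
begin

text \<open>
  The regression function is only known on \<open>{0..1}\<close>; this extension is measurable on the whole line and
  takes the same values at all points of the model.
\<close>

definition reg :: "real \<Rightarrow> real" where "reg x = s (max 0 (min 1 x))"

lemma reg_measurable [measurable]: "reg \<in> borel_measurable borel"
proof (rule borel_measurable_continuous_onI)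
  have "continuous_on UNIV (s \<circ> (\<lambda>x. max 0 (min 1 x)))"
    by (rule continuous_on_compose, intro continuous_intros)
      (rule continuous_on_subset[OF lipschitz_on_continuous_on[OF lipschitz]], auto)
  then show "continuous_on UNIV reg" by (simp add: reg_def comp_def)
qed

lemma reg_bounded: "\<bar>reg x\<bar> \<le> B"
  unfolding reg_def by (rule bounded) auto

lemma B_nonneg: "0 \<le> B" using reg_bounded[of 0] by linarith

lemma C_nonneg: "0 \<le> C" using lipschitz by (rule lipschitz_on_nonneg)

lemma reg_X: "i \<le> n \<Longrightarrow> \<omega> \<in> space M \<Longrightarrow> s (X i \<omega>) = reg (X i \<omega>)"
  using point_range[of i \<omega>] by (simp add: reg_def)

lemma reg_lipschitz: "\<bar>reg x - reg y\<bar> \<le> C * \<bar>x - y\<bar>"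
proof -
  have "\<bar>reg x - reg y\<bar> \<le> C * \<bar>max 0 (min 1 x) - max 0 (min 1 y)\<bar>"
    using lipschitz_onD[OF lipschitz, of "max 0 (min 1 x)" "max 0 (min 1 y)"] by (simp add: reg_def dist_real_def)
  also have "\<dots> \<le> C * \<bar>x - y\<bar>" using C_nonneg by (intro mult_left_mono) auto
  finally show ?thesis .
qed

lemma expectation_X_eq:
  assumes "i \<le> n" and [measurable]: "g \<in> borel_measurable borel"
  shows "expectation (\<lambda>\<omega>. g (X i \<omega>)) = (expectation (\<lambda>\<omega>. g (X 0 \<omega>)) :: real)"
proof -
  have "expectation (\<lambda>\<omega>. g (X i \<omega>)) = (\<integral>x. g x \<partial>density lborel (\<lambda>x. ennreal (\<mu> x * indicator {0..1} x)))" if "i \<le> n" for i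
    using that by (subst distributed_distr_eq_density[OF point_distributed[OF that], symmetric], subst integral_distr) auto
  from this[OF assms(1)] this[of 0] show ?thesis by simp
qed

lemma integrable_eps: "integrable M (\<epsilon> 0)"
  using noise_square_integrable by (rule square_integrable_imp_integrable[rotated]) simp

text \<open>
  The mean of the regression function over a set, which is the population mean of the response since the
  noise is centred. It is \<open>0\<close> on null sets, as the population mean.
\<close>

definition pop :: "real set \<Rightarrow> real" where
  "pop A = expectation (\<lambda>\<omega>. reg (X 0 \<omega>) * indicator A (X 0 \<omega>)) / mass A"

lemma integrable_reg_indicator:
  assumes [measurable]: "A \<in> sets borel"
  shows "integrable M (\<lambda>\<omega>. reg (X 0 \<omega>) * indicator A (X 0 \<omega>))"
  using reg_bounded B_nonneg by (intro integrable_const_bound[where B = B]) (auto intro!: AE_I2 split: split_indicator)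

lemma expectation_indicator_X:
  assumes [measurable]: "A \<in> sets borel"
  shows "expectation (\<lambda>\<omega>. indicator A (X 0 \<omega>)) = mass A"
proof -
  have "expectation (\<lambda>\<omega>. indicator A (X 0 \<omega>)) = expectation (\<lambda>\<omega>. indicator {\<omega>\<in>space M. X 0 \<omega> \<in> A} \<omega>)"
    by (intro Bochner_Integration.integral_cong) (auto split: split_indicator)
  also have "\<dots> = mass A" unfolding mass_def by simp
  finally show ?thesis .
qed

lemma integrable_indicator_X:
  assumes [measurable]: "A \<in> sets borel"
  shows "integrable M (\<lambda>\<omega>. c * indicator A (X 0 \<omega>) :: real)"
  by (intro integrable_mult_right integrable_const_bound[where B = 1]) (auto split: split_indicator)

text \<open>
  On a null set both sides vanish: there the conditional measure is the zero measure. Otherwise the noise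
  drops out because it is centred and independent of the point.
\<close>

lemma population_mean_eq:
  assumes A[measurable]: "A \<in> sets borel"
  shows "population_mean M s X \<epsilon> A = pop A"
proof -
  define S where "S = {\<omega>\<in>space M. X 0 \<omega> \<in> A}"
  have S[measurable]: "S \<in> events" by (simp add: S_def)
  have eS: "emeasure M S = ennreal (mass A)" unfolding S_def by (rule emeasure_X_eq_mass) auto
  show ?thesis
  proof (cases "mass A = 0")
    case True
    then have "AE \<omega> in M. \<omega> \<notin> S" using S eS by (intro AE_not_in) auto
    then have "AE \<omega> in uniform_measure M S. response s X \<epsilon> 0 \<omega> = 0"
      by (intro AE_uniform_measureI) auto
    then have "population_mean M s X \<epsilon> A = 0"
      unfolding population_mean_def S_def[symmetric] by (rule integral_eq_zero_AE)
    then show ?thesis using True by (simp add: pop_def)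
  next
    case False
    then have p: "0 < mass A" using mass_in_unit[of A] by auto
    have resp: "population_mean M s X \<epsilon> A = (\<integral>\<omega>. reg (X 0 \<omega>) + \<epsilon> 0 \<omega> \<partial>uniform_measure M S)"
      unfolding population_mean_def S_def[symmetric]
      by (intro Bochner_Integration.integral_cong refl) (simp add: response_def reg_X)
    have "uniform_measure M S = density M (\<lambda>\<omega>. ennreal (indicator S \<omega> / mass A))"
      unfolding uniform_measure_def eS using p
      by (intro density_cong) (auto split: split_indicator simp: divide_ennreal[symmetric])
    then have "population_mean M s X \<epsilon> A = (\<integral>\<omega>. indicator S \<omega> / mass A * (reg (X 0 \<omega>) + \<epsilon> 0 \<omega>) \<partial>M)"
      unfolding resp using p by (simp add: integral_density)
    also have "\<dots> = (\<integral>\<omega>. (reg (X 0 \<omega>) * indicator A (X 0 \<omega>) + indicator A (X 0 \<omega>) * \<epsilon> 0 \<omega>) / mass A \<partial>M)"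
      by (intro Bochner_Integration.integral_cong) (auto simp: S_def split: split_indicator)
    also have "\<dots> = (expectation (\<lambda>\<omega>. reg (X 0 \<omega>) * indicator A (X 0 \<omega>)) + expectation (\<lambda>\<omega>. indicator A (X 0 \<omega>) * \<epsilon> 0 \<omega>)) / mass A"
    proof -
      have "integrable M (\<lambda>\<omega>. indicator A (X 0 \<omega>) * \<epsilon> 0 \<omega>)"
        using integrable_eps by (rule Bochner_Integration.integrable_bound) (auto intro!: AE_I2 split: split_indicator)
      then show ?thesis using integrable_reg_indicator[OF A] by simp
    qed
    also have "expectation (\<lambda>\<omega>. indicator A (X 0 \<omega>) * \<epsilon> 0 \<omega>) = 0"
    proof -
      have "indep_var (PiM {Point 0} (\<lambda>_. borel)) (\<lambda>\<omega>. restrict (\<lambda>i. src i \<omega>) {Point 0})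
          (PiM {Noise 0} (\<lambda>_. borel)) (\<lambda>\<omega>. restrict (\<lambda>i. src i \<omega>) {Noise 0})"
        by (rule indep_var_restrict[OF independent]) auto
      moreover have "(\<lambda>v. indicator A (v (Point 0))) \<in> borel_measurable (PiM {Point 0} (\<lambda>_. borel :: real measure))"
        "(\<lambda>v. v (Noise 0)) \<in> borel_measurable (PiM {Noise 0} (\<lambda>_. borel :: real measure))"
        using component_Point[of 0 "{Point 0}"] measurable_component_singleton[of "Noise 0" "{Noise 0}" "\<lambda>_. borel :: real measure"]
        by simp_all measurable
      ultimately have "indep_var borel ((\<lambda>v. indicator A (v (Point 0)) :: real) \<circ> (\<lambda>\<omega>. restrict (\<lambda>i. src i \<omega>) {Point 0}))
          borel ((\<lambda>v. v (Noise 0)) \<circ> (\<lambda>\<omega>. restrict (\<lambda>i. src i \<omega>) {Noise 0}))"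
        by (intro indep_var_compose)
      then have "indep_var borel (\<lambda>\<omega>. indicator A (X 0 \<omega>) :: real) borel (\<epsilon> 0)"
        by (simp add: comp_def)
      moreover have "integrable M (\<lambda>\<omega>. indicator A (X 0 \<omega>) :: real)"
        by (intro integrable_const_bound[where B = 1]) (auto split: split_indicator)
      ultimately show ?thesis using integrable_eps noise_mean
        by (simp add: indep_var_lebesgue_integral)
    qed
    finally show ?thesis by (simp add: pop_def)
  qed
qed

lemma pop_bounded: "A \<in> sets borel \<Longrightarrow> \<bar>pop A\<bar> \<le> B"
proof -
  assume A[measurable]: "A \<in> sets borel"
  have "\<bar>expectation (\<lambda>\<omega>. reg (X 0 \<omega>) * indicator A (X 0 \<omega>))\<bar> \<le> expectation (\<lambda>\<omega>. B * indicator A (X 0 \<omega>))"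
    by (intro abs_expectation_le[OF integrable_reg_indicator[OF A] integrable_indicator_X[OF A]])
      (simp add: abs_mult reg_bounded split: split_indicator)
  also have "\<dots> = B * mass A" by (simp add: expectation_indicator_X)
  finally show ?thesis using mass_in_unit[of A] B_nonneg
    by (cases "mass A = 0") (auto simp: pop_def abs_divide divide_le_eq)
qed

lemma expectation_centred:
  assumes i: "i \<le> n" and A[measurable]: "A \<in> sets borel" and p: "0 < mass A"
  shows "expectation (\<lambda>\<omega>. indicator A (X i \<omega>) * (reg (X i \<omega>) - pop A)) = 0"
proof -
  have "expectation (\<lambda>\<omega>. indicator A (X i \<omega>) * (reg (X i \<omega>) - pop A)) =
      expectation (\<lambda>\<omega>. indicator A (X 0 \<omega>) * (reg (X 0 \<omega>) - pop A))"
    by (rule expectation_X_eq[OF i, of "\<lambda>x. indicator A x * (reg x - pop A)"]) measurable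
  also have "\<dots> = expectation (\<lambda>\<omega>. reg (X 0 \<omega>) * indicator A (X 0 \<omega>) - pop A * indicator A (X 0 \<omega>))"
    by (simp add: algebra_simps)
  also have "\<dots> = expectation (\<lambda>\<omega>. reg (X 0 \<omega>) * indicator A (X 0 \<omega>)) - pop A * mass A"
  proof -
    have "integrable M (\<lambda>\<omega>. pop A * indicator A (X 0 \<omega>))" by (rule integrable_indicator_X) simp
    then show ?thesis using integrable_reg_indicator[OF A] by (simp add: expectation_indicator_X)
  qed
  finally show ?thesis using p by (simp add: pop_def)
qed

lemma reg_minus_pop_le:
  assumes ab: "a < b" and p: "0 < mass {a<..b}" and y: "y \<in> {a<..b}"
  shows "\<bar>reg y - pop {a<..b}\<bar> \<le> C * (b - a)"
proof -
  let ?A = "{a<..b}"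
  have int: "integrable M (\<lambda>\<omega>. (reg y - reg (X 0 \<omega>)) * indicator ?A (X 0 \<omega>))"
    unfolding left_diff_distrib by (intro Bochner_Integration.integrable_diff integrable_indicator_X integrable_reg_indicator) auto
  have "\<bar>expectation (\<lambda>\<omega>. (reg y - reg (X 0 \<omega>)) * indicator ?A (X 0 \<omega>))\<bar> \<le> expectation (\<lambda>\<omega>. C * (b - a) * indicator ?A (X 0 \<omega>))"
  proof (rule abs_expectation_le[OF int])
    show "integrable M (\<lambda>\<omega>. C * (b - a) * indicator ?A (X 0 \<omega>))" by (rule integrable_indicator_X) simp
    fix \<omega>
    have "\<bar>reg y - reg x\<bar> \<le> C * (b - a)" if "x \<in> ?A" for x
    proof -
      have "C * \<bar>y - x\<bar> \<le> C * (b - a)" using C_nonneg that y by (intro mult_left_mono) auto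
      then show ?thesis using reg_lipschitz[of y x] by simp
    qed
    then show "\<bar>(reg y - reg (X 0 \<omega>)) * indicator ?A (X 0 \<omega>)\<bar> \<le> C * (b - a) * indicator ?A (X 0 \<omega>)"
      by (simp add: abs_mult split: split_indicator)
  qed
  also have "\<dots> = C * (b - a) * mass ?A" by (simp add: expectation_indicator_X)
  also have "expectation (\<lambda>\<omega>. (reg y - reg (X 0 \<omega>)) * indicator ?A (X 0 \<omega>)) = reg y * mass ?A - expectation (\<lambda>\<omega>. reg (X 0 \<omega>) * indicator ?A (X 0 \<omega>))"
  proof -
    have "integrable M (\<lambda>\<omega>. reg y * indicator ?A (X 0 \<omega>))" by (rule integrable_indicator_X) simp
    then show ?thesis using integrable_reg_indicator[of ?A] by (simp add: left_diff_distrib expectation_indicator_X)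
  qed
  also have "\<dots> = (reg y - pop ?A) * mass ?A" using p by (simp add: pop_def field_simps)
  finally show ?thesis using p by (simp add: abs_mult)
qed

end

section \<open>The error that is not due to the noise\<close>

context regular_purf
begin

text \<open>
  If the cell contains sample points, the difference is the mean of the centred variable \<open>g\<close>, which is
  bounded by \<open>C (b - a)\<close>; one factor \<open>b - a\<close> cancels against the inverse moment of the count. If it contains
  none, which has probability at most \<open>exp (- n m (b - a))\<close>, the population mean remains, up to its sign.
\<close>

lemma sample_bias_le:
  assumes ab: "0 \<le> a" "a < b" "b \<le> 1"
  shows "(\<integral>\<^sup>+\<omega>. ennreal (((\<Sum>i=1..n. indicator {a<..b} (X i \<omega>) * reg (X i \<omega>)) / sample_count \<omega> {a<..b} - pop {a<..b})\<^sup>2) \<partial>M)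
    \<le> ennreal (B\<^sup>2 * exp (- (real n * m) * (b - a)) + 2 * C\<^sup>2 / (real n * m))"
proof -
  let ?A = "{a<..b}"
  define g where "g x = indicator ?A x * (reg x - pop ?A)" for x
  define D where "D = C * (b - a)"
  let ?S = "\<lambda>\<omega>. (\<Sum>i=1..n. indicator ?A (X i \<omega>) * reg (X i \<omega>)) / sample_count \<omega> ?A - pop ?A"
  let ?G = "\<lambda>\<omega>. (\<Sum>i=1..n. g (X i \<omega>)) / sample_count \<omega> ?A"
  let ?Z = "\<lambda>\<omega>. if card {i\<in>{1..n}. X i \<omega> \<in> ?A} = 0 then 1 else 0 :: real"
  have L: "0 < b - a" using ab by simp
  have pm: "m * (b - a) \<le> mass ?A" using ab by (intro mass_interval_ge_m) auto
  then have p: "0 < mass ?A" using mult_pos_pos[OF m_pos L] by linarith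
  have D0: "0 \<le> D" using C_nonneg L by (simp add: D_def)
  have [measurable]: "g \<in> borel_measurable borel" unfolding g_def by measurable
  have gD: "\<bar>g x\<bar> \<le> D" for x
    using reg_minus_pop_le[OF ab(2) p, of x] D0 by (cases "x \<in> ?A") (auto simp: g_def D_def)
  have pointwise: "(?S \<omega>)\<^sup>2
      \<le> (?G \<omega>)\<^sup>2 + B\<^sup>2 * ?Z \<omega>" for \<omega>
  proof (cases "card {i\<in>{1..n}. X i \<omega> \<in> ?A} = 0")
    case True
    have "(pop ?A)\<^sup>2 \<le> B\<^sup>2" using pop_bounded[of ?A] B_nonneg by (simp add: abs_le_square_iff[symmetric])
    then show ?thesis unfolding True by simp
  next
    case False
    have "(\<Sum>i=1..n. g (X i \<omega>)) = (\<Sum>i=1..n. indicator ?A (X i \<omega>) * reg (X i \<omega>)) - pop ?A * (\<Sum>i=1..n. indicator ?A (X i \<omega>))"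
      by (simp add: g_def right_diff_distrib sum_subtractf sum_distrib_left mult.commute)
    also have "(\<Sum>i=1..n. indicator ?A (X i \<omega>)) = sample_count \<omega> ?A"
      by (subst card_eq_sum) (auto intro!: sum.cong split: split_indicator)
    finally have "(\<Sum>i=1..n. g (X i \<omega>)) / sample_count \<omega> ?A = (\<Sum>i=1..n. indicator ?A (X i \<omega>) * reg (X i \<omega>)) / sample_count \<omega> ?A - pop ?A"
      using False by (simp only: diff_divide_distrib) simp
    then show ?thesis using False by (simp only: if_False mult_zero_right add_0_right order_refl)
  qed
  have "(\<integral>\<^sup>+\<omega>. ennreal ((?S \<omega>)\<^sup>2) \<partial>M)
      \<le> (\<integral>\<^sup>+\<omega>. ennreal ((?G \<omega>)\<^sup>2) +
          ennreal (B\<^sup>2) * ennreal (?Z \<omega>) \<partial>M)"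
  proof (rule nn_integral_mono)
    fix \<omega>
    have "ennreal ((?S \<omega>)\<^sup>2) \<le>
        ennreal ((?G \<omega>)\<^sup>2 + B\<^sup>2 * ?Z \<omega>)"
      by (rule ennreal_leI) (rule pointwise)
    also have "\<dots> = ennreal ((?G \<omega>)\<^sup>2) +
          ennreal (B\<^sup>2) * ennreal (?Z \<omega>)"
      by (subst ennreal_plus, simp, simp, subst ennreal_mult, simp_all)
    finally show "ennreal ((?S \<omega>)\<^sup>2) \<le>
        ennreal ((?G \<omega>)\<^sup>2) +
          ennreal (B\<^sup>2) * ennreal (?Z \<omega>)" .
  qed
  also have "\<dots> = (\<integral>\<^sup>+\<omega>. ennreal ((?G \<omega>)\<^sup>2) \<partial>M) +
      ennreal (B\<^sup>2) * (\<integral>\<^sup>+\<omega>. ennreal (?Z \<omega>) \<partial>M)"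
  proof -
    have cm: "(\<lambda>\<omega>. sample_count \<omega> ?A) \<in> borel_measurable M"
    proof -
      have [measurable]: "X i \<in> borel_measurable M" if "i \<in> {1..n}" for i using that by simp
      show ?thesis unfolding card_eq_sum[OF finite_atLeastAtMost] by measurable
    qed
    have "(\<lambda>\<omega>. ennreal (if sample_count \<omega> ?A = 0 then 1 else 0)) \<in> borel_measurable M"
      using cm by measurable
    then have 1: "(\<lambda>\<omega>. ennreal (?Z \<omega>)) \<in> borel_measurable M"
      by (simp only: of_nat_eq_0_iff)
    have "(\<lambda>\<omega>. \<Sum>i=1..n. g (X i \<omega>)) \<in> borel_measurable M"
      by (intro borel_measurable_sum measurable_compose[OF X_measurable]) auto
    then have 2: "(\<lambda>\<omega>. ennreal ((?G \<omega>)\<^sup>2)) \<in> borel_measurable M"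
      by (intro measurable_compose[OF _ measurable_ennreal] borel_measurable_power borel_measurable_divide cm)
    show ?thesis
      using nn_integral_add[OF 2 borel_measurable_times_ennreal[OF measurable_const 1]] nn_integral_cmult[OF 1]
      by (simp only: space_borel UNIV_I)
  qed
  also have "\<dots> \<le> ennreal (D\<^sup>2) * ennreal (2 / (real n * (m * (b - a)))) + ennreal (B\<^sup>2) * ennreal (exp (- (real n * m) * (b - a)))"
  proof (intro add_mono mult_left_mono)
    have "(\<integral>\<^sup>+\<omega>. ennreal (((\<Sum>i\<in>{1..n}. g (X i \<omega>)) / sample_count \<omega> ?A)\<^sup>2) \<partial>M) \<le> ennreal (D\<^sup>2) * (\<integral>\<^sup>+\<omega>. ennreal (1 / sample_count \<omega> ?A) \<partial>M)"
    proof (rule centred_mean_square_le[OF points_indep])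
      show "expectation (\<lambda>\<omega>. g (X i \<omega>)) = 0" if "i \<in> {1..n}" for i
        unfolding g_def using that p by (intro expectation_centred) auto
    qed (use gD in \<open>auto simp: g_def[of _] split: split_indicator\<close>)
    also have "\<dots> \<le> ennreal (D\<^sup>2) * ennreal (2 / (real n * (m * (b - a))))"
      using ab by (intro mult_left_mono mean_inverse_count_cell_le) auto
    finally show "(\<integral>\<^sup>+\<omega>. ennreal ((?G \<omega>)\<^sup>2) \<partial>M) \<le> ennreal (D\<^sup>2) * ennreal (2 / (real n * (m * (b - a))))" .
    have "(\<integral>\<^sup>+\<omega>. ennreal (?Z \<omega>) \<partial>M) = ennreal ((1 - mass ?A) ^ card {1..n})"
    proof (rule count_0[OF points_indep])
      show "prob {\<omega>\<in>space M. X i \<omega> \<in> ?A} = mass ?A" if "i \<in> {1..n}" for i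
        by (rule prob_X) (use that in auto)
      show "mass ?A \<in> {0..1}" by (rule mass_in_unit)
    qed (use n_pos in auto)
    also have "card {1..n} = n" by simp
    also have "ennreal ((1 - mass ?A) ^ n) \<le> ennreal (exp (- (real n * m) * (b - a)))"
    proof (rule ennreal_leI)
      have "(1 - mass ?A) ^ n \<le> exp (- mass ?A) ^ n"
        using mass_in_unit[of ?A] exp_ge_add_one_self[of "- mass ?A"] by (intro power_mono) auto
      also have "\<dots> = exp (real n * (- mass ?A))" by (rule exp_of_nat_mult[symmetric])
      also have "\<dots> \<le> exp (- (real n * m) * (b - a))"
        using mult_left_mono[OF pm, of "real n"] by (simp add: mult.assoc)
      finally show "(1 - mass ?A) ^ n \<le> exp (- (real n * m) * (b - a))" .
    qed
    finally show "(\<integral>\<^sup>+\<omega>. ennreal (?Z \<omega>) \<partial>M) \<le> ennreal (exp (- (real n * m) * (b - a)))" .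
  qed auto
  also have "\<dots> = ennreal (D\<^sup>2 * (2 / (real n * (m * (b - a)))) + B\<^sup>2 * exp (- (real n * m) * (b - a)))"
    using L m_pos by (simp add: ennreal_mult[symmetric] ennreal_plus[symmetric] del: ennreal_plus)
  also have "\<dots> \<le> ennreal (B\<^sup>2 * exp (- (real n * m) * (b - a)) + 2 * C\<^sup>2 / (real n * m))"
  proof (rule ennreal_leI)
    have "D\<^sup>2 * (2 / (real n * (m * (b - a)))) = 2 * C\<^sup>2 / (real n * m) * (b - a)"
      using L by (simp add: D_def power2_eq_square)
    also have "\<dots> \<le> 2 * C\<^sup>2 / (real n * m) * 1"
      using ab m_pos by (intro mult_left_mono) auto
    finally show "D\<^sup>2 * (2 / (real n * (m * (b - a)))) + B\<^sup>2 * exp (- (real n * m) * (b - a))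
        \<le> B\<^sup>2 * exp (- (real n * m) * (b - a)) + 2 * C\<^sup>2 / (real n * m)" by simp
  qed
  finally show ?thesis .
qed

lemma pop_interval_measurable:
  fixes a b :: "'c \<Rightarrow> real"
  assumes [measurable]: "a \<in> borel_measurable K" "b \<in> borel_measurable K"
  shows "(\<lambda>z. pop {a z<..b z}) \<in> borel_measurable K"
proof -
  have eq: "indicator {c<..d} x = (if c < x \<and> x \<le> d then 1 else 0 :: real)" for c d x :: real
    by (simp add: indicator_def)
  note [measurable] = mass_interval_measurable[of a K b]
  show ?thesis unfolding pop_def eq by measurable
qed

text \<open>
  Here and below \<open>f\<close> stands for the sample and \<open>c\<close> assigns to each tree the endpoints of its cell; in this
  form the dependence on the sources of randomness is explicit.
\<close>

definition ind :: "(nat \<Rightarrow> real \<times> real) \<Rightarrow> nat \<Rightarrow> real \<Rightarrow> real" where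
  "ind c l x = (if fst (c l) < x \<and> x \<le> snd (c l) then 1 else 0)"

definition cnt :: "(nat \<Rightarrow> real) \<Rightarrow> (nat \<Rightarrow> real \<times> real) \<Rightarrow> nat \<Rightarrow> real" where
  "cnt f c l = (\<Sum>i=1..n. ind c l (f i))"

text \<open>
  The coefficient of the noise of sample point \<open>i\<close> in the forest.
\<close>

definition weight :: "nat \<Rightarrow> (nat \<Rightarrow> real) \<Rightarrow> (nat \<Rightarrow> real \<times> real) \<Rightarrow> real" where
  "weight i f c = (\<Sum>l=1..q. ind c l (f i) / cnt f c l) / real q"

text \<open>
  The error of a tree that remains when the noise is removed from the responses.
\<close>

definition bias :: "nat \<Rightarrow> (nat \<Rightarrow> real) \<Rightarrow> (nat \<Rightarrow> real \<times> real) \<Rightarrow> real" where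
  "bias l f c = (\<Sum>i=1..n. ind c l (f i) * reg (f i)) / cnt f c l - pop {fst (c l)<..snd (c l)}"

definition mean_bias :: "(nat \<Rightarrow> real) \<Rightarrow> (nat \<Rightarrow> real \<times> real) \<Rightarrow> real" where
  "mean_bias f c = (\<Sum>l=1..q. bias l f c) / real q"

abbreviation "sample \<omega> \<equiv> (\<lambda>i. X i \<omega>)"
abbreviation "cells \<omega> \<equiv> (\<lambda>l. (lo l (X 0 \<omega>) \<omega>, hi l (X 0 \<omega>) \<omega>))"

lemma local_congs:
  assumes "\<And>i. i \<in> {1..n} \<Longrightarrow> f i = f' i" "\<And>l. l \<in> {1..q} \<Longrightarrow> c l = c' l"
  shows "i \<in> {1..n} \<Longrightarrow> weight i f c = weight i f' c'" "l \<in> {1..q} \<Longrightarrow> bias l f c = bias l f' c'"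
    "mean_bias f c = mean_bias f' c'"
proof -
  have cnt: "cnt f c l = cnt f' c' l" if "l \<in> {1..q}" for l
    using assms that by (auto simp: cnt_def ind_def intro!: sum.cong)
  show "weight i f c = weight i f' c'" if "i \<in> {1..n}"
    unfolding weight_def using that assms by (auto simp: cnt ind_def intro!: sum.cong arg_cong2[where f = "(/)"])
  show bias: "bias l f c = bias l f' c'" if "l \<in> {1..q}" for l
    unfolding bias_def using that assms by (auto simp: cnt ind_def intro!: sum.cong arg_cong2[where f = "(/)"] arg_cong2[where f = "(-)"])
  show "mean_bias f c = mean_bias f' c'"
    unfolding mean_bias_def using bias by (auto intro!: sum.cong arg_cong2[where f = "(/)"])
qed

lemma local_measurable:
  assumes f[measurable]: "\<And>i. i \<in> {1..n} \<Longrightarrow> (\<lambda>z. f z i) \<in> borel_measurable K"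
    and a[measurable]: "\<And>l. l \<in> {1..q} \<Longrightarrow> a l \<in> borel_measurable K"
    and b[measurable]: "\<And>l. l \<in> {1..q} \<Longrightarrow> b l \<in> borel_measurable K"
  shows "i \<in> {1..n} \<Longrightarrow> (\<lambda>z. weight i (f z) (\<lambda>l. (a l z, b l z))) \<in> borel_measurable K"
    "l \<in> {1..q} \<Longrightarrow> (\<lambda>z. bias l (f z) (\<lambda>l. (a l z, b l z))) \<in> borel_measurable K"
    "(\<lambda>z. mean_bias (f z) (\<lambda>l. (a l z, b l z))) \<in> borel_measurable K"
proof -
  have ind[measurable]: "(\<lambda>z. ind (\<lambda>l. (a l z, b l z)) l (f z i)) \<in> borel_measurable K" if "i \<in> {1..n}" "l \<in> {1..q}" for i l
    unfolding ind_def fst_conv snd_conv using that by measurable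
  have cnt[measurable]: "(\<lambda>z. cnt (f z) (\<lambda>l. (a l z, b l z)) l) \<in> borel_measurable K" if "l \<in> {1..q}" for l
    unfolding cnt_def using that by measurable
  show "(\<lambda>z. weight i (f z) (\<lambda>l. (a l z, b l z))) \<in> borel_measurable K" if "i \<in> {1..n}"
    unfolding weight_def using that by measurable
  show bias[measurable]: "(\<lambda>z. bias l (f z) (\<lambda>l. (a l z, b l z))) \<in> borel_measurable K" if "l \<in> {1..q}" for l
  proof -
    note [measurable] = pop_interval_measurable[OF a[OF that] b[OF that]]
    show ?thesis unfolding bias_def fst_conv snd_conv using that by measurable
  qed
  show "(\<lambda>z. mean_bias (f z) (\<lambda>l. (a l z, b l z))) \<in> borel_measurable K"
    unfolding mean_bias_def by measurable
qed

lemma count_eq_cnt: "sample_count \<omega> (cell_set l (X 0 \<omega>') \<omega>') = cnt (sample \<omega>) (cells \<omega>') l"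
  by (subst card_eq_sum) (auto simp: cnt_def ind_def intro!: sum.cong)

definition bias_bound :: "real \<Rightarrow> real" where
  "bias_bound d = B\<^sup>2 * (2 * (real k / (real n * m))\<^sup>2 + 2 * d * mx * real k / (real n * m)) + 2 * C\<^sup>2 / (real n * m)"

text \<open>
  Averaging \<^verbatim>\<open>sample_bias_le\<close> over the splits requires the Laplace transform of a cell length, which is
  of order \<open>(k / (n m))\<^sup>2\<close> away from the boundary and \<open>k / (n m)\<close> near it.
\<close>

lemma mean_bias_square_le:
  assumes l: "l \<in> {1..q}" and d: "0 < d" "1 \<le> real k * d"
  shows "(\<integral>\<^sup>+\<omega>. ennreal ((bias l (sample \<omega>) (cells \<omega>))\<^sup>2) \<partial>M) \<le> ennreal (bias_bound d)"
proof -
  interpret V: uniform_splits M "U l" k by (rule tree_splits) fact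
  have mx: "0 \<le> mx" using density_upper[of 0] density_nonneg[of 0] by simp
  let ?l = "real n * m"
  let ?R = "2 * C\<^sup>2 / ?l"
  have nm: "0 < ?l" using n_pos m_pos by simp
  define e where "e = exp \<circ> (\<lambda>L. - ?l * L)"
  have "(\<integral>\<^sup>+\<omega>. ennreal ((bias l (sample \<omega>) (cells \<omega>))\<^sup>2) \<partial>M) =
      (\<integral>\<^sup>+\<omega>. \<integral>\<^sup>+\<omega>'. ennreal ((bias l (sample \<omega>') (cells \<omega>))\<^sup>2) \<partial>M \<partial>M)"
  proof (rule indep_freeze_sample)
    fix K :: "((source \<Rightarrow> real) \<times> (source \<Rightarrow> real)) measure"
      and f :: "_ \<Rightarrow> nat \<Rightarrow> real" and a b :: "nat \<Rightarrow> _ \<Rightarrow> real"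
    assume *: "\<And>i. i \<in> {1..n} \<Longrightarrow> (\<lambda>z. f z i) \<in> borel_measurable K"
      "\<And>l. l \<in> {1..q} \<Longrightarrow> a l \<in> borel_measurable K" "\<And>l. l \<in> {1..q} \<Longrightarrow> b l \<in> borel_measurable K"
    note [measurable] = local_measurable(2)[of f K a b, OF * l]
    show "(\<lambda>z. ennreal ((bias l (f z) (\<lambda>l. (a l z, b l z)))\<^sup>2)) \<in> borel_measurable K" by measurable
  next
    fix f f' :: "nat \<Rightarrow> real" and c c' :: "nat \<Rightarrow> real \<times> real"
    assume "\<And>i. i \<in> {1..n} \<Longrightarrow> f i = f' i" "\<And>l. l \<in> {1..q} \<Longrightarrow> c l = c' l"
    from local_congs(2)[of f f' c c', OF this l]
    show "ennreal ((bias l f c)\<^sup>2) = ennreal ((bias l f' c')\<^sup>2)" by simp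
  qed
  also have "\<dots> \<le> (\<integral>\<^sup>+\<omega>. ennreal (B\<^sup>2 * e (hi l (X 0 \<omega>) \<omega> - lo l (X 0 \<omega>) \<omega>) + ?R) \<partial>M)"
  proof (rule nn_integral_mono_AE, use X_pos in eventually_elim)
    fix \<omega> assume x: "0 < X 0 \<omega> \<and> X 0 \<omega> \<le> 1"
    let ?a = "lo l (X 0 \<omega>) \<omega>" and ?b = "hi l (X 0 \<omega>) \<omega>"
    have ab: "0 \<le> ?a" "?a < ?b" "?b \<le> 1"
      using x lower_split_less[of "X 0 \<omega>" k "\<lambda>j. U l j \<omega>"] upper_split_ge[of "X 0 \<omega>" k "\<lambda>j. U l j \<omega>"]
      by (auto intro: lower_split_nonneg upper_split_le_1)
    have "bias l (sample \<omega>') (cells \<omega>) = (\<Sum>i=1..n. indicator {?a<..?b} (X i \<omega>') * reg (X i \<omega>')) / sample_count \<omega>' {?a<..?b} - pop {?a<..?b}" for \<omega>'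
    proof -
      have ind_eq: "ind (cells \<omega>) l x = indicator {?a<..?b} x" for x
        by (simp add: ind_def indicator_def)
      show ?thesis by (simp only: bias_def ind_eq count_eq_cnt fst_conv snd_conv)
    qed
    then show "(\<integral>\<^sup>+\<omega>'. ennreal ((bias l (sample \<omega>') (cells \<omega>))\<^sup>2) \<partial>M) \<le> ennreal (B\<^sup>2 * e (?b - ?a) + ?R)"
      using sample_bias_le[OF ab] by (simp only: e_def comp_def)
  qed
  also have "\<dots> = (\<integral>\<^sup>+\<omega>. \<integral>\<^sup>+\<omega>'. ennreal (B\<^sup>2 * e (hi l (X 0 \<omega>) \<omega>' - lo l (X 0 \<omega>) \<omega>') + ?R) \<partial>M \<partial>M)"
  proof -
    define G where "G x c = ennreal (B\<^sup>2 * e (snd (c l) - fst (c l)) + ?R)" for x :: real and c :: "nat \<Rightarrow> real \<times> real"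
    have "(\<integral>\<^sup>+\<omega>. G (X 0 \<omega>) (\<lambda>l. (lo l (X 0 \<omega>) \<omega>, hi l (X 0 \<omega>) \<omega>)) \<partial>M) =
      (\<integral>\<^sup>+\<omega>. \<integral>\<^sup>+\<omega>'. G (X 0 \<omega>) (\<lambda>l. (lo l (X 0 \<omega>) \<omega>', hi l (X 0 \<omega>) \<omega>')) \<partial>M \<partial>M)"
    proof (rule indep_freeze_new_point(1))
      fix K :: "((source \<Rightarrow> real) \<times> (source \<Rightarrow> real)) measure"
        and f :: "_ \<Rightarrow> real" and a b :: "nat \<Rightarrow> _ \<Rightarrow> real"
      assume "f \<in> borel_measurable K"
        and "\<And>l. l \<in> {1..q} \<Longrightarrow> a l \<in> borel_measurable K" "\<And>l. l \<in> {1..q} \<Longrightarrow> b l \<in> borel_measurable K"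
      then have [measurable]: "a l \<in> borel_measurable K" "b l \<in> borel_measurable K" using l by auto
      show "(\<lambda>z. G (f z) (\<lambda>l. (a l z, b l z))) \<in> borel_measurable K"
        unfolding G_def fst_conv snd_conv e_def comp_def by measurable
    next
      fix x :: real and c c' :: "nat \<Rightarrow> real \<times> real" assume "\<And>l. l \<in> {1..q} \<Longrightarrow> c l = c' l"
      then show "G x c = G x c'" using l by (simp add: G_def)
    qed
    then show ?thesis by (simp only: G_def fst_conv snd_conv)
  qed
  also have "\<dots> = (\<integral>\<^sup>+\<omega>. ennreal (B\<^sup>2) * (\<integral>\<^sup>+\<omega>'. ennreal (exp (- ?l * V.cell_len (X 0 \<omega>) \<omega>')) \<partial>M) + ennreal ?R \<partial>M)"
  proof (rule nn_integral_cong)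
    fix \<omega>
    have "ennreal (B\<^sup>2 * e (hi l (X 0 \<omega>) \<omega>' - lo l (X 0 \<omega>) \<omega>') + ?R) =
        ennreal (B\<^sup>2) * ennreal (exp (- ?l * V.cell_len (X 0 \<omega>) \<omega>')) + ennreal ?R" for \<omega>'
    proof -
      have "0 \<le> ?R" using nm by (intro divide_nonneg_pos) auto
      then show ?thesis by (simp add: e_def cell_length_def ennreal_mult)
    qed
    then show "(\<integral>\<^sup>+\<omega>'. ennreal (B\<^sup>2 * e (hi l (X 0 \<omega>) \<omega>' - lo l (X 0 \<omega>) \<omega>') + ?R) \<partial>M) =
        ennreal (B\<^sup>2) * (\<integral>\<^sup>+\<omega>'. ennreal (exp (- ?l * V.cell_len (X 0 \<omega>) \<omega>')) \<partial>M) + ennreal ?R"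
      by (simp add: nn_integral_add nn_integral_cmult emeasure_space_1)
  qed
  also have "\<dots> \<le> (\<integral>\<^sup>+\<omega>. ennreal (B\<^sup>2) * (ennreal (2 * (real k / ?l)\<^sup>2) +
      ennreal (real k / ?l) * indicator (near_boundary d) \<omega>) + ennreal ?R \<partial>M)"
  proof (rule nn_integral_mono_AE, use X_pos AE_space in eventually_elim)
    fix \<omega> assume x: "0 < X 0 \<omega> \<and> X 0 \<omega> \<le> 1" and \<omega>: "\<omega> \<in> space M"
    have "(\<integral>\<^sup>+\<omega>'. ennreal (exp (- ?l * V.cell_len (X 0 \<omega>) \<omega>')) \<partial>M) \<le> ennreal (2 * (real k / ?l)\<^sup>2) +
      ennreal (real k / ?l) * indicator (near_boundary d) \<omega>"
    proof (cases "d \<le> X 0 \<omega> \<and> X 0 \<omega> \<le> 1 - d")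
      case True
      then show ?thesis using V.mean_exp_cell_len_le_square[of d "X 0 \<omega>" "?l"] d nm
        by (intro order_trans[OF _ add_increasing2[OF zero_le order_refl]]) auto
    next
      case False
      have "(\<integral>\<^sup>+\<omega>'. ennreal (exp (- ?l * V.cell_len (X 0 \<omega>) \<omega>')) \<partial>M) \<le> ennreal (real k / ?l)"
        using x k_ge_2 nm by (intro V.mean_exp_cell_len_le_linear) auto
      also have "\<dots> = ennreal (real k / ?l) * indicator (near_boundary d) \<omega>"
        using False \<omega> by simp
      finally show ?thesis by (rule order_trans) simp
    qed
    then show "ennreal (B\<^sup>2) * (\<integral>\<^sup>+\<omega>'. ennreal (exp (- ?l * V.cell_len (X 0 \<omega>) \<omega>')) \<partial>M) + ennreal ?R
      \<le> ennreal (B\<^sup>2) * (ennreal (2 * (real k / ?l)\<^sup>2) +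
      ennreal (real k / ?l) * indicator (near_boundary d) \<omega>) + ennreal ?R"
      by (intro add_mono mult_left_mono) auto
  qed
  also have "\<dots> = ennreal (B\<^sup>2) * (ennreal (2 * (real k / ?l)\<^sup>2) +
      ennreal (real k / ?l) * emeasure M (near_boundary d)) + ennreal ?R"
    by (simp add: nn_integral_add nn_integral_cmult emeasure_space_1 del: atLeastAtMost_iff Compl_iff)
  also have "\<dots> \<le> ennreal (B\<^sup>2) * (ennreal (2 * (real k / ?l)\<^sup>2) +
      ennreal (real k / ?l) * ennreal (2 * d * mx)) + ennreal ?R"
    using d by (intro add_mono mult_left_mono prob_near_boundary) auto
  also have "\<dots> = ennreal (bias_bound d)"
  proof -
    have *: "bias_bound d = B\<^sup>2 * (2 * (real k / ?l)\<^sup>2 + real k / ?l * (2 * d * mx)) + ?R"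
      by (simp add: bias_bound_def)
    have "0 \<le> ?R" "0 \<le> real k / ?l" "0 \<le> 2 * (real k / ?l)\<^sup>2" "0 \<le> 2 * d * mx" "0 \<le> B\<^sup>2"
      using nm d mx by (auto intro!: divide_nonneg_pos)
    then show ?thesis unfolding * by (simp only: ennreal_plus ennreal_mult add_nonneg_nonneg mult_nonneg_nonneg)
  qed
  finally show ?thesis .
qed

end

section \<open>Measurability of the squared deviation\<close>

lemma nth_sort_le_iff:
  fixes ys :: "'b::linorder list"
  assumes i: "i < length ys"
  shows "sort ys ! i \<le> a \<longleftrightarrow> i < length (filter (\<lambda>y. y \<le> a) ys)"
proof -
  define zs where "zs = sort ys"
  have zs: "length zs = length ys" "sorted zs" by (simp_all add: zs_def)
  have "length (filter (\<lambda>y. y \<le> a) ys) = length (filter (\<lambda>y. y \<le> a) zs)"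
    unfolding zs_def by (metis mset_filter mset_sort size_mset)
  also have "\<dots> = card {j. j < length zs \<and> zs ! j \<le> a}" by (rule length_filter_conv_card)
  finally have len: "length (filter (\<lambda>y. y \<le> a) ys) = card {j. j < length zs \<and> zs ! j \<le> a}" .
  show ?thesis
  proof (cases "zs ! i \<le> a")
    case True
    have "{..i} \<subseteq> {j. j < length zs \<and> zs ! j \<le> a}"
      using True i zs sorted_nth_mono[OF zs(2)] by (auto intro: order_trans)
    then have "card {..i} \<le> card {j. j < length zs \<and> zs ! j \<le> a}" by (intro card_mono) auto
    then show ?thesis using True len by (simp add: zs_def)
  next
    case False
    have "{j. j < length zs \<and> zs ! j \<le> a} \<subseteq> {..<i}"
    proof
      fix j assume j: "j \<in> {j. j < length zs \<and> zs ! j \<le> a}"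
      show "j \<in> {..<i}"
      proof (rule ccontr)
        assume "j \<notin> {..<i}"
        then have "zs ! i \<le> zs ! j" using j by (intro sorted_nth_mono zs) auto
        then show False using j False by auto
      qed
    qed
    then have "card {j. j < length zs \<and> zs ! j \<le> a} \<le> card {..<i}" by (intro card_mono) auto
    then show ?thesis using False len by (simp add: zs_def)
  qed
qed

text \<open>
  An order statistic is at most \<open>a\<close> if and only if enough of the variables are at most \<open>a\<close>.
\<close>

lemma order_stat_measurable:
  assumes u: "\<And>i. i \<in> {1..k} \<Longrightarrow> u i \<in> borel_measurable M" and j: "j \<le> Suc k"
  shows "(\<lambda>\<omega>. order_stat k (\<lambda>i. u i \<omega>) j) \<in> borel_measurable M"
proof (cases "j = 0 \<or> j = Suc k")
  case True
  then show ?thesis by (auto simp: order_stat_def nth_append)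
next
  case False
  then obtain i where i: "j = Suc i" "i < k" using j by (cases j) auto
  have eq: "order_stat k v j = sort (map v [1..<Suc k]) ! i" for v
    using i by (simp add: order_stat_def nth_append)
  show ?thesis unfolding borel_measurable_iff_le
  proof
    fix a
    have "order_stat k v j \<le> a \<longleftrightarrow> i < card {l\<in>{1..k}. v l \<le> a}" for v
    proof -
      have "length (filter (\<lambda>y. y \<le> a) (map v [1..<Suc k])) = length (filter (\<lambda>l. v l \<le> a) [1..<Suc k])"
        by (simp add: filter_map comp_def)
      also have "\<dots> = card (set (filter (\<lambda>l. v l \<le> a) [1..<Suc k]))"
        by (rule distinct_card[symmetric]) simp
      also have "set (filter (\<lambda>l. v l \<le> a) [1..<Suc k]) = {l\<in>{1..k}. v l \<le> a}" by auto
      finally show ?thesis unfolding eq using nth_sort_le_iff[of i "map v [1..<Suc k]" a] i by simp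
    qed
    then have "{\<omega>\<in>space M. order_stat k (\<lambda>i. u i \<omega>) j \<le> a} = {\<omega>\<in>space M. i < card {l\<in>{1..k}. u l \<omega> \<le> a}}"
      by simp
    also have "\<dots> \<in> sets M"
    proof -
      have "i < card {l\<in>{1..k}. v l \<le> a} \<longleftrightarrow> i < (\<Sum>l\<in>{1..k}. if v l \<le> a then 1 else 0)" for v :: "nat \<Rightarrow> real"
        by (simp add: sum.If_cases Int_def)
      then show ?thesis using u by simp
    qed
    finally show "{\<omega>\<in>space M. order_stat k (\<lambda>i. u i \<omega>) j \<le> a} \<in> sets M" .
  qed
qed

context regular_purf
begin

lemma response_eq: "i \<le> n \<Longrightarrow> \<omega> \<in> space M \<Longrightarrow> response s X \<epsilon> i \<omega> = reg (X i \<omega>) + \<epsilon> i \<omega>"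
  by (simp add: response_def reg_X)

lemma empirical_mean_eq:
  assumes "\<omega> \<in> space M"
  shows "empirical_mean s n X \<epsilon> \<omega> A =
    (\<Sum>i=1..n. if X i \<omega> \<in> A then reg (X i \<omega>) + \<epsilon> i \<omega> else 0) / (\<Sum>i=1..n. if X i \<omega> \<in> A then 1 else 0)"
proof -
  have "(\<Sum>i | i \<in> {1..n} \<and> X i \<omega> \<in> A. response s X \<epsilon> i \<omega>) = (\<Sum>i=1..n. if X i \<omega> \<in> A then reg (X i \<omega>) + \<epsilon> i \<omega> else 0)"
    unfolding sum.inter_filter[OF finite_atLeastAtMost, symmetric]
    using assms by (intro sum.cong) (auto simp: response_eq)
  then show ?thesis
    unfolding empirical_mean_def by (simp only: card_eq_sum finite_atLeastAtMost)
qed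

text \<open>
  The representation by the cell of the new point holds only almost everywhere, so measurability has to
  be derived from the definition by order statistics.
\<close>

lemma purf_sq_deviation_measurable: "purf_sq_deviation M s n k q X \<epsilon> U \<in> borel_measurable M"
proof -
  define os where "os l j \<omega> = order_stat k (\<lambda>i. U l i \<omega>) j" for l j \<omega>
  have os[measurable]: "os l j \<in> borel_measurable M" if "l \<in> {1..q}" "j \<in> {0..Suc k}" for l j
    unfolding os_def using that by (intro order_stat_measurable) auto
  have cell_os: "cell k (\<lambda>i. U l i \<omega>) j = {os l j \<omega><..os l (Suc j) \<omega>}" for l j \<omega>
    by (simp add: cell_def os_def)
  have [measurable]: "X i \<in> borel_measurable M" "\<epsilon> i \<in> borel_measurable M" if "i \<in> {1..n}" for i
    using that by auto
  have [measurable]: "X 0 \<in> borel_measurable M" by simp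
  have emp: "(\<lambda>\<omega>. forest (empirical_mean s n X \<epsilon> \<omega>) k q U \<omega> (X 0 \<omega>)) \<in> borel_measurable M"
  proof (subst measurable_cong)
    fix \<omega> assume "\<omega> \<in> space M"
    show "forest (empirical_mean s n X \<epsilon> \<omega>) k q U \<omega> (X 0 \<omega>) =
      (\<Sum>l=1..q. \<Sum>j=0..k. (\<Sum>i=1..n. if os l j \<omega> < X i \<omega> \<and> X i \<omega> \<le> os l (Suc j) \<omega> then reg (X i \<omega>) + \<epsilon> i \<omega> else 0) /
        (\<Sum>i=1..n. if os l j \<omega> < X i \<omega> \<and> X i \<omega> \<le> os l (Suc j) \<omega> then 1 else 0) *
        (if os l j \<omega> < X 0 \<omega> \<and> X 0 \<omega> \<le> os l (Suc j) \<omega> then 1 else 0)) / real q"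
      unfolding forest_def tree_def empirical_mean_eq[OF \<open>\<omega> \<in> space M\<close>] cell_os indicator_def greaterThanAtMost_iff of_bool_def
      by (rule refl)
  next
    have "os l j \<in> borel_measurable M" "os l (Suc j) \<in> borel_measurable M" if "l \<in> {1..q}" "j \<in> {0..k}" for l j
      using that by auto
    note [measurable] = this
    show "(\<lambda>\<omega>. (\<Sum>l=1..q. \<Sum>j=0..k. (\<Sum>i=1..n. if os l j \<omega> < X i \<omega> \<and> X i \<omega> \<le> os l (Suc j) \<omega> then reg (X i \<omega>) + \<epsilon> i \<omega> else 0) /
        (\<Sum>i=1..n. if os l j \<omega> < X i \<omega> \<and> X i \<omega> \<le> os l (Suc j) \<omega> then 1 else 0) *
        (if os l j \<omega> < X 0 \<omega> \<and> X 0 \<omega> \<le> os l (Suc j) \<omega> then 1 else 0)) / real q) \<in> borel_measurable M"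
      by measurable
  qed
  have pop: "(\<lambda>\<omega>. forest (population_mean M s X \<epsilon>) k q U \<omega> (X 0 \<omega>)) \<in> borel_measurable M"
  proof -
    have *: "forest (population_mean M s X \<epsilon>) k q U \<omega> (X 0 \<omega>) =
      (\<Sum>l=1..q. \<Sum>j=0..k. pop {os l j \<omega><..os l (Suc j) \<omega>} *
        (if os l j \<omega> < X 0 \<omega> \<and> X 0 \<omega> \<le> os l (Suc j) \<omega> then 1 else 0)) / real q" for \<omega>
    proof -
      have "population_mean M s X \<epsilon> (cell k (\<lambda>i. U l i \<omega>) j) = pop {os l j \<omega><..os l (Suc j) \<omega>}" for l j
        unfolding cell_os by (rule population_mean_eq) simp
      then show ?thesis
        unfolding forest_def tree_def by (simp only: cell_os indicator_def greaterThanAtMost_iff of_bool_def)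
    qed
    have "os l j \<in> borel_measurable M" "os l (Suc j) \<in> borel_measurable M"
      "(\<lambda>\<omega>. pop {os l j \<omega><..os l (Suc j) \<omega>}) \<in> borel_measurable M" if "l \<in> {1..q}" "j \<in> {0..k}" for l j
      using that by (auto intro!: pop_interval_measurable)
    note [measurable] = this
    show ?thesis unfolding * by measurable
  qed
  show ?thesis
    unfolding purf_sq_deviation_def using emp pop by measurable
qed

lemma forest_eq_cells:
  "AE \<omega> in M. \<forall>b. forest b k q U \<omega> (X 0 \<omega>) = (\<Sum>l=1..q. b (cell_set l (X 0 \<omega>) \<omega>)) / real q"
proof -
  have "AE \<omega> in M. \<forall>l\<in>{1..q}. \<forall>j\<in>{1..k}. U l j \<omega> \<in> {0..1}"
    by (intro AE_finite_allI uniform_splits.splits_in_unit tree_splits) auto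
  with X_pos show ?thesis
  proof eventually_elim
    case (elim \<omega>)
    then have "tree b k (\<lambda>j. U l j \<omega>) (X 0 \<omega>) = b (cell_set l (X 0 \<omega>) \<omega>)" if "l \<in> {1..q}" for l b
      using that by (intro tree_eq_cell_at) blast+
    then show ?case unfolding forest_def by simp
  qed
qed

end

section \<open>Separating the noise\<close>

context regular_purf
begin

lemma noise_transfer:
  assumes i: "i \<le> n" and g: "g \<in> borel_measurable borel"
  shows "expectation (\<lambda>\<omega>. g (\<epsilon> i \<omega>)) = (expectation (\<lambda>\<omega>. g (\<epsilon> 0 \<omega>)) :: real)"
    and "integrable M (\<lambda>\<omega>. g (\<epsilon> i \<omega>) :: real) \<longleftrightarrow> integrable M (\<lambda>\<omega>. g (\<epsilon> 0 \<omega>))"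
proof -
  have eq: "distr M borel (\<epsilon> i) = distr M borel (\<epsilon> 0)" using noise_law[of i] noise_law[of 0] i by simp
  have [measurable]: "\<epsilon> i \<in> borel_measurable M" "\<epsilon> 0 \<in> borel_measurable M" using i by auto
  show "expectation (\<lambda>\<omega>. g (\<epsilon> i \<omega>)) = (expectation (\<lambda>\<omega>. g (\<epsilon> 0 \<omega>)) :: real)"
    using integral_distr[of "\<epsilon> i" M borel g] integral_distr[of "\<epsilon> 0" M borel g] g eq by simp
  show "integrable M (\<lambda>\<omega>. g (\<epsilon> i \<omega>) :: real) \<longleftrightarrow> integrable M (\<lambda>\<omega>. g (\<epsilon> 0 \<omega>))"
    using integrable_distr_eq[of "\<epsilon> i" M borel g] integrable_distr_eq[of "\<epsilon> 0" M borel g] g eq by simp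
qed

lemma noise_moments:
  assumes "i \<le> n"
  shows "integrable M (\<epsilon> i)" "expectation (\<epsilon> i) = 0"
    "integrable M (\<lambda>\<omega>. (\<epsilon> i \<omega>)\<^sup>2)" "expectation (\<lambda>\<omega>. (\<epsilon> i \<omega>)\<^sup>2) = \<sigma>\<^sup>2"
  using noise_transfer[OF assms, of "\<lambda>x. x"] noise_transfer[OF assms, of "\<lambda>x. x\<^sup>2"] integrable_eps noise_mean
    noise_square_integrable noise_variance by simp_all

lemma noise_product:
  assumes i: "i \<in> {1..n}" "j \<in> {1..n}"
  shows "integrable M (\<lambda>\<omega>. \<epsilon> i \<omega> * \<epsilon> j \<omega>)" "expectation (\<lambda>\<omega>. \<epsilon> i \<omega> * \<epsilon> j \<omega>) = (if i = j then \<sigma>\<^sup>2 else 0)"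
proof -
  have ij: "i \<le> n" "j \<le> n" using i by auto
  have "integrable M (\<lambda>\<omega>. \<epsilon> i \<omega> * \<epsilon> j \<omega>) \<and> expectation (\<lambda>\<omega>. \<epsilon> i \<omega> * \<epsilon> j \<omega>) = (if i = j then \<sigma>\<^sup>2 else 0)"
  proof (cases "i = j")
    case True
    then show ?thesis using noise_moments[OF ij(1)] by (simp add: power2_eq_square)
  next
    case False
    have "indep_var borel (\<lambda>\<omega>. (\<lambda>v. v (Noise i)) (\<lambda>i. src i \<omega>)) borel (\<lambda>\<omega>. (\<lambda>v. v (Noise j)) (\<lambda>i. src i \<omega>))"
      using False ij by (intro indep_var_functions[OF independent, of "{Noise i}" "{Noise j}"] measurable_component_singleton) auto
    then have iv: "indep_var borel (\<epsilon> i) borel (\<epsilon> j)" by simp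
    show ?thesis
      using indep_var_lebesgue_integral[OF iv] indep_var_integrable[OF iv] noise_moments[OF ij(1)] noise_moments[OF ij(2)] False by simp
  qed
  then show "integrable M (\<lambda>\<omega>. \<epsilon> i \<omega> * \<epsilon> j \<omega>)" "expectation (\<lambda>\<omega>. \<epsilon> i \<omega> * \<epsilon> j \<omega>) = (if i = j then \<sigma>\<^sup>2 else 0)" by auto
qed

text \<open>
  Functions of the sample and the cells that ignore all indices outside the model and are measurable
  in the remaining coordinates; they are independent of the noise.
\<close>

definition local_statistic :: "((nat \<Rightarrow> real) \<Rightarrow> (nat \<Rightarrow> real \<times> real) \<Rightarrow> real) \<Rightarrow> bool" where
  "local_statistic G \<longleftrightarrow>
    (\<forall>f f' c c'. (\<forall>i\<in>{1..n}. f i = f' i) \<longrightarrow> (\<forall>l\<in>{1..q}. c l = c' l) \<longrightarrow> G f c = G f' c') \<and>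
    (\<forall>(K :: (source \<Rightarrow> real) measure) f a b. (\<forall>i\<in>{1..n}. (\<lambda>z. f z i) \<in> borel_measurable K) \<longrightarrow>
      (\<forall>l\<in>{1..q}. a l \<in> borel_measurable K) \<longrightarrow> (\<forall>l\<in>{1..q}. b l \<in> borel_measurable K) \<longrightarrow>
      (\<lambda>z. G (f z) (\<lambda>l. (a l z, b l z))) \<in> borel_measurable K)"

lemma local_statistic_cong:
  assumes G: "local_statistic G" and eq: "\<forall>i\<in>{1..n}. f i = f' i" "\<forall>l\<in>{1..q}. c l = c' l"
  shows "G f c = G f' c'"
  by (rule G[unfolded local_statistic_def, THEN conjunct1, THEN spec, THEN spec, THEN spec, THEN spec, THEN mp, THEN mp, OF eq])

lemma local_statistic_measurable:
  fixes K :: "(source \<Rightarrow> real) measure"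
  assumes G: "local_statistic G" and meas: "\<forall>i\<in>{1..n}. (\<lambda>z. f z i) \<in> borel_measurable K"
    "\<forall>l\<in>{1..q}. a l \<in> borel_measurable K" "\<forall>l\<in>{1..q}. b l \<in> borel_measurable K"
  shows "(\<lambda>z. G (f z) (\<lambda>l. (a l z, b l z))) \<in> borel_measurable K"
  by (rule G[unfolded local_statistic_def, THEN conjunct2, THEN spec, THEN spec, THEN spec, THEN spec, THEN mp, THEN mp, THEN mp, OF meas])

lemma local_statistic_weight:
  assumes i: "i \<in> {1..n}" shows "local_statistic (weight i)"
  unfolding local_statistic_def
proof (intro conjI allI impI)
  fix f f' :: "nat \<Rightarrow> real" and c c' :: "nat \<Rightarrow> real \<times> real"
  assume "\<forall>i\<in>{1..n}. f i = f' i" "\<forall>l\<in>{1..q}. c l = c' l"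
  with i show "weight i f c = weight i f' c'" by (intro local_congs(1)) auto
next
  fix K :: "(source \<Rightarrow> real) measure" and f :: "_ \<Rightarrow> nat \<Rightarrow> real" and a b :: "nat \<Rightarrow> _ \<Rightarrow> real"
  assume "\<forall>i\<in>{1..n}. (\<lambda>z. f z i) \<in> borel_measurable K" "\<forall>l\<in>{1..q}. a l \<in> borel_measurable K"
    "\<forall>l\<in>{1..q}. b l \<in> borel_measurable K"
  with i show "(\<lambda>z. weight i (f z) (\<lambda>l. (a l z, b l z))) \<in> borel_measurable K"
    by (intro local_measurable(1)) auto
qed

lemma local_statistic_mean_bias: "local_statistic mean_bias"
  unfolding local_statistic_def
proof (intro conjI allI impI)
  fix f f' :: "nat \<Rightarrow> real" and c c' :: "nat \<Rightarrow> real \<times> real"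
  assume "\<forall>i\<in>{1..n}. f i = f' i" "\<forall>l\<in>{1..q}. c l = c' l"
  then show "mean_bias f c = mean_bias f' c'" by (intro local_congs(3)) auto
next
  fix K :: "(source \<Rightarrow> real) measure" and f :: "_ \<Rightarrow> nat \<Rightarrow> real" and a b :: "nat \<Rightarrow> _ \<Rightarrow> real"
  assume "\<forall>i\<in>{1..n}. (\<lambda>z. f z i) \<in> borel_measurable K" "\<forall>l\<in>{1..q}. a l \<in> borel_measurable K"
    "\<forall>l\<in>{1..q}. b l \<in> borel_measurable K"
  then show "(\<lambda>z. mean_bias (f z) (\<lambda>l. (a l z, b l z))) \<in> borel_measurable K"
    by (intro local_measurable(3)) auto
qed

lemma local_statistic_times:
  assumes "local_statistic G" "local_statistic H"
  shows "local_statistic (\<lambda>f c. G f c * H f c)"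
  unfolding local_statistic_def
proof (intro conjI allI impI)
  fix f f' :: "nat \<Rightarrow> real" and c c' :: "nat \<Rightarrow> real \<times> real"
  assume eq: "\<forall>i\<in>{1..n}. f i = f' i" "\<forall>l\<in>{1..q}. c l = c' l"
  from local_statistic_cong[OF assms(1) eq] local_statistic_cong[OF assms(2) eq]
  show "G f c * H f c = G f' c' * H f' c'" by simp
next
  fix K :: "(source \<Rightarrow> real) measure" and f :: "_ \<Rightarrow> nat \<Rightarrow> real" and a b :: "nat \<Rightarrow> _ \<Rightarrow> real"
  assume meas: "\<forall>i\<in>{1..n}. (\<lambda>z. f z i) \<in> borel_measurable K" "\<forall>l\<in>{1..q}. a l \<in> borel_measurable K"
    "\<forall>l\<in>{1..q}. b l \<in> borel_measurable K"
  show "(\<lambda>z. G (f z) (\<lambda>l. (a l z, b l z)) * H (f z) (\<lambda>l. (a l z, b l z))) \<in> borel_measurable K"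
    by (intro borel_measurable_times local_statistic_measurable assms meas)
qed

lemma expectation_times_noise:
  fixes G :: "(nat \<Rightarrow> real) \<Rightarrow> (nat \<Rightarrow> real \<times> real) \<Rightarrow> real" and T :: "(source \<Rightarrow> real) \<Rightarrow> real"
  assumes G: "local_statistic G"
    and bounded: "\<And>f c. \<bar>G f c\<bar> \<le> D"
    and T: "T \<in> borel_measurable (PiM (Noise ` {1..n}) (\<lambda>_. borel))" "\<And>v. T (restrict v (Noise ` {1..n})) = T v"
    and T_int: "integrable M (\<lambda>\<omega>. T (\<lambda>i. src i \<omega>))"
  shows "integrable M (\<lambda>\<omega>. G (sample \<omega>) (cells \<omega>) * T (\<lambda>i. src i \<omega>))"
    and "expectation (\<lambda>\<omega>. G (sample \<omega>) (cells \<omega>) * T (\<lambda>i. src i \<omega>)) =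
      expectation (\<lambda>\<omega>. G (sample \<omega>) (cells \<omega>)) * expectation (\<lambda>\<omega>. T (\<lambda>i. src i \<omega>))"
    and "integrable M (\<lambda>\<omega>. G (sample \<omega>) (cells \<omega>))"
proof -
  let ?A = "Point ` {0..n} \<union> splits"
  define c where "c v l = (lower_split k (\<lambda>j. v (Split l j)) (v (Point 0)), upper_split k (\<lambda>j. v (Split l j)) (v (Point 0)))"
    for v :: "source \<Rightarrow> real" and l
  define g where "g v = G (\<lambda>i. v (Point i)) (c v)" for v :: "source \<Rightarrow> real"
  have "indep_var borel (\<lambda>\<omega>. g (\<lambda>i. src i \<omega>)) borel (\<lambda>\<omega>. T (\<lambda>i. src i \<omega>))"
  proof (rule indep_var_functions[OF independent, of ?A "Noise ` {1..n}"])
    let ?K = "PiM ?A (\<lambda>_. borel :: real measure)"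
    have 1: "(\<lambda>v. v (Point i)) \<in> borel_measurable ?K" if "i \<in> {1..n}" for i
      by (rule component_Point) (use that in auto)
    have 2: "(\<lambda>v. v (Point 0)) \<in> borel_measurable ?K"
      by (rule component_Point) auto
    have 3: "(\<lambda>v. v (Split l j)) \<in> borel_measurable ?K" if "l \<in> {1..q}" "j \<in> {1..k}" for l j
      by (rule component_Split) (use that in auto)
    have "\<forall>i\<in>{1..n}. (\<lambda>v. v (Point i)) \<in> borel_measurable ?K" using 1 by blast
    moreover have "\<forall>l\<in>{1..q}. (\<lambda>v. lower_split k (\<lambda>j. v (Split l j)) (v (Point 0))) \<in> borel_measurable ?K"
      by (intro ballI lower_split_measurable 2 3)
    moreover have "\<forall>l\<in>{1..q}. (\<lambda>v. upper_split k (\<lambda>j. v (Split l j)) (v (Point 0))) \<in> borel_measurable ?K"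
      by (intro ballI upper_split_measurable 2 3)
    ultimately have "(\<lambda>v. G (\<lambda>i. v (Point i)) (\<lambda>l. (lower_split k (\<lambda>j. v (Split l j)) (v (Point 0)),
        upper_split k (\<lambda>j. v (Split l j)) (v (Point 0))))) \<in> borel_measurable ?K"
      by (rule local_statistic_measurable[OF G])
    then show "g \<in> borel_measurable ?K"
      by (simp only: g_def[abs_def] c_def[abs_def])
    show "g (restrict v ?A) = g v" for v
    proof -
      have "c (restrict v ?A) l = c v l" if l: "l \<in> {1..q}" for l
      proof -
        have "(\<lambda>j. restrict v ?A (Split l j)) j = v (Split l j)" if "j \<in> {1..k}" for j
          using l that by force
        note * = split_congs[where u = "\<lambda>j. restrict v ?A (Split l j)" and u' = "\<lambda>j. v (Split l j)", OF this]
        show ?thesis unfolding c_def using * by simp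
      qed
      moreover have "restrict v ?A (Point i) = v (Point i)" if "i \<in> {1..n}" for i using that by auto
      ultimately show ?thesis
        unfolding g_def by (intro local_statistic_cong[OF G]) blast+
    qed
    show "T (restrict v (Noise ` {1..n})) = T v" for v by (rule T(2))
  qed (use T(1) in auto)
  moreover have "c (\<lambda>i. src i \<omega>) = cells \<omega>" for \<omega>
    by (simp add: c_def fun_eq_iff)
  ultimately have iv: "indep_var borel (\<lambda>\<omega>. G (sample \<omega>) (cells \<omega>)) borel (\<lambda>\<omega>. T (\<lambda>i. src i \<omega>))"
    by (simp add: g_def)
  show int: "integrable M (\<lambda>\<omega>. G (sample \<omega>) (cells \<omega>))"
    using indep_var_rv1[OF iv] bounded by (intro integrable_const_bound[where B = D]) auto
  show "integrable M (\<lambda>\<omega>. G (sample \<omega>) (cells \<omega>) * T (\<lambda>i. src i \<omega>))"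
    by (rule indep_var_integrable[OF iv int T_int])
  show "expectation (\<lambda>\<omega>. G (sample \<omega>) (cells \<omega>) * T (\<lambda>i. src i \<omega>)) =
      expectation (\<lambda>\<omega>. G (sample \<omega>) (cells \<omega>)) * expectation (\<lambda>\<omega>. T (\<lambda>i. src i \<omega>))"
    by (rule indep_var_lebesgue_integral[OF iv int T_int])
qed

lemma ind_nonneg: "0 \<le> ind c l x"
  by (simp add: ind_def)

lemma ind_div_cnt_le_1:
  assumes "i \<in> {1..n}" shows "ind c l (f i) / cnt f c l \<le> 1"
proof -
  have "ind c l (f i) \<le> cnt f c l"
    unfolding cnt_def using assms by (intro member_le_sum) (auto simp: ind_nonneg)
  then show ?thesis using ind_nonneg[of c l "f i"] by (cases "cnt f c l = 0") (auto simp: divide_le_eq)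
qed

lemma cnt_nonneg: "0 \<le> cnt f c l"
  unfolding cnt_def by (intro sum_nonneg ind_nonneg)

lemma abs_mean_le:
  assumes "\<And>l. l \<in> {1..q} \<Longrightarrow> \<bar>x l\<bar> \<le> D"
  shows "\<bar>(\<Sum>l=1..q. x l) / real q\<bar> \<le> D"
proof -
  have "\<bar>\<Sum>l=1..q. x l\<bar> \<le> (\<Sum>l=1..q. D)"
    by (rule order_trans[OF sum_abs sum_mono]) (use assms in auto)
  then show ?thesis using q_pos by (simp add: abs_divide divide_le_eq mult.commute)
qed

lemma weight_bounded: "i \<in> {1..n} \<Longrightarrow> \<bar>weight i f c\<bar> \<le> 1"
  unfolding weight_def using ind_div_cnt_le_1 ind_nonneg cnt_nonneg
  by (intro abs_mean_le) (auto simp: abs_divide)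

lemma bias_bounded: "\<bar>bias l f c\<bar> \<le> 2 * B"
proof -
  have "\<bar>\<Sum>i=1..n. ind c l (f i) * reg (f i)\<bar> \<le> (\<Sum>i=1..n. B * ind c l (f i))"
    by (rule order_trans[OF sum_abs sum_mono]) (auto simp: ind_def reg_bounded B_nonneg)
  also have "\<dots> = B * cnt f c l" by (simp add: cnt_def sum_distrib_left)
  finally have "\<bar>(\<Sum>i=1..n. ind c l (f i) * reg (f i)) / cnt f c l\<bar> \<le> B"
    using cnt_nonneg[of f c l] B_nonneg by (cases "cnt f c l = 0") (auto simp: abs_divide divide_le_eq)
  moreover have "\<bar>pop {fst (c l)<..snd (c l)}\<bar> \<le> B" by (rule pop_bounded) simp
  ultimately show ?thesis unfolding bias_def by linarith
qed

lemma mean_bias_bounded: "\<bar>mean_bias f c\<bar> \<le> 2 * B"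
  unfolding mean_bias_def using bias_bounded by (intro abs_mean_le) auto

abbreviation "w i \<omega> \<equiv> weight i (sample \<omega>) (cells \<omega>)"
abbreviation "rest \<omega> \<equiv> mean_bias (sample \<omega>) (cells \<omega>)"

lemma Noise_component: "i \<in> {1..n} \<Longrightarrow> (\<lambda>v. v (Noise i)) \<in> borel_measurable (PiM (Noise ` {1..n}) (\<lambda>_. borel :: real measure))"
  by (rule measurable_component_singleton) auto

lemma weight_noise_products:
  assumes i: "i \<in> {1..n}" "j \<in> {1..n}"
  shows "integrable M (\<lambda>\<omega>. w i \<omega> * w j \<omega> * (\<epsilon> i \<omega> * \<epsilon> j \<omega>))"
    "expectation (\<lambda>\<omega>. w i \<omega> * w j \<omega> * (\<epsilon> i \<omega> * \<epsilon> j \<omega>)) = expectation (\<lambda>\<omega>. w i \<omega> * w j \<omega>) * (if i = j then \<sigma>\<^sup>2 else 0)"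
    "integrable M (\<lambda>\<omega>. w i \<omega> * w j \<omega>)"
proof -
  define T where "T v = v (Noise i) * v (Noise j)" for v :: "source \<Rightarrow> real"
  have G: "local_statistic (\<lambda>f c. weight i f c * weight j f c)"
    by (intro local_statistic_times local_statistic_weight i)
  have bound: "\<bar>weight i f c * weight j f c\<bar> \<le> 1 * 1" for f c
    unfolding abs_mult using i by (intro mult_mono weight_bounded) auto
  have T: "T \<in> borel_measurable (PiM (Noise ` {1..n}) (\<lambda>_. borel))"
    unfolding T_def by (intro borel_measurable_times Noise_component i)
  have T_local: "T (restrict v (Noise ` {1..n})) = T v" for v using i by (simp add: T_def)
  have T_int: "integrable M (\<lambda>\<omega>. T (\<lambda>i. src i \<omega>))" using noise_product(1)[OF i] by (simp add: T_def)
  note E = expectation_times_noise[OF G bound T T_local T_int]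
  show "integrable M (\<lambda>\<omega>. w i \<omega> * w j \<omega> * (\<epsilon> i \<omega> * \<epsilon> j \<omega>))"
    using E(1) by (simp add: T_def)
  show "expectation (\<lambda>\<omega>. w i \<omega> * w j \<omega> * (\<epsilon> i \<omega> * \<epsilon> j \<omega>)) = expectation (\<lambda>\<omega>. w i \<omega> * w j \<omega>) * (if i = j then \<sigma>\<^sup>2 else 0)"
    using E(2) noise_product(2)[OF i] by (simp add: T_def)
  show "integrable M (\<lambda>\<omega>. w i \<omega> * w j \<omega>)"
    using E(3) by simp
qed

lemma rest_noise_products:
  assumes i: "i \<in> {1..n}"
  shows "integrable M (\<lambda>\<omega>. rest \<omega> * w i \<omega> * \<epsilon> i \<omega>)" "expectation (\<lambda>\<omega>. rest \<omega> * w i \<omega> * \<epsilon> i \<omega>) = 0"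
proof -
  define T where "T v = v (Noise i)" for v :: "source \<Rightarrow> real"
  have i': "i \<le> n" using i by simp
  have G: "local_statistic (\<lambda>f c. mean_bias f c * weight i f c)"
    by (intro local_statistic_times local_statistic_weight local_statistic_mean_bias i)
  have bound: "\<bar>mean_bias f c * weight i f c\<bar> \<le> 2 * B * 1" for f c
    unfolding abs_mult using i B_nonneg by (intro mult_mono weight_bounded mean_bias_bounded) auto
  have T: "T \<in> borel_measurable (PiM (Noise ` {1..n}) (\<lambda>_. borel))"
    unfolding T_def by (rule Noise_component[OF i])
  have T_local: "T (restrict v (Noise ` {1..n})) = T v" for v using i by (simp add: T_def)
  have T_int: "integrable M (\<lambda>\<omega>. T (\<lambda>i. src i \<omega>))" using noise_moments(1)[OF i'] by (simp add: T_def)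
  note E = expectation_times_noise[OF G bound T T_local T_int]
  show "integrable M (\<lambda>\<omega>. rest \<omega> * w i \<omega> * \<epsilon> i \<omega>)"
    using E(1) by (simp add: T_def)
  show "expectation (\<lambda>\<omega>. rest \<omega> * w i \<omega> * \<epsilon> i \<omega>) = 0"
    using E(2) noise_moments(2)[OF i'] by (simp add: T_def)
qed

lemma sample_cells_measurable:
  "l \<in> {1..q} \<Longrightarrow> (\<lambda>\<omega>. bias l (sample \<omega>) (cells \<omega>)) \<in> borel_measurable M"
  "rest \<in> borel_measurable M"
proof -
  have 1: "(\<lambda>\<omega>. sample \<omega> i) \<in> borel_measurable M" if "i \<in> {1..n}" for i using that by auto
  have 2: "(\<lambda>\<omega>. lo l (X 0 \<omega>) \<omega>) \<in> borel_measurable M" "(\<lambda>\<omega>. hi l (X 0 \<omega>) \<omega>) \<in> borel_measurable M" if "l \<in> {1..q}" for l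
    using that by (auto intro!: lo_hi_measurable)
  note * = local_measurable[of sample M "\<lambda>l \<omega>. lo l (X 0 \<omega>) \<omega>" "\<lambda>l \<omega>. hi l (X 0 \<omega>) \<omega>", OF 1 2]
  show "l \<in> {1..q} \<Longrightarrow> (\<lambda>\<omega>. bias l (sample \<omega>) (cells \<omega>)) \<in> borel_measurable M"
    "rest \<in> borel_measurable M" by (rule *; assumption)+
qed

text \<open>
  The noise enters linearly, with coefficients that depend on the points and the splits only.
\<close>

lemma deviation_eq:
  "AE \<omega> in M. purf_sq_deviation M s n k q X \<epsilon> U \<omega> = ((\<Sum>i=1..n. w i \<omega> * \<epsilon> i \<omega>) + rest \<omega>)\<^sup>2"
proof -
  from forest_eq_cells AE_space show ?thesis
  proof eventually_elim
    case (elim \<omega>)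
    let ?c = "cells \<omega>" and ?f = "sample \<omega>"
    have emp: "empirical_mean s n X \<epsilon> \<omega> (cell_set l (X 0 \<omega>) \<omega>) =
        (\<Sum>i=1..n. ind ?c l (X i \<omega>) * reg (X i \<omega>)) / cnt ?f ?c l + (\<Sum>i=1..n. ind ?c l (X i \<omega>) / cnt ?f ?c l * \<epsilon> i \<omega>)" for l
    proof -
      have "(\<Sum>i=1..n. if X i \<omega> \<in> cell_set l (X 0 \<omega>) \<omega> then reg (X i \<omega>) + \<epsilon> i \<omega> else 0)
          = (\<Sum>i=1..n. ind ?c l (X i \<omega>) * reg (X i \<omega>)) + (\<Sum>i=1..n. ind ?c l (X i \<omega>) * \<epsilon> i \<omega>)"
        unfolding sum.distrib[symmetric] by (intro sum.cong) (auto simp: ind_def)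
      moreover have "(\<Sum>i=1..n. if X i \<omega> \<in> cell_set l (X 0 \<omega>) \<omega> then 1 else 0) = cnt ?f ?c l"
        unfolding cnt_def by (intro sum.cong) (auto simp: ind_def)
      ultimately show ?thesis
        unfolding empirical_mean_eq[OF elim(2)] by (simp add: add_divide_distrib sum_divide_distrib)
    qed
    have pop: "population_mean M s X \<epsilon> (cell_set l (X 0 \<omega>) \<omega>) = pop {fst (?c l)<..snd (?c l)}" for l
      by (subst population_mean_eq) auto
    have "forest (empirical_mean s n X \<epsilon> \<omega>) k q U \<omega> (X 0 \<omega>) - forest (population_mean M s X \<epsilon>) k q U \<omega> (X 0 \<omega>)
        = (\<Sum>l=1..q. bias l ?f ?c + (\<Sum>i=1..n. ind ?c l (X i \<omega>) / cnt ?f ?c l * \<epsilon> i \<omega>)) / real q"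
      unfolding elim(1)[rule_format] diff_divide_distrib[symmetric] sum_subtractf[symmetric] emp pop bias_def
      by (simp add: algebra_simps)
    also have "\<dots> = rest \<omega> + (\<Sum>l=1..q. \<Sum>i=1..n. ind ?c l (X i \<omega>) / cnt ?f ?c l * \<epsilon> i \<omega>) / real q"
      by (simp add: sum.distrib add_divide_distrib mean_bias_def)
    also have "(\<Sum>l=1..q. \<Sum>i=1..n. ind ?c l (X i \<omega>) / cnt ?f ?c l * \<epsilon> i \<omega>) / real q = (\<Sum>i=1..n. w i \<omega> * \<epsilon> i \<omega>)"
      unfolding weight_def by (subst sum.swap) (simp add: sum_divide_distrib sum_distrib_right)
    finally show ?case unfolding purf_sq_deviation_def by (simp only: add.commute)
  qed
qed

end

section \<open>The variance for a fixed sample size\<close>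

context regular_purf
begin

lemma overlap_eq:
  "overlap l l' \<omega> = (\<Sum>i=1..n. ind (cells \<omega>) l (X i \<omega>) / cnt (sample \<omega>) (cells \<omega>) l *
    (ind (cells \<omega>) l' (X i \<omega>) / cnt (sample \<omega>) (cells \<omega>) l'))"
proof -
  have "sample_count \<omega> (cell_set l (X 0 \<omega>) \<omega> \<inter> cell_set l' (X 0 \<omega>) \<omega>) = (\<Sum>i=1..n. ind (cells \<omega>) l (X i \<omega>) * ind (cells \<omega>) l' (X i \<omega>))"
    by (subst card_eq_sum) (auto simp: ind_def intro!: sum.cong)
  then show ?thesis
    unfolding overlap_def overlap_ratio_def count_eq_cnt by (simp add: sum_divide_distrib)
qed

lemma overlap_nonneg: "0 \<le> overlap l l' \<omega>"
  unfolding overlap_def overlap_ratio_def by simp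

lemma integrable_overlap:
  assumes l: "l \<in> {1..q}" "l' \<in> {1..q}"
  shows "integrable M (overlap l l')"
proof (rule integrable_const_bound[where B = "real n"])
  have "overlap l l' \<omega> \<le> (\<Sum>i=1..n. 1 * 1)" for \<omega>
    unfolding overlap_eq using ind_nonneg cnt_nonneg
    by (intro sum_mono mult_mono ind_div_cnt_le_1) auto
  then show "AE \<omega> in M. norm (overlap l l' \<omega>) \<le> real n"
    using overlap_nonneg by simp
  have X[measurable]: "X i \<in> borel_measurable M" if "i \<in> {1..n}" for i using that by auto
  have [measurable]: "(\<lambda>\<omega>. lo l (X 0 \<omega>) \<omega>) \<in> borel_measurable M" "(\<lambda>\<omega>. hi l (X 0 \<omega>) \<omega>) \<in> borel_measurable M" if "l \<in> {1..q}" for l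
    using that by (auto intro!: lo_hi_measurable)
  have ind[measurable]: "(\<lambda>\<omega>. ind (cells \<omega>) l (X i \<omega>)) \<in> borel_measurable M" if "i \<in> {1..n}" "l \<in> {1..q}" for i l
    unfolding ind_def fst_conv snd_conv using that by measurable
  have cnt[measurable]: "(\<lambda>\<omega>. cnt (sample \<omega>) (cells \<omega>) l) \<in> borel_measurable M" if "l \<in> {1..q}" for l
    unfolding cnt_def using that by measurable
  show "overlap l l' \<in> borel_measurable M"
    unfolding overlap_eq[abs_def] using l by (intro borel_measurable_sum borel_measurable_times borel_measurable_divide ind cnt)
qed

lemma expectation_le_if_nn_integral_le:
  assumes "integrable M f" "\<And>\<omega>. 0 \<le> f \<omega>" "(\<integral>\<^sup>+\<omega>. ennreal (f \<omega>) \<partial>M) \<le> ennreal c" "0 \<le> c"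
  shows "expectation f \<le> c"
proof -
  have "ennreal (expectation f) \<le> ennreal c"
    using assms(3) nn_integral_eq_integral[OF assms(1)] assms(2) by simp
  then show ?thesis using assms(4) by (simp add: ennreal_le_iff)
qed

lemma mx_nonneg: "0 \<le> mx"
  using density_upper[of 0] density_nonneg[of 0] by simp

text \<open>
  Expanding the square of the average over the trees turns the sum of the squared weights into the sum
  of the overlaps over all pairs of trees, divided by \<open>q\<^sup>2\<close>.
\<close>

lemma expectation_weights_square_le:
  assumes d: "0 < d" "1 \<le> real k * d"
  shows "(\<Sum>i=1..n. expectation (\<lambda>\<omega>. w i \<omega> * w i \<omega>)) \<le> 2 * (real k + 1) / (real n * real q) + overlap_bound d"
proof -
  define D where "D = 2 * (real k + 1) / real n"
  have D: "0 \<le> D" by (simp add: D_def)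
  have ob: "0 \<le> overlap_bound d"
    using d k_ge_2 m_pos r_pos mx_nonneg by (simp add: overlap_bound_def sum_inverse_def)
  have sq: "(\<Sum>i=1..n. w i \<omega> * w i \<omega>) = (\<Sum>l=1..q. \<Sum>l'=1..q. overlap l l' \<omega>) / (real q)\<^sup>2" for \<omega>
  proof -
    let ?a = "\<lambda>l i. ind (cells \<omega>) l (X i \<omega>) / cnt (sample \<omega>) (cells \<omega>) l"
    have "(\<Sum>i=1..n. w i \<omega> * w i \<omega>) = (\<Sum>i=1..n. (\<Sum>l=1..q. \<Sum>l'=1..q. ?a l i * ?a l' i)) / (real q)\<^sup>2"
      by (simp add: weight_def sum_product power2_eq_square sum_divide_distrib mult_ac)
    also have "(\<Sum>i=1..n. (\<Sum>l=1..q. \<Sum>l'=1..q. ?a l i * ?a l' i)) = (\<Sum>l=1..q. \<Sum>i=1..n. \<Sum>l'=1..q. ?a l i * ?a l' i)"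
      by (rule sum.swap)
    also have "\<dots> = (\<Sum>l=1..q. \<Sum>l'=1..q. overlap l l' \<omega>)"
      unfolding overlap_eq by (intro sum.cong refl sum.swap)
    finally show ?thesis .
  qed
  have o_le: "expectation (overlap l l') \<le> overlap_bound d + (if l' = l then D else 0)"
    if l: "l \<in> {1..q}" "l' \<in> {1..q}" for l l'
  proof (cases "l' = l")
    case True
    have "(\<integral>\<^sup>+\<omega>. ennreal (overlap l l \<omega>) \<partial>M) \<le> ennreal D"
      unfolding D_def by (rule mean_overlap_diagonal_le[OF l(1)])
    then have "expectation (overlap l l) \<le> D"
      using l D by (intro expectation_le_if_nn_integral_le integrable_overlap overlap_nonneg)
    then show ?thesis using True ob by simp
  next
    case False
    have "expectation (overlap l l') \<le> overlap_bound d"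
      using l False d ob by (intro expectation_le_if_nn_integral_le integrable_overlap overlap_nonneg mean_overlap_le) auto
    then show ?thesis using False by simp
  qed
  have "(\<Sum>i=1..n. expectation (\<lambda>\<omega>. w i \<omega> * w i \<omega>)) = expectation (\<lambda>\<omega>. \<Sum>i=1..n. w i \<omega> * w i \<omega>)"
    by (rule Bochner_Integration.integral_sum[symmetric]) (rule weight_noise_products)
  also have "\<dots> = (\<Sum>l=1..q. \<Sum>l'=1..q. expectation (overlap l l')) / (real q)\<^sup>2"
  proof -
    have "expectation (\<lambda>\<omega>. \<Sum>l=1..q. \<Sum>l'=1..q. overlap l l' \<omega>) = (\<Sum>l=1..q. expectation (\<lambda>\<omega>. \<Sum>l'=1..q. overlap l l' \<omega>))"
      by (intro Bochner_Integration.integral_sum Bochner_Integration.integrable_sum integrable_overlap)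
    also have "\<dots> = (\<Sum>l=1..q. \<Sum>l'=1..q. expectation (overlap l l'))"
      by (intro sum.cong refl Bochner_Integration.integral_sum integrable_overlap)
    finally show ?thesis unfolding sq by simp
  qed
  also have "\<dots> \<le> (\<Sum>l=1..q. \<Sum>l'=1..q. overlap_bound d + (if l' = l then D else 0)) / (real q)\<^sup>2"
    by (intro divide_right_mono sum_mono o_le) auto
  also have "(\<Sum>l=1..q. \<Sum>l'=1..q. overlap_bound d + (if l' = l then D else 0)) = (real q)\<^sup>2 * overlap_bound d + real q * D"
    by (simp add: sum.distrib power2_eq_square algebra_simps)
  also have "\<dots> / (real q)\<^sup>2 = D / real q + overlap_bound d"
    using q_pos by (simp add: add_divide_distrib power2_eq_square)
  also have "D / real q = 2 * (real k + 1) / (real n * real q)"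
    by (simp add: D_def)
  finally show ?thesis .
qed

text \<open>
  Different trees are not compared: by convexity the average is no worse than a single tree.
\<close>

lemma expectation_rest_square_le:
  assumes d: "0 < d" "1 \<le> real k * d"
  shows "integrable M (\<lambda>\<omega>. (rest \<omega>)\<^sup>2)" "expectation (\<lambda>\<omega>. (rest \<omega>)\<^sup>2) \<le> bias_bound d"
proof -
  let ?b = "\<lambda>l \<omega>. bias l (sample \<omega>) (cells \<omega>)"
  have sq_le: "x\<^sup>2 \<le> (2 * B)\<^sup>2" if "\<bar>x\<bar> \<le> 2 * B" for x :: real
    using power_mono[OF that, of 2] by simp
  have int: "integrable M (\<lambda>\<omega>. (?b l \<omega>)\<^sup>2)" if "l \<in> {1..q}" for l
    using sample_cells_measurable(1)[OF that] sq_le[OF bias_bounded]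
    by (intro integrable_const_bound[where B = "(2 * B)\<^sup>2"]) auto
  show int_rest: "integrable M (\<lambda>\<omega>. (rest \<omega>)\<^sup>2)"
    using sample_cells_measurable(2) sq_le[OF mean_bias_bounded]
    by (intro integrable_const_bound[where B = "(2 * B)\<^sup>2"]) auto
  have bb: "0 \<le> bias_bound d"
    using d m_pos mx_nonneg by (simp add: bias_bound_def)
  have "expectation (\<lambda>\<omega>. (rest \<omega>)\<^sup>2) \<le> expectation (\<lambda>\<omega>. (\<Sum>l=1..q. (?b l \<omega>)\<^sup>2) / real q)"
  proof (rule integral_mono[OF int_rest])
    show "integrable M (\<lambda>\<omega>. (\<Sum>l=1..q. (?b l \<omega>)\<^sup>2) / real q)"
      using int by (intro integrable_divide Bochner_Integration.integrable_sum) auto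
    fix \<omega>
    have "(rest \<omega>)\<^sup>2 \<le> ((\<Sum>l=1..q. (?b l \<omega>)\<^sup>2) * real q) / (real q)\<^sup>2"
      unfolding mean_bias_def power_divide
      using sum_squared_le_sum_of_squares[of "\<lambda>l. ?b l \<omega>" "{1..q}"] by (intro divide_right_mono) auto
    also have "\<dots> = (\<Sum>l=1..q. (?b l \<omega>)\<^sup>2) / real q" using q_pos by (simp add: power2_eq_square)
    finally show "(rest \<omega>)\<^sup>2 \<le> (\<Sum>l=1..q. (?b l \<omega>)\<^sup>2) / real q" .
  qed
  also have "\<dots> = (\<Sum>l=1..q. expectation (\<lambda>\<omega>. (?b l \<omega>)\<^sup>2)) / real q"
    using int by simp
  also have "\<dots> \<le> (\<Sum>l=1..q. bias_bound d) / real q"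
    using int bb d by (intro divide_right_mono sum_mono expectation_le_if_nn_integral_le mean_bias_square_le) auto
  also have "\<dots> = bias_bound d" using q_pos by simp
  finally show "expectation (\<lambda>\<omega>. (rest \<omega>)\<^sup>2) \<le> bias_bound d" .
qed

text \<open>
  In the expansion of the square, the products of different noise variables and the products of the noise
  with the remainder have mean zero.
\<close>

theorem purf_variance_le:
  assumes d: "0 < d" "1 \<le> real k * d"
  shows "integrable M (purf_sq_deviation M s n k q X \<epsilon> U)"
    and "purf_variance M s n k q X \<epsilon> U \<le> \<sigma>\<^sup>2 * (2 * (real k + 1) / (real n * real q) + overlap_bound d) + bias_bound d"
proof -
  define S where "S \<omega> = ((\<Sum>i=1..n. w i \<omega> * \<epsilon> i \<omega>) + rest \<omega>)\<^sup>2" for \<omega>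
  have S_eq: "S \<omega> = (\<Sum>i=1..n. \<Sum>j=1..n. w i \<omega> * w j \<omega> * (\<epsilon> i \<omega> * \<epsilon> j \<omega>)) + 2 * (\<Sum>i=1..n. rest \<omega> * w i \<omega> * \<epsilon> i \<omega>) + (rest \<omega>)\<^sup>2" for \<omega>
  proof -
    have "(\<Sum>i=1..n. w i \<omega> * \<epsilon> i \<omega>)\<^sup>2 = (\<Sum>i=1..n. \<Sum>j=1..n. w i \<omega> * w j \<omega> * (\<epsilon> i \<omega> * \<epsilon> j \<omega>))"
      unfolding power2_eq_square sum_product by (intro sum.cong refl) (simp add: mult_ac)
    moreover have "(\<Sum>i=1..n. w i \<omega> * \<epsilon> i \<omega>) * rest \<omega> = (\<Sum>i=1..n. rest \<omega> * w i \<omega> * \<epsilon> i \<omega>)"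
      unfolding sum_distrib_right by (intro sum.cong refl) (simp add: mult_ac)
    ultimately show ?thesis unfolding S_def power2_sum by simp
  qed
  have int1: "integrable M (\<lambda>\<omega>. \<Sum>i=1..n. \<Sum>j=1..n. w i \<omega> * w j \<omega> * (\<epsilon> i \<omega> * \<epsilon> j \<omega>))"
    by (intro Bochner_Integration.integrable_sum weight_noise_products)
  have int2: "integrable M (\<lambda>\<omega>. 2 * (\<Sum>i=1..n. rest \<omega> * w i \<omega> * \<epsilon> i \<omega>))"
    by (intro integrable_mult_right Bochner_Integration.integrable_sum rest_noise_products)
  note int3 = expectation_rest_square_le(1)[OF d]
  have S_int: "integrable M S"
    unfolding S_eq[abs_def] by (intro Bochner_Integration.integrable_add int1 int2 int3)
  have AE: "AE \<omega> in M. purf_sq_deviation M s n k q X \<epsilon> U \<omega> = S \<omega>"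
    using deviation_eq by (simp add: S_def)
  show "integrable M (purf_sq_deviation M s n k q X \<epsilon> U)"
    using S_int integrable_cong_AE[OF purf_sq_deviation_measurable borel_measurable_integrable[OF S_int] AE] by simp
  have "purf_variance M s n k q X \<epsilon> U = expectation S"
    unfolding purf_variance_def
    by (rule integral_cong_AE[OF purf_sq_deviation_measurable borel_measurable_integrable[OF S_int] AE])
  also have "\<dots> = expectation (\<lambda>\<omega>. \<Sum>i=1..n. \<Sum>j=1..n. w i \<omega> * w j \<omega> * (\<epsilon> i \<omega> * \<epsilon> j \<omega>))
      + expectation (\<lambda>\<omega>. 2 * (\<Sum>i=1..n. rest \<omega> * w i \<omega> * \<epsilon> i \<omega>)) + expectation (\<lambda>\<omega>. (rest \<omega>)\<^sup>2)"
    unfolding S_eq[abs_def] using int1 int2 int3 by simp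
  also have "expectation (\<lambda>\<omega>. \<Sum>i=1..n. \<Sum>j=1..n. w i \<omega> * w j \<omega> * (\<epsilon> i \<omega> * \<epsilon> j \<omega>)) = \<sigma>\<^sup>2 * (\<Sum>i=1..n. expectation (\<lambda>\<omega>. w i \<omega> * w i \<omega>))"
  proof -
    have "expectation (\<lambda>\<omega>. \<Sum>i=1..n. \<Sum>j=1..n. w i \<omega> * w j \<omega> * (\<epsilon> i \<omega> * \<epsilon> j \<omega>)) =
        (\<Sum>i=1..n. \<Sum>j=1..n. expectation (\<lambda>\<omega>. w i \<omega> * w j \<omega> * (\<epsilon> i \<omega> * \<epsilon> j \<omega>)))"
      by (subst Bochner_Integration.integral_sum, intro Bochner_Integration.integrable_sum weight_noise_products, assumption+)
        (intro sum.cong refl Bochner_Integration.integral_sum weight_noise_products)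
    also have "\<dots> = (\<Sum>i=1..n. \<Sum>j=1..n. if j = i then \<sigma>\<^sup>2 * expectation (\<lambda>\<omega>. w i \<omega> * w i \<omega>) else 0)"
      by (intro sum.cong refl) (simp add: weight_noise_products)
    also have "\<dots> = \<sigma>\<^sup>2 * (\<Sum>i=1..n. expectation (\<lambda>\<omega>. w i \<omega> * w i \<omega>))"
      by (simp add: sum_distrib_left)
    finally show ?thesis .
  qed
  also have "expectation (\<lambda>\<omega>. 2 * (\<Sum>i=1..n. rest \<omega> * w i \<omega> * \<epsilon> i \<omega>)) = 0"
  proof -
    have "expectation (\<lambda>\<omega>. \<Sum>i=1..n. rest \<omega> * w i \<omega> * \<epsilon> i \<omega>) = (\<Sum>i=1..n. expectation (\<lambda>\<omega>. rest \<omega> * w i \<omega> * \<epsilon> i \<omega>))"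
      by (intro Bochner_Integration.integral_sum rest_noise_products)
    then show ?thesis by (simp add: rest_noise_products)
  qed
  also have "\<sigma>\<^sup>2 * (\<Sum>i=1..n. expectation (\<lambda>\<omega>. w i \<omega> * w i \<omega>)) + 0 + expectation (\<lambda>\<omega>. (rest \<omega>)\<^sup>2)
      \<le> \<sigma>\<^sup>2 * (2 * (real k + 1) / (real n * real q) + overlap_bound d) + bias_bound d"
    using expectation_weights_square_le[OF d] expectation_rest_square_le(2)[OF d]
    by (intro add_mono) (auto intro!: mult_left_mono)
  finally show "purf_variance M s n k q X \<epsilon> U \<le> \<sigma>\<^sup>2 * (2 * (real k + 1) / (real n * real q) + overlap_bound d) + bias_bound d" .
qed

end

section \<open>The asymptotic bound\<close>

theorem theorem2:
  fixes M :: "nat \<Rightarrow> 'a measure" and \<mu> s :: "real \<Rightarrow> real" and N :: "real measure"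
    and \<sigma> C :: real and k q :: "nat \<Rightarrow> nat"
    and X \<epsilon> :: "nat \<Rightarrow> nat \<Rightarrow> 'a \<Rightarrow> real" and U :: "nat \<Rightarrow> nat \<Rightarrow> nat \<Rightarrow> 'a \<Rightarrow> real"
  assumes model: "\<And>n. purf_model (M n) \<mu> N \<sigma> n (k n) (q n) (X n) (\<epsilon> n) (U n)"
    and k_lim: "filterlim k at_top sequentially"
    and kn_lim: "(\<lambda>n. real (k n) / real n) \<longlonglongrightarrow> 0"
    and q_lim: "filterlim q at_top sequentially"
    and density_pos: "\<And>x. x \<in> {0..1} \<Longrightarrow> \<mu> x > 0"
    and lipschitz: "C-lipschitz_on {0..1} s"
  shows "\<exists>f :: nat \<Rightarrow> real. f \<in> o(\<lambda>n. real (k n) / real n) \<and>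
    (\<forall>\<^sub>F n in sequentially.
      integrable (M n) (purf_sq_deviation (M n) s n (k n) (q n) (X n) (\<epsilon> n) (U n)) \<and>
      purf_variance (M n) s n (k n) (q n) (X n) (\<epsilon> n) (U n)
        \<le> 3 / 4 * (\<sigma>\<^sup>2 * (real (k n) + 1) / real n) + f n)"
proof -
  have cont: "continuous_on {0..1} \<mu>" using purf_model.density_continuous[OF model] .
  obtain x0 where x0: "x0 \<in> {0..1}" "\<And>x. x \<in> {0..1} \<Longrightarrow> \<mu> x0 \<le> \<mu> x"
    using continuous_attains_inf[OF _ _ cont] by force
  obtain x1 where x1: "x1 \<in> {0..1}" "\<And>x. x \<in> {0..1} \<Longrightarrow> \<mu> x \<le> \<mu> x1"
    using continuous_attains_sup[OF _ _ cont] by force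
  define m mx where "m = \<mu> x0" and "mx = \<mu> x1"
  have m: "0 < m" using density_pos x0 by (simp add: m_def)
  have mx: "0 \<le> mx" using density_pos[OF x1(1)] by (simp add: mx_def)
  obtain r0 where r0: "0 < r0" "\<And>x y. x \<in> {0..1} \<Longrightarrow> y \<in> {0..1} \<Longrightarrow> dist y x < r0 \<Longrightarrow> dist (\<mu> y) (\<mu> x) < m / 5"
    using compact_uniformly_continuous[OF cont compact_Icc] m unfolding uniformly_continuous_on_def
    by (metis divide_pos_pos zero_less_numeral)
  define r where "r = r0 / 2"
  have r: "0 < r" using r0 by (simp add: r_def)
  have osc: "4 / 5 * \<mu> x \<le> \<mu> y" if "x \<in> {0..1}" "y \<in> {0..1}" "\<bar>x - y\<bar> \<le> r" for x y
  proof -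
    have "dist y x < r0" using that(3) r0(1) unfolding dist_real_def r_def by linarith
    with that have "dist (\<mu> y) (\<mu> x) < m / 5" by (intro r0(2))
    moreover have "m \<le> \<mu> x" using x0 that by (simp add: m_def)
    ultimately show ?thesis unfolding dist_real_def by linarith
  qed
  have "compact (s ` {0..1})"
    by (intro compact_continuous_image lipschitz_on_continuous_on[OF lipschitz]) simp
  then obtain B where B: "\<And>x. x \<in> {0..1} \<Longrightarrow> \<bar>s x\<bar> \<le> B"
    using compact_imp_bounded bounded_iff[of "s ` {0..1}"] by (metis imageI real_norm_def)
  have regular: "regular_purf (M n) \<mu> N \<sigma> n (k n) (q n) (X n) (\<epsilon> n) (U n) s C B m mx r"
    if "0 < n" "0 < q n" "2 \<le> k n" for n
    by (intro regular_purf.intro model regular_purf_axioms.intro that m r osc lipschitz B)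
      (use x0 x1 in \<open>auto simp: m_def mx_def\<close>)
  let ?V = "\<lambda>n. purf_variance (M n) s n (k n) (q n) (X n) (\<epsilon> n) (U n)"
  let ?I = "\<lambda>n. integrable (M n) (purf_sq_deviation (M n) s n (k n) (q n) (X n) (\<epsilon> n) (U n))"
  let ?\<rho> = "\<lambda>n. real (k n) / real n"
  have k_inv: "(\<lambda>n. 1 / real (k n)) \<longlonglongrightarrow> 0"
    by (intro tendsto_divide_0[OF tendsto_const] filterlim_at_top_imp_at_infinity
        filterlim_compose[OF filterlim_real_sequentially k_lim])
  have q_inv: "(\<lambda>n. 1 / real (q n)) \<longlonglongrightarrow> 0"
    by (intro tendsto_divide_0[OF tendsto_const] filterlim_at_top_imp_at_infinity
        filterlim_compose[OF filterlim_real_sequentially q_lim])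
  have main: "\<forall>\<^sub>F n in sequentially. ?I n \<and> ?V n \<le> 3 / 4 * (\<sigma>\<^sup>2 * (real (k n) + 1) / real n) + e * ?\<rho> n"
    if e: "0 < e" for e
  proof -
    \<comment> \<open>The first bound on \<open>d\<close> keeps the boundary term of the noise below \<open>1/16\<close>, in addition to the limit
      \<open>5/8 < 11/16\<close> of the other terms; the second one keeps that of the empty cells below \<open>e / 2\<close>.\<close>
    define d where "d = min (m / (128 * (mx + 1))) (e * m / (4 * (mx + 1) * (B\<^sup>2 + 1)))"
    have d: "0 < d" using m mx e by (simp add: d_def add_nonneg_pos)
    have "d * (128 * (mx + 1)) \<le> m"
    proof -
      have "d \<le> m / (128 * (mx + 1))" by (simp add: d_def)
      then show ?thesis using mx by (simp add: pos_le_divide_eq)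
    qed
    then have d1: "8 * d * mx / m \<le> 1 / 16"
    proof -
      have "128 * (d * mx) \<le> d * (128 * (mx + 1))" using d by (simp add: algebra_simps)
      then have "128 * (d * mx) \<le> m" using \<open>d * (128 * (mx + 1)) \<le> m\<close> by linarith
      then show ?thesis using m by (simp add: divide_le_eq)
    qed
    have d2: "B\<^sup>2 * (2 * d * mx / m) \<le> e / 2"
    proof -
      have pos: "0 < 4 * (mx + 1) * (B\<^sup>2 + 1)" using mx by (simp add: add_nonneg_pos)
      have "d \<le> e * m / (4 * (mx + 1) * (B\<^sup>2 + 1))" by (simp add: d_def)
      then have "d * (4 * (mx + 1) * (B\<^sup>2 + 1)) \<le> e * m" using pos by (simp add: pos_le_divide_eq)
      moreover have "d * (4 * mx * B\<^sup>2) \<le> d * (4 * (mx + 1) * (B\<^sup>2 + 1))"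
        using d mx by (intro mult_left_mono mult_mono) auto
      ultimately have "4 * (B\<^sup>2 * d * mx) \<le> e * m" by (simp add: mult_ac)
      then show ?thesis using m by (simp add: divide_le_eq mult_ac)
    qed
    define A where "A n = 4 * (1 / real (q n)) + 5 / 4 * (1 / (2 - 1 / real (k n)) + 1 / d * (1 / real (k n))) +
        1 / (m * r) * (1 / real (k n)) + 6 / m\<^sup>2 * ?\<rho> n" for n
    define E where "E n = B\<^sup>2 * (2 / m\<^sup>2 * ?\<rho> n) + 2 * C\<^sup>2 / m * (1 / real (k n))" for n
    have "A \<longlonglongrightarrow> 4 * 0 + 5 / 4 * (1 / (2 - 0) + 1 / d * 0) + 1 / (m * r) * 0 + 6 / m\<^sup>2 * 0"
      unfolding A_def by (intro tendsto_intros q_inv k_inv kn_lim) simp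
    then have A_lim: "\<forall>\<^sub>F n in sequentially. A n < 11 / 16"
      by (rule order_tendstoD) simp
    have "E \<longlonglongrightarrow> B\<^sup>2 * (2 / m\<^sup>2 * 0) + 2 * C\<^sup>2 / m * 0"
      unfolding E_def by (intro tendsto_intros k_inv kn_lim)
    then have E_lim: "\<forall>\<^sub>F n in sequentially. E n < e / 2"
      by (rule order_tendstoD) (use e in simp)
    have k2: "\<forall>\<^sub>F n in sequentially. 2 \<le> k n \<and> 1 / d \<le> real (k n)"
      using k_lim filterlim_compose[OF filterlim_real_sequentially k_lim]
      unfolding filterlim_at_top by (intro eventually_conj) auto
    have q1: "\<forall>\<^sub>F n in sequentially. 1 \<le> q n"
      using q_lim unfolding filterlim_at_top by auto
    from A_lim E_lim k2 q1 eventually_gt_at_top[of 0] show ?thesis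
    proof eventually_elim
      case (elim n)
      then have n: "0 < n" and q: "0 < q n" and k: "2 \<le> k n" by auto
      interpret regular_purf "M n" \<mu> N \<sigma> n "k n" "q n" "X n" "\<epsilon> n" "U n" s C B m mx r
        by (rule regular) fact+
      have kd: "1 \<le> real (k n) * d" using elim(3) d by (simp add: divide_le_eq)
      have \<rho>: "0 \<le> ?\<rho> n" by simp
      have k0: "0 < real (k n)" using k by simp
      have ob: "2 * (real (k n) + 1) / (real n * real (q n)) + overlap_bound d \<le> ?\<rho> n * (A n + 8 * d * mx / m)"
      proof -
        have "2 * (real (k n) + 1) / (real n * real (q n)) \<le> 4 * real (k n) / (real n * real (q n))"
          using k by (intro divide_right_mono) auto
        also have "\<dots> = ?\<rho> n * (4 * (1 / real (q n)))" by simp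
        finally have 1: "2 * (real (k n) + 1) / (real n * real (q n)) \<le> ?\<rho> n * (4 * (1 / real (q n)))" .
        have "(real (k n))\<^sup>2 / (2 * real (k n) - 1) = real (k n) * (1 / (2 - 1 / real (k n)))"
          using k by (simp add: field_simps power2_eq_square)
        moreover have "1 / d = real (k n) * (1 / d * (1 / real (k n)))" using k0 by simp
        ultimately have si: "sum_inverse d = real (k n) * (1 / (2 - 1 / real (k n)) + 1 / d * (1 / real (k n)))"
          unfolding sum_inverse_def by (simp only: distrib_left)
        have "5 / 4 * (a * z) / c = a / c * (5 / 4 * z)" for a c z :: real by simp
        then have 2: "5 / 4 * sum_inverse d / real n = ?\<rho> n * (5 / 4 * (1 / (2 - 1 / real (k n)) + 1 / d * (1 / real (k n))))"
          unfolding si .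
        have 3: "1 / (real n * (m * r)) = ?\<rho> n * (1 / (m * r) * (1 / real (k n)))" using k0 by simp
        have 4: "6 * (real (k n))\<^sup>2 / (real n * m)\<^sup>2 = ?\<rho> n * (6 / m\<^sup>2 * ?\<rho> n)"
          by (simp add: power2_eq_square mult_ac)
        have 5: "8 * d * mx * real (k n) / (real n * m) = ?\<rho> n * (8 * d * mx / m)" by simp
        have add_up: "x + (p * b + p * c + p * f + p * g) \<le> p * (a + b + c + f + g)" if "x \<le> p * a"
          for x p a b c f g :: real
          using that by (simp add: distrib_left)
        show ?thesis
          unfolding overlap_bound_def 2 3 4 5 A_def by (rule add_up[OF 1])
      qed
      also have "\<dots> \<le> ?\<rho> n * (3 / 4)"
        using elim(1) d1 by (intro mult_left_mono \<rho>) linarith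
      finally have noise: "\<sigma>\<^sup>2 * (2 * (real (k n) + 1) / (real n * real (q n)) + overlap_bound d) \<le> \<sigma>\<^sup>2 * (?\<rho> n * (3 / 4))"
        by (intro mult_left_mono) auto
      have bb: "bias_bound d \<le> e * ?\<rho> n"
      proof -
        have "bias_bound d = ?\<rho> n * (E n + B\<^sup>2 * (2 * d * mx / m))"
        proof -
          have "2 * C\<^sup>2 / (real n * m) = ?\<rho> n * (2 * C\<^sup>2 / m * (1 / real (k n)))" using k0 by simp
          moreover have "2 * (real (k n) / (real n * m))\<^sup>2 = ?\<rho> n * (2 / m\<^sup>2 * ?\<rho> n)"
            by (simp add: power2_eq_square mult_ac)
          moreover have "2 * d * mx * real (k n) / (real n * m) = ?\<rho> n * (2 * d * mx / m)" by simp
          ultimately show ?thesis unfolding bias_bound_def E_def by (simp only: distrib_left mult.left_commute[of "B\<^sup>2"] add.commute add.left_commute)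
        qed
        also have "\<dots> \<le> ?\<rho> n * e" using elim(2) d2 by (intro mult_left_mono \<rho>) linarith
        finally show ?thesis by (simp add: mult.commute)
      qed
      have "?V n \<le> \<sigma>\<^sup>2 * (?\<rho> n * (3 / 4)) + e * ?\<rho> n"
        using purf_variance_le(2)[OF d kd] noise bb by linarith
      also have "\<sigma>\<^sup>2 * (?\<rho> n * (3 / 4)) \<le> 3 / 4 * (\<sigma>\<^sup>2 * (real (k n) + 1) / real n)"
      proof -
        have "\<sigma>\<^sup>2 * real (k n) / real n \<le> \<sigma>\<^sup>2 * (real (k n) + 1) / real n"
          by (intro divide_right_mono mult_left_mono) auto
        then show ?thesis by simp
      qed
      finally show ?case using purf_variance_le(1)[OF d kd] by simp
    qed
  qed
  \<comment> \<open>The excess over the claimed main term is the smallest admissible error function.\<close>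
  define f where "f n = max 0 (?V n - 3 / 4 * (\<sigma>\<^sup>2 * (real (k n) + 1) / real n))" for n
  have "f \<in> o(\<lambda>n. real (k n) / real n)"
  proof (rule landau_o.smallI)
    fix e :: real assume "0 < e"
    from main[OF this] show "\<forall>\<^sub>F n in sequentially. norm (f n) \<le> e * norm (real (k n) / real n)"
    proof eventually_elim
      case (elim n)
      have "0 \<le> e * ?\<rho> n" using \<open>0 < e\<close> by simp
      with elim have "f n \<le> e * ?\<rho> n" "0 \<le> f n" by (auto simp: f_def)
      then show ?case by simp
    qed
  qed
  moreover have "\<forall>\<^sub>F n in sequentially. ?I n \<and> ?V n \<le> 3 / 4 * (\<sigma>\<^sup>2 * (real (k n) + 1) / real n) + f n"
    using main[OF zero_less_one] by eventually_elim (simp add: f_def)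
  ultimately show ?thesis by blast
qed

end
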